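(* Let $G=(V,E)$ be a 3-edge-connected cubic graph. Then the everywhere $\frac{8}{9}$ vector for $G$ dominates a convex combination of incidence vectors of 2-edge-connected spanning subgraphs of $G$ (no edge used more than once), and such a convex combination can be found in time polynomial in the size of $G$.
   Context: A 2-edge-connected spanning subgraph of $G$ is a subset $F\subseteq E$ such that $(V,F)$ is connected and remains connected after deleting any single edge; its incidence vector is $\chi^F\in\{0,1\}^E$. The everywhere $\alpha$ vector for $G$ is the vector in $\mathbb{R}^E$ with all coordinates $\alpha$. A vector $a$ dominates $b$ if $a_i\ge b_i$ coordinatewise. Cubic means every vertex has degree 3. *)

theory Defs
  imports Complex_Main "HOL-Library.Indicator_Function" "HOL-Computational_Algebra.Polynomial"
begin

section \<open>Graphs\<close>

text \<open>
  Finite loopless graphs; edges are named objects, so parallel edges are allowed.  Simple graphs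
  are the case of an injective end-point map.  Excluding loops loses nothing for connected cubic
  graphs without bridges: a loop uses up two of the three edge ends at its vertex.
\<close>

record ('v, 'e) graph =
  verts :: "'v set"
  edges :: "'e set"
  ends :: "'e \<Rightarrow> 'v set"

definition wf_graph :: "('v, 'e) graph \<Rightarrow> bool" where
  "wf_graph G \<longleftrightarrow> finite (verts G) \<and> finite (edges G) \<and>
     (\<forall>e\<in>edges G. ends G e \<subseteq> verts G \<and> card (ends G e) = 2)"

definition degree_in :: "('v, 'e) graph \<Rightarrow> 'v \<Rightarrow> nat" where
  "degree_in G v = card {e \<in> edges G. v \<in> ends G e}"

definition cubic :: "('v, 'e) graph \<Rightarrow> bool" where
  "cubic G \<longleftrightarrow> (\<forall>v\<in>verts G. degree_in G v = 3)"

definition adj_by :: "('v, 'e) graph \<Rightarrow> 'e set \<Rightarrow> ('v \<times> 'v) set" where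
  "adj_by G F = {(u, v). \<exists>e\<in>F. ends G e = {u, v}}"

text \<open>Connectedness of the spanning subgraph \<open>(V, F)\<close>; the graph without vertices does not count
  as connected.\<close>

definition connected_by :: "('v, 'e) graph \<Rightarrow> 'e set \<Rightarrow> bool" where
  "connected_by G F \<longleftrightarrow> verts G \<noteq> {} \<and> (\<forall>u\<in>verts G. \<forall>v\<in>verts G. (u, v) \<in> (adj_by G F)\<^sup>*)"

definition edge_connected :: "nat \<Rightarrow> ('v, 'e) graph \<Rightarrow> bool" where
  "edge_connected k G \<longleftrightarrow> (\<forall>D\<subseteq>edges G. card D < k \<longrightarrow> connected_by G (edges G - D))"

definition two_edge_connected_spanning :: "('v, 'e) graph \<Rightarrow> 'e set \<Rightarrow> bool" where
  "two_edge_connected_spanning G F \<longleftrightarrow> F \<subseteq> edges G \<and> connected_by G F \<and>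
     (\<forall>e\<in>F. connected_by G (F - {e}))"


section \<open>Convex combinations of incidence vectors\<close>

text \<open>
  Vectors indexed by the edge set \<open>E\<close> are functions of which only the values on \<open>E\<close> matter, and
  the incidence vector of \<open>F\<close> is \<^term>\<open>indicator F\<close>.  A list of weighted edge sets stands for
  the corresponding linear combination of incidence vectors.
\<close>

definition dominates_on :: "'e set \<Rightarrow> ('e \<Rightarrow> real) \<Rightarrow> ('e \<Rightarrow> real) \<Rightarrow> bool" where
  "dominates_on E a b \<longleftrightarrow> (\<forall>e\<in>E. a e \<ge> b e)"

definition combination :: "(real \<times> 'e set) list \<Rightarrow> 'e \<Rightarrow> real" where
  "combination c e = (\<Sum>(w, F)\<leftarrow>c. w * indicator F e)"

definition convex_weights :: "(real \<times> 'e set) list \<Rightarrow> bool" where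
  "convex_weights c \<longleftrightarrow> (\<forall>(w, F)\<in>set c. w \<ge> 0) \<and> (\<Sum>(w, F)\<leftarrow>c. w) = 1"

definition dominated_2ec_combination ::
    "('v, 'e) graph \<Rightarrow> ('e \<Rightarrow> real) \<Rightarrow> (real \<times> 'e set) list \<Rightarrow> bool" where
  "dominated_2ec_combination G a c \<longleftrightarrow>
     convex_weights c \<and> (\<forall>(w, F)\<in>set c. two_edge_connected_spanning G F) \<and>
     dominates_on (edges G) a (combination c)"


section \<open>Model of computation\<close>

text \<open>
  A first-order, call-by-value, recursive language over binary trees (pure LISP without atoms
  other than the empty one).  A program is a list of function bodies, in which variables are de
  Bruijn indices into the environment; the entry point is the body number 0.

  Every evaluation step costs one unit.  This is realistic because the only operations are
  pointer operations: \<open>t\<close> steps allocate at most \<open>t\<close> cells, so with values kept as shared heap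
  structures a Turing machine can follow a run with polynomial overhead (and, conversely, the
  language simulates Turing machines with polynomial overhead).  Sharing can however make a tree
  exponentially larger than the number of cells representing it.  Therefore \<open>runs_within\<close> below
  charges for the full size of the output in addition to the evaluation steps.
\<close>

datatype tree = Leaf | Node tree tree

datatype expr =
    EVar nat
  | ELeaf
  | ENode expr expr
  | ELeft expr
  | ERight expr
  | EIf expr expr expr
  | ELet expr expr
  | ECall nat "expr list"

type_synonym program = "expr list"

inductive
  eval :: "program \<Rightarrow> tree list \<Rightarrow> expr \<Rightarrow> tree \<Rightarrow> nat \<Rightarrow> bool" and
  evals :: "program \<Rightarrow> tree list \<Rightarrow> expr list \<Rightarrow> tree list \<Rightarrow> nat \<Rightarrow> bool"
  for P :: program
where
  Var: "i < length env \<Longrightarrow> eval P env (EVar i) (env ! i) 1"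
| Leaf: "eval P env ELeaf Leaf 1"
| Node: "eval P env a x s \<Longrightarrow> eval P env b y t \<Longrightarrow> eval P env (ENode a b) (Node x y) (s + t + 1)"
| Left: "eval P env a (Node x y) s \<Longrightarrow> eval P env (ELeft a) x (s + 1)"
| Left_Leaf: "eval P env a Leaf s \<Longrightarrow> eval P env (ELeft a) Leaf (s + 1)"
| Right: "eval P env a (Node x y) s \<Longrightarrow> eval P env (ERight a) y (s + 1)"
| Right_Leaf: "eval P env a Leaf s \<Longrightarrow> eval P env (ERight a) Leaf (s + 1)"
| If_Node: "eval P env a (Node x y) s \<Longrightarrow> eval P env b z t \<Longrightarrow> eval P env (EIf a b c) z (s + t + 1)"
| If_Leaf: "eval P env a Leaf s \<Longrightarrow> eval P env c z t \<Longrightarrow> eval P env (EIf a b c) z (s + t + 1)"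
| Let: "eval P env a x s \<Longrightarrow> eval P (x # env) b y t \<Longrightarrow> eval P env (ELet a b) y (s + t + 1)"
| Call: "f < length P \<Longrightarrow> evals P env as xs s \<Longrightarrow> eval P xs (P ! f) y t \<Longrightarrow>
    eval P env (ECall f as) y (s + t + 1)"
| Args_Nil: "evals P env [] [] 0"
| Args_Cons: "eval P env a x s \<Longrightarrow> evals P env as xs t \<Longrightarrow> evals P env (a # as) (x # xs) (s + t)"

lemma eval_deterministic:
  "eval P env a x s \<Longrightarrow> eval P env a y t \<Longrightarrow> x = y \<and> s = t"
  "evals P env as xs s \<Longrightarrow> evals P env as ys t \<Longrightarrow> xs = ys \<and> s = t"
proof (induction arbitrary: y t and ys t rule: eval_evals.inducts)
  case (Var i env) from Var.prems show ?case by cases auto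
next
  case (Leaf env) from Leaf.prems show ?case by cases auto
next
  case (Node env a x s b y' t') from Node.prems show ?case by cases (use Node.IH in blast)
next
  case (Left env a x y' s) from Left.prems show ?case by cases (use Left.IH in blast)+
next
  case (Left_Leaf env a s) from Left_Leaf.prems show ?case by cases (use Left_Leaf.IH in blast)+
next
  case (Right env a x y' s) from Right.prems show ?case by cases (use Right.IH in blast)+
next
  case (Right_Leaf env a s) from Right_Leaf.prems show ?case by cases (use Right_Leaf.IH in blast)+
next
  case (If_Node env a x y' s b z t' c)
  from If_Node.prems show ?case by cases (use If_Node.IH in blast)+
next
  case (If_Leaf env a s c z t' b)
  from If_Leaf.prems show ?case by cases (use If_Leaf.IH in blast)+
next
  case (Let env a x s b y' t') from Let.prems show ?case by cases (use Let.IH in blast)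
next
  case (Call f env as xs s y' t') from Call.prems show ?case by cases (use Call.IH in blast)
next
  case (Args_Nil env) from Args_Nil.prems show ?case by cases auto
next
  case (Args_Cons env a x s as xs t')
  from Args_Cons.prems show ?case by cases (use Args_Cons.IH in blast)
qed

definition runs_within :: "program \<Rightarrow> tree \<Rightarrow> tree \<Rightarrow> nat \<Rightarrow> bool" where
  "runs_within P x y T \<longleftrightarrow> P \<noteq> [] \<and> (\<exists>t. eval P [x] (P ! 0) y t \<and> t + size y \<le> T)"


section \<open>Encoding of inputs and outputs\<close>

definition enc_bit :: "bool \<Rightarrow> tree" where
  "enc_bit b = (if b then Node Leaf Leaf else Leaf)"

text \<open>Binary notation, least significant bit first, without leading zeros.\<close>

fun enc_nat :: "nat \<Rightarrow> tree" where
  "enc_nat n = (if n = 0 then Leaf else Node (enc_bit (odd n)) (enc_nat (n div 2)))"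

declare enc_nat.simps [simp del]

definition enc_pair :: "('a \<Rightarrow> tree) \<Rightarrow> ('b \<Rightarrow> tree) \<Rightarrow> 'a \<times> 'b \<Rightarrow> tree" where
  "enc_pair f g = (\<lambda>(a, b). Node (f a) (g b))"

definition enc_list :: "('a \<Rightarrow> tree) \<Rightarrow> 'a list \<Rightarrow> tree" where
  "enc_list f xs = foldr (\<lambda>x. Node (f x)) xs Leaf"

lemma inj_enc_nat: "inj enc_nat"
proof (rule injI)
  show "enc_nat m = enc_nat n \<Longrightarrow> m = n" for m n
  proof (induction m arbitrary: n rule: less_induct)
    case (less m)
    show ?case
    proof (cases "m = 0 \<or> n = 0")
      case True
      then show ?thesis using less.prems by (auto simp: enc_nat.simps split: if_splits)
    next
      case False
      then have "enc_bit (odd m) = enc_bit (odd n)" "enc_nat (m div 2) = enc_nat (n div 2)"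
        using less.prems by (simp_all add: enc_nat.simps [of m] enc_nat.simps [of n])
      then have "odd m = odd n" "m div 2 = n div 2"
        using less.IH [of "m div 2" "n div 2"] False by (auto simp: enc_bit_def split: if_splits)
      then show ?thesis by presburger
    qed
  qed
qed

lemma inj_enc_pair: "inj f \<Longrightarrow> inj g \<Longrightarrow> inj (enc_pair f g)"
  by (auto simp: inj_def enc_pair_def)

lemma inj_enc_list:
  assumes "inj f"
  shows "inj (enc_list f)"
proof (rule injI)
  show "enc_list f xs = enc_list f ys \<Longrightarrow> xs = ys" for xs ys
  proof (induction xs arbitrary: ys)
    case Nil
    then show ?case by (cases ys) (auto simp: enc_list_def)
  next
    case (Cons x xs)
    then show ?case using assms by (cases ys) (auto simp: enc_list_def inj_def)
  qed
qed

text \<open>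
  A graph is given to a program as its number \<open>n\<close> of vertices, which are \<open>0, \<dots>, n - 1\<close>, and the
  list of the end-point pairs of its edges.  The edges are the positions in that list.
\<close>

definition graph_of :: "nat \<Rightarrow> (nat \<times> nat) list \<Rightarrow> (nat, nat) graph" where
  "graph_of n es = \<lparr>verts = {..<n}, edges = {..<length es},
     ends = (\<lambda>i. {fst (es ! i), snd (es ! i)})\<rparr>"

definition enc_graph :: "nat \<Rightarrow> (nat \<times> nat) list \<Rightarrow> tree" where
  "enc_graph n es = enc_pair enc_nat (enc_list (enc_pair enc_nat enc_nat)) (n, es)"

text \<open>A program describes a combination by a list of weights \<open>p / q\<close>, each together with a list of
  edges.\<close>

type_synonym weighted_lists = "((nat \<times> nat) \<times> nat list) list"

definition enc_weighted :: "weighted_lists \<Rightarrow> tree" where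
  "enc_weighted = enc_list (enc_pair (enc_pair enc_nat enc_nat) (enc_list enc_nat))"

definition positive_denominators :: "weighted_lists \<Rightarrow> bool" where
  "positive_denominators ws \<longleftrightarrow> (\<forall>((p, q), F)\<in>set ws. q > 0)"

definition weighted_sets :: "weighted_lists \<Rightarrow> (real \<times> nat set) list" where
  "weighted_sets = map (\<lambda>((p, q), F). (real p / real q, set F))"

end

theory Submission imports Defs begin

text \<open>
  It suffices to cover the edges by nine sets whose complements are 2-edge-connected; the nine
  complements then get weight \<open>1/9\<close> each.

  Every edge is missing from one of three spanning trees.  Indeed, a 3-edge-connected cubic graph with
  more than two vertices has an edge \<open>e = uv\<close> that lies in no nontrivial 3-edge cut.  Deleting \<open>e\<close> and
  suppressing \<open>u\<close> and \<open>v\<close> gives a smaller graph of the same kind, and a 3-colouring of its edges such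
  that the complement of each colour class is connected extends to the larger graph.

  Given a spanning tree, 3-colour the remaining edges so that every fundamental cut contains two
  colours: then the graph stays 2-edge-connected when one colour is removed.  The shores of the
  fundamental cuts form a laminar family.  Going through the cuts from the root to the leaves and
  colouring greedily, each end of an edge forbids at most one colour, so that three colours suffice.

  The choices are found by exhaustive search among polynomially many candidates.
\<close>

section \<open>Cuts and spanning trees\<close>

text \<open>The constant 8/9 comes from 3 * 3 subgraphs, each edge being absent from at least one of
  them: the first factor chooses a tree that misses the edge, the second the colour that the edge
  then receives. The greedy colouring can succeed because a fundamental cut has one tree edge and
  therefore at least two others. Cuts with several tree edges need no care. The obstacle in finding
  the trees is that an edge of a nontrivial 3-edge cut leaves a 2-edge cut when it is deleted and
  its ends are suppressed, and that a colouring has to keep three graphs connected at once when it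
  is lifted back. Both stages argue with vertex sets that no edge crosses, since these are closed
  under symmetric difference. Whether a deletion or a recolouring is admissible is a matter of
  connectedness and can be tested. So the structural arguments only have to prove existence: a round
  examines at most one deletion per edge, and later 3^5 recolourings.\<close>

type_synonym ('e, 'v) edge = "'e \<times> 'v \<times> 'v"

abbreviation src :: "('e, 'v) edge \<Rightarrow> 'v" where "src e \<equiv> fst (snd e)"
abbreviation tgt :: "('e, 'v) edge \<Rightarrow> 'v" where "tgt e \<equiv> snd (snd e)"

definition crosses :: "'v set \<Rightarrow> ('e, 'v) edge \<Rightarrow> bool" where
  "crosses S e \<longleftrightarrow> (src e \<in> S) \<noteq> (tgt e \<in> S)"

abbreviation same :: "'v set \<Rightarrow> 'v \<Rightarrow> 'v \<Rightarrow> bool" where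
  "same S u v \<equiv> u \<in> S \<longleftrightarrow> v \<in> S"

abbreviation undivided :: "'v set \<Rightarrow> 'v set \<Rightarrow> bool" where
  "undivided V S \<equiv> V \<subseteq> S \<or> V \<inter> S = {}"

text \<open>Connectedness without paths: a set that no edge of \<open>F\<close> crosses cannot split
  \<open>V\<close>. In this form symmetric differences of sets can serve as witnesses.\<close>

definition con :: "'v set \<Rightarrow> ('e, 'v) edge set \<Rightarrow> bool" where
  "con V F \<longleftrightarrow> (\<forall>S. (\<forall>e\<in>F. \<not> crosses S e) \<longrightarrow> undivided V S)"

text \<open>Crossing is a parity, the number of ends in the set modulo 2, and parities add up under
  symmetric difference.\<close>

lemma crosses_xor: "crosses {x. (x \<in> S) \<noteq> (x \<in> T)} e \<longleftrightarrow> crosses S e \<noteq> crosses T e"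
  by (auto simp: crosses_def)

lemma con_mono: "con V F \<Longrightarrow> F \<subseteq> F' \<Longrightarrow> con V F'"
  unfolding con_def by blast

lemma connected_by_iff_con:
  assumes "\<And>e. e \<in> F \<Longrightarrow> ends G (fst e) = {src e, tgt e}"
  shows "connected_by G (fst ` F) \<longleftrightarrow> verts G \<noteq> {} \<and> con (verts G) F"
proof (intro iffI conjI)
  assume c: "connected_by G (fst ` F)"
  then show "verts G \<noteq> {}" by (simp add: connected_by_def)
  show "con (verts G) F" unfolding con_def
  proof (intro allI impI)
    fix S assume nc: "\<forall>e\<in>F. \<not> crosses S e"
    have "same S u v" if "(u, v) \<in> (adj_by G (fst ` F))\<^sup>*" for u v
      using that
    proof (induction rule: rtrancl_induct)
      case (step y z)
      then obtain e where "e \<in> F" "ends G (fst e) = {y, z}" by (auto simp: adj_by_def)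
      then have "same S y z"
        using nc assms[of e] by (auto simp: crosses_def doubleton_eq_iff)
      with step show ?case by simp
    qed simp
    with c show "undivided (verts G) S" unfolding connected_by_def by blast
  qed
next
  assume "verts G \<noteq> {} \<and> con (verts G) F"
  then have ne: "verts G \<noteq> {}" and c: "con (verts G) F" by auto
  have "(u, v) \<in> (adj_by G (fst ` F))\<^sup>*" if uv: "u \<in> verts G" "v \<in> verts G" for u v
  proof -
    \<comment> \<open>The set of vertices reachable from \<open>u\<close> is the test set, since no
      edge of \<open>F\<close> leaves it.\<close>
    let ?S = "{v. (u, v) \<in> (adj_by G (fst ` F))\<^sup>*}"
    have "\<not> crosses ?S e" if "e \<in> F" for e
    proof -
      have "(src e, tgt e) \<in> adj_by G (fst ` F)" "(tgt e, src e) \<in> adj_by G (fst ` F)"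
        using that assms[OF that] by (force simp: adj_by_def insert_commute)+
      then show ?thesis by (auto simp: crosses_def intro: rtrancl_into_rtrancl)
    qed
    then have "verts G \<subseteq> ?S \<or> verts G \<inter> ?S = {}" using c unfolding con_def by blast
    then show ?thesis using uv by blast
  qed
  with ne show "connected_by G (fst ` F)" by (simp add: connected_by_def)
qed

section \<open>Growing a spanning tree together with its fundamental cuts\<close>

type_synonym ('e, 'v) tree_cuts = "(('e, 'v) edge \<times> 'v list) list"

abbreviation attach :: "'v \<Rightarrow> 'v \<Rightarrow> ('e, 'v) edge \<times> 'v list \<Rightarrow> ('e, 'v) edge \<times> 'v list" where
  "attach p w q \<equiv> (fst q, if p \<in> set (snd q) then w # snd q else snd q)"

text \<open>A new leaf \<open>w\<close> joins every shore that contains its neighbour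
  \<open>p\<close>, which keeps the fundamental cuts up to date while the tree grows. Without a
  crossing edge the state stays as it is, so surplus rounds do no harm.\<close>

definition grow_step ::
    "('e, 'v) edge list \<Rightarrow> 'v list \<times> ('e, 'v) tree_cuts \<Rightarrow> 'v list \<times> ('e, 'v) tree_cuts"
where
  "grow_step E st = (case filter (crosses (set (fst st))) E of [] \<Rightarrow> st
     | t # _ \<Rightarrow> let w = if src t \<in> set (fst st) then tgt t else src t;
                  p = if src t \<in> set (fst st) then src t else tgt t
              in (w # fst st,
                  (t, [w]) # map (attach p w) (snd st)))"

definition grow :: "'v list \<Rightarrow> ('e, 'v) edge list \<Rightarrow> 'v list \<times> ('e, 'v) tree_cuts" where
  "grow V E = (case V of [] \<Rightarrow> ([], []) | r # _ \<Rightarrow> (grow_step E ^^ length V) ([r], []))"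

definition connects :: "'v list \<Rightarrow> ('e, 'v) edge list \<Rightarrow> bool" where
  "connects V E \<longleftrightarrow> set V \<subseteq> set (fst (grow V E))"

text \<open>The second conjunct puts a set before its proper supersets. A \<open>foldr\<close>
  starts at the end of the list and so meets the larger shores earlier, which is the order from the
  root to the leaves.\<close>

definition laminar :: "'v set list \<Rightarrow> bool" where
  "laminar Ds \<longleftrightarrow> (\<forall>A\<in>set Ds. \<forall>B\<in>set Ds. A \<subseteq> B \<or> B \<subseteq> A \<or> A \<inter> B = {})
     \<and> sorted_wrt (\<lambda>A B. \<not> B \<subset> A) Ds"

text \<open>The tree edges are listed from the latest to the oldest, each with the vertices on its side
  away from the root.\<close>

definition tree_family :: "'v set \<Rightarrow> ('e, 'v) tree_cuts \<Rightarrow> bool" where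
  "tree_family W L \<longleftrightarrow> con W (fst ` set L)
    \<and> (\<forall>q\<in>set L. src (fst q) \<in> W \<and> tgt (fst q) \<in> W \<and> snd q \<noteq> [] \<and> set (snd q) \<subseteq> W)
    \<and> (\<forall>q\<in>set L. \<forall>q'\<in>set L. crosses (set (snd q)) (fst q') \<longleftrightarrow> fst q = fst q')
    \<and> laminar (map (set \<circ> snd) L)
    \<and> (\<forall>x\<in>W. \<forall>y\<in>W. x \<noteq> y \<longrightarrow> (\<exists>q\<in>set L. (x \<in> set (snd q)) \<noteq> (y \<in> set (snd q))))"

text \<open>The new element \<open>w\<close> enters exactly the sets that contain \<open>p\<close>.
  Being a twin of \<open>p\<close>, it can neither break an inclusion nor make disjoint sets
  meet.\<close>

lemma nested_insert:
  assumes "A \<subseteq> B \<or> B \<subseteq> A \<or> A \<inter> B = {}" "w \<notin> A" "w \<notin> B"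
  shows "(if p \<in> A then insert w A else A) \<subseteq> (if p \<in> B then insert w B else B) \<or>
    (if p \<in> B then insert w B else B) \<subseteq> (if p \<in> A then insert w A else A) \<or>
    (if p \<in> A then insert w A else A) \<inter> (if p \<in> B then insert w B else B) = {}"
  using assms by (cases "p \<in> A"; cases "p \<in> B"; simp; blast)

lemma psubset_insert:
  assumes "(if p \<in> A then insert w A else A) \<subset> (if p \<in> B then insert w B else B)" "w \<notin> B" "w \<notin> A"
  shows "A \<subset> B"
  using assms by (cases "p \<in> A"; cases "p \<in> B"; simp; blast)

text \<open>In every old shore the leaf \<open>w\<close> is on the side of \<open>p\<close>, so the
  new edge \<open>t\<close> crosses none of them; the new shore consists of \<open>w\<close> alone
  and is crossed by no old edge.\<close>

lemma tree_family_extend: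
  fixes L :: "('e, 'v) tree_cuts"
  assumes tf: "tree_family W L" and p: "p \<in> W" and w: "w \<notin> W"
    and t: "src t = p \<and> tgt t = w \<or> src t = w \<and> tgt t = p"
  shows "tree_family (insert w W)
    ((t, [w]) # map (attach p w) L)"
    (is "tree_family _ (_ # map ?u L)")
proof -
  have c: "con W (fst ` set L)"
    and endp: "\<And>q. q \<in> set L \<Longrightarrow> src (fst q) \<in> W \<and> tgt (fst q) \<in> W \<and> snd q \<noteq> [] \<and> set (snd q) \<subseteq> W"
    and fund: "\<And>q q'. q \<in> set L \<Longrightarrow> q' \<in> set L \<Longrightarrow> crosses (set (snd q)) (fst q') \<longleftrightarrow> fst q = fst q'"
    and lam: "laminar (map (set \<circ> snd) L)"
    and sep: "\<And>x y. x \<in> W \<Longrightarrow> y \<in> W \<Longrightarrow> x \<noteq> y \<Longrightarrow> \<exists>q\<in>set L. (x \<in> set (snd q)) \<noteq> (y \<in> set (snd q))"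
    using tf unfolding tree_family_def by auto
  have pw: "p \<noteq> w" using p w by auto
  have old: "x \<in> set (snd (?u q)) \<longleftrightarrow> x \<in> set (snd q)" if "x \<in> W" for x q
    using that w by auto
  have new: "w \<in> set (snd (?u q)) \<longleftrightarrow> p \<in> set (snd q)" if "q \<in> set L" for q
    using endp[OF that] w by auto
  have sub: "set (snd (?u q)) \<subseteq> insert w W" if "q \<in> set L" for q
    using endp[OF that] by auto
  have wq: "w \<notin> set (snd q)" if "q \<in> set L" for q
    using endp[OF that] w by auto
  have 1: "con (insert w W) (fst ` set ((t, [w]) # map ?u L))" unfolding con_def
  proof (intro allI impI)
    fix S assume S: "\<forall>e\<in>fst ` set ((t, [w]) # map ?u L). \<not> crosses S e"
    have "\<forall>e\<in>fst ` set L. \<not> crosses S e" using S by (simp add: image_image)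
    then have "undivided W S" using c unfolding con_def by blast
    moreover have "same S p w" using S t by (auto simp: crosses_def)
    ultimately show "undivided (insert w W) S" using p by blast
  qed
  have 2: "\<forall>q\<in>set ((t, [w]) # map ?u L). src (fst q) \<in> insert w W \<and> tgt (fst q) \<in> insert w W
      \<and> snd q \<noteq> [] \<and> set (snd q) \<subseteq> insert w W"
  proof
    fix q assume "q \<in> set ((t, [w]) # map ?u L)"
    then consider "q = (t, [w])" | r where "r \<in> set L" "q = ?u r" by auto
    then show "src (fst q) \<in> insert w W \<and> tgt (fst q) \<in> insert w W
      \<and> snd q \<noteq> [] \<and> set (snd q) \<subseteq> insert w W"
    proof cases
      case 1
      then show ?thesis using t p by auto
    next
      case 2
      then show ?thesis using endp[OF 2(1)] sub[OF 2(1)] by simp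
    qed
  qed
  have mem: "q \<in> set ((t, [w]) # map ?u L) \<longleftrightarrow> q = (t, [w]) \<or> (\<exists>r\<in>set L. q = ?u r)" for q
    by (simp only: list.set set_map insert_iff image_iff)
  have tL: "t \<noteq> fst q" if "q \<in> set L" for q using endp[OF that] t w by auto
  have cr: "crosses (set (snd (?u q))) (fst q') \<longleftrightarrow> fst q = fst q'" if "q \<in> set L" "q' \<in> set L" for q q'
  proof -
    have "crosses (set (snd (?u q))) (fst q') \<longleftrightarrow> crosses (set (snd q)) (fst q')"
      unfolding crosses_def using old[of _ q] endp[OF that(2)] by blast
    then show ?thesis using fund that by simp
  qed
  have crt: "\<not> crosses (set (snd (?u q))) t" if "q \<in> set L" for q
    using t old[OF p, of q] new[OF that] unfolding crosses_def by blast
  have crw: "\<not> crosses {w} (fst q)" if "q \<in> set L" for q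
    using endp[OF that] w by (auto simp: crosses_def)
  have tt: "crosses {w} t" using t pw by (auto simp: crosses_def)
  have 3: "\<forall>q\<in>set ((t, [w]) # map ?u L). \<forall>q'\<in>set ((t, [w]) # map ?u L).
      crosses (set (snd q)) (fst q') \<longleftrightarrow> fst q = fst q'"
  proof -
    have "crosses (set (snd q)) (fst q') \<longleftrightarrow> fst q = fst q'"
      if q: "q = (t, [w]) \<or> (\<exists>r\<in>set L. q = ?u r)" and q': "q' = (t, [w]) \<or> (\<exists>r\<in>set L. q' = ?u r)"
      for q q'
    proof (cases "q = (t, [w])")
      case True
      show ?thesis
      proof (cases "q' = (t, [w])")
        case False
        then obtain r where r: "r \<in> set L" "q' = ?u r" using q' by blast
        show ?thesis unfolding True r(2) fst_conv snd_conv using crw[OF r(1)] tL[OF r(1)] by simp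
      qed (simp add: True tt)
    next
      case False
      then obtain r where r: "r \<in> set L" "q = ?u r" using q by blast
      show ?thesis
      proof (cases "q' = (t, [w])")
        case True
        show ?thesis using crt[OF r(1)] tL[OF r(1)] unfolding True r(2) fst_conv by metis
      next
        case False
        then obtain r' where r': "r' \<in> set L" "q' = ?u r'" using q' by blast
        show ?thesis using cr[OF r(1) r'(1)] unfolding r(2) r'(2) fst_conv .
      qed
    qed
    then show ?thesis by (intro ballI) (simp only: mem)
  qed
  have lam1: "A \<subseteq> B \<or> B \<subseteq> A \<or> A \<inter> B = {}" if "A \<in> (set \<circ> snd) ` set L" "B \<in> (set \<circ> snd) ` set L" for A B
    using lam that unfolding laminar_def by auto
  have up: "set (snd (?u q)) = (if p \<in> set (snd q) then insert w (set (snd q)) else set (snd q))" for q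
    by simp
  have lamu: "set (snd (?u q)) \<subseteq> set (snd (?u q')) \<or> set (snd (?u q')) \<subseteq> set (snd (?u q))
      \<or> set (snd (?u q)) \<inter> set (snd (?u q')) = {}" if "q \<in> set L" "q' \<in> set L" for q q'
    unfolding up by (rule nested_insert) (use lam1 that wq in auto)
  have lamw: "{w} \<subseteq> set (snd (?u q)) \<or> {w} \<inter> set (snd (?u q)) = {}" for q by blast
  have srt: "sorted_wrt (\<lambda>A B. \<not> B \<subset> A) (map (set \<circ> snd) L)" using lam by (simp add: laminar_def)
  have mono: "set (snd q') \<subset> set (snd q)" if "q \<in> set L" "q' \<in> set L" "set (snd (?u q')) \<subset> set (snd (?u q))" for q q'
    using that(3) wq[OF that(1)] wq[OF that(2)] unfolding up by (rule psubset_insert)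
  have "sorted_wrt (\<lambda>q q'. \<not> set (snd (?u q')) \<subset> set (snd (?u q))) L"
  proof -
    have "sorted_wrt (\<lambda>q q'. \<not> set (snd q') \<subset> set (snd q)) L" using srt by (simp add: sorted_wrt_map)
    then show ?thesis by (rule sorted_wrt_mono_rel[rotated]) (use mono in blast)
  qed
  then have srt': "sorted_wrt (\<lambda>A B. \<not> B \<subset> A) (map (set \<circ> snd) (map ?u L))"
    by (simp add: sorted_wrt_map)
  \<comment> \<open>Placing \<open>{w}\<close> at the front respects the order because shores are
    not empty, so none lies properly inside a singleton.\<close>
  have nonempty: "\<not> set (snd (?u q)) \<subset> {w}" if "q \<in> set L" for q
  proof
    assume "set (snd (?u q)) \<subset> {w}"
    then have "set (snd (?u q)) = {}" by (simp only: psubset_eq subset_singleton_iff) blast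
    then show False using endp[OF that] by (auto split: if_splits)
  qed
  have sets: "set (map (set \<circ> snd) ((t, [w]) # map ?u L)) = insert {w} ((\<lambda>q. set (snd (?u q))) ` set L)"
    by auto
  have 4: "laminar (map (set \<circ> snd) ((t, [w]) # map ?u L))"
    unfolding laminar_def
  proof
    show "\<forall>A\<in>set (map (set \<circ> snd) ((t, [w]) # map ?u L)).
       \<forall>B\<in>set (map (set \<circ> snd) ((t, [w]) # map ?u L)). A \<subseteq> B \<or> B \<subseteq> A \<or> A \<inter> B = {}"
      unfolding sets using lamu lamw by blast
    show "sorted_wrt (\<lambda>A B. \<not> B \<subset> A) (map (set \<circ> snd) ((t, [w]) # map ?u L))"
      using srt' nonempty by auto
  qed
  have 5: "\<forall>x\<in>insert w W. \<forall>y\<in>insert w W. x \<noteq> y \<longrightarrow>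
      (\<exists>q\<in>set ((t, [w]) # map ?u L). (x \<in> set (snd q)) \<noteq> (y \<in> set (snd q)))"
  proof (intro ballI impI)
    fix x y assume xy: "x \<in> insert w W" "y \<in> insert w W" "x \<noteq> y"
    show "\<exists>q\<in>set ((t, [w]) # map ?u L). (x \<in> set (snd q)) \<noteq> (y \<in> set (snd q))"
    proof (cases "x = w \<or> y = w")
      case True
      then show ?thesis using xy by auto
    next
      case False
      then have xW: "x \<in> W" "y \<in> W" using xy by auto
      obtain q where q: "q \<in> set L" "(x \<in> set (snd q)) \<noteq> (y \<in> set (snd q))"
        using sep[OF xW xy(3)] by blast
      then have "(x \<in> set (snd (?u q))) \<noteq> (y \<in> set (snd (?u q)))" using old xW by blast
      then show ?thesis using q(1) by force
    qed
  qed
  show ?thesis unfolding tree_family_def by (intro conjI 1 2 3 4 5)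
qed

definition grow_inv :: "'v \<Rightarrow> ('e, 'v) edge list \<Rightarrow> 'v list \<times> ('e, 'v) tree_cuts \<Rightarrow> bool" where
  "grow_inv r E st \<longleftrightarrow> distinct (fst st) \<and> r \<in> set (fst st) \<and> fst ` set (snd st) \<subseteq> set E
     \<and> tree_family (set (fst st)) (snd st)
     \<and> set (fst st) \<subseteq> insert r (src ` set E \<union> tgt ` set E)"

lemma grow_step_cases:
  assumes "grow_inv r E st"
  shows "grow_inv r E (grow_step E st) \<and>
    (if \<exists>e\<in>set E. crosses (set (fst st)) e then length (fst (grow_step E st)) = Suc (length (fst st))
     else grow_step E st = st)"
proof (cases "filter (crosses (set (fst st))) E")
  case Nil
  moreover have "grow_step E st = st" unfolding grow_step_def Nil by simp
  ultimately show ?thesis using assms by (auto simp: filter_empty_conv)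
next
  case (Cons t ts)
  let ?W = "set (fst st)"
  have "t \<in> set (filter (crosses ?W) E)" unfolding Cons by simp
  then have t: "t \<in> set E" "crosses ?W t" by simp_all
  define w where "w = (if src t \<in> ?W then tgt t else src t)"
  define p where "p = (if src t \<in> ?W then src t else tgt t)"
  have gs: "grow_step E st = (w # fst st,
      (t, [w]) # map (attach p w) (snd st))"
    unfolding grow_step_def Cons by (simp add: w_def p_def Let_def)
  have pw: "p \<in> ?W" "w \<notin> ?W" "src t = p \<and> tgt t = w \<or> src t = w \<and> tgt t = p"
    using t(2) by (auto simp: p_def w_def crosses_def)
  have "tree_family (insert w ?W) (snd (grow_step E st))"
    unfolding gs snd_conv by (rule tree_family_extend) (use assms pw in \<open>auto simp: grow_inv_def\<close>)
  moreover have "w \<in> src ` set E \<union> tgt ` set E" using t(1) pw(3) by force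
  ultimately have "grow_inv r E (grow_step E st)"
    using assms pw t(1) unfolding grow_inv_def gs by (simp add: image_image)
  moreover have "length (fst (grow_step E st)) = Suc (length (fst st))" by (simp add: gs)
  ultimately show ?thesis using t by auto
qed

lemma grow_inv_init: "grow_inv r E ([r], [])"
  by (auto simp: grow_inv_def tree_family_def con_def laminar_def)

lemma grow_inv_funpow: "grow_inv r E ((grow_step E ^^ n) ([r], []))"
proof (induction n)
  case 0
  show ?case by (simp add: grow_inv_init)
next
  case (Suc n)
  show ?case using grow_step_cases[OF Suc.IH] by simp
qed

text \<open>A stalled state never moves again. An edge that still crosses after \<open>n\<close>
  rounds therefore shows that each of these rounds added a vertex.\<close>

lemma grow_funpow_progress:
  "(\<exists>e\<in>set E. crosses (set (fst ((grow_step E ^^ n) ([r], [])))) e) \<Longrightarrow>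
    length (fst ((grow_step E ^^ n) ([r], []))) = Suc n"
proof (induction n)
  case (Suc n)
  let ?st = "(grow_step E ^^ n) ([r], [])"
  have gs: "(grow_step E ^^ Suc n) ([r], []) = grow_step E ?st" by simp
  have "\<exists>e\<in>set E. crosses (set (fst ?st)) e"
    using Suc.prems grow_step_cases[OF grow_inv_funpow[of r E n]] unfolding gs by (metis (full_types))
  then show ?case using Suc.IH grow_step_cases[OF grow_inv_funpow[of r E n]] unfolding gs by simp
qed simp

lemma grow_correct:
  assumes V: "V \<noteq> []" and E: "\<forall>e\<in>set E. src e \<in> set V \<and> tgt e \<in> set V"
  shows "grow_inv (hd V) E (grow V E)" "set (fst (grow V E)) \<subseteq> set V"
    "\<forall>e\<in>set E. \<not> crosses (set (fst (grow V E))) e"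
proof -
  obtain r V' where Vr: "V = r # V'" using V by (cases V) auto
  have g: "grow V E = (grow_step E ^^ length V) ([r], [])" by (simp add: grow_def Vr)
  show inv: "grow_inv (hd V) E (grow V E)" unfolding g using grow_inv_funpow[of r E "length V"] by (simp only: Vr list.sel)
  then show sub: "set (fst (grow V E)) \<subseteq> set V"
    using E V unfolding grow_inv_def by fastforce
  \<comment> \<open>The vertices reached are distinct and come from \<open>V\<close>. An edge
    crossing after \<open>length V\<close> rounds would require \<open>Suc (length V)\<close> of
    them.\<close>
  have "length (fst (grow V E)) \<le> length V"
    using sub inv unfolding grow_inv_def
    by (metis card_length card_mono distinct_card finite_set le_trans)
  then show "\<forall>e\<in>set E. \<not> crosses (set (fst (grow V E))) e"
    using grow_funpow_progress[of E "length V" r] unfolding g by fastforce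
qed

text \<open>The set of vertices reached contains the root and is crossed by no edge, so
  connectedness makes it all of \<open>V\<close>; conversely the grown tree by itself connects what
  it has reached.\<close>

lemma connects_iff_con:
  assumes V: "V \<noteq> []" and E: "\<forall>e\<in>set E. src e \<in> set V \<and> tgt e \<in> set V"
  shows "connects V E \<longleftrightarrow> con (set V) (set E)"
proof
  note g = grow_correct[OF V E]
  assume "connects V E"
  then have W: "set (fst (grow V E)) = set V" using g(2) by (auto simp: connects_def)
  then have "con (set V) (fst ` set (snd (grow V E)))" "fst ` set (snd (grow V E)) \<subseteq> set E"
    using g(1) unfolding grow_inv_def tree_family_def by auto
  then show "con (set V) (set E)" by (rule con_mono)
next
  note g = grow_correct[OF V E]
  assume c: "con (set V) (set E)"
  have "hd V \<in> set (fst (grow V E))" using g(1) by (simp add: grow_inv_def)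
  moreover have "set V \<subseteq> set (fst (grow V E)) \<or> set V \<inter> set (fst (grow V E)) = {}"
    using c g(3) unfolding con_def by blast
  ultimately show "connects V E" unfolding connects_def using hd_in_set[OF V] by blast
qed

lemma connects_tree_family:
  assumes V: "V \<noteq> []" and E: "\<forall>e\<in>set E. src e \<in> set V \<and> tgt e \<in> set V" and "connects V E"
  shows "tree_family (set V) (snd (grow V E))" "fst ` set (snd (grow V E)) \<subseteq> set E"
proof -
  note g = grow_correct[OF V E]
  have "set (fst (grow V E)) = set V" using g(2) assms(3) by (auto simp: connects_def)
  then show "tree_family (set V) (snd (grow V E))" "fst ` set (snd (grow V E)) \<subseteq> set E"
    using g(1) unfolding grow_inv_def by auto
qed

section \<open>Colouring the edges outside a spanning tree\<close>

abbreviation hits :: "(('e, 'v) edge \<times> 'c) list \<Rightarrow> 'v set \<Rightarrow> (('e, 'v) edge \<times> 'c) list" where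
  "hits M D \<equiv> filter (\<lambda>m. crosses D (fst m)) M"

text \<open>Only a cut with exactly one coloured edge blocks a colour. With none there is nothing to
  repeat, and with two or more the cut already has two colours by the invariant
  \<open>bicoloured\<close>.\<close>

definition colour_ok :: "'v list list \<Rightarrow> ('e, 'v) edge \<Rightarrow> (('e, 'v) edge \<times> 'c) list \<Rightarrow> 'c \<Rightarrow> bool" where
  "colour_ok Ds e M c \<longleftrightarrow> (\<forall>D\<in>set Ds. crosses (set D) e \<longrightarrow>
     (case hits M (set D) of [] \<Rightarrow> True | m # ms \<Rightarrow> ms \<noteq> [] \<or> snd m \<noteq> c))"

definition assign ::
    "'c list \<Rightarrow> 'v list list \<Rightarrow> ('e, 'v) edge \<Rightarrow> (('e, 'v) edge \<times> 'c) list \<Rightarrow> (('e, 'v) edge \<times> 'c) list"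
where
  "assign Cs Ds e M = (if e \<in> set (map fst M) then M
     else case filter (colour_ok Ds e M) Cs of [] \<Rightarrow> M | c # _ \<Rightarrow> (e, c) # M)"

definition colouring ::
    "'c list \<Rightarrow> ('e, 'v) edge list \<Rightarrow> 'v list list \<Rightarrow> (('e, 'v) edge \<times> 'c) list" where
  "colouring Cs N Ds = foldr (\<lambda>D M. foldr (assign Cs Ds) (filter (crosses (set D)) N) M) Ds []"

text \<open>Stated so that it holds for partial colourings too: two colours are demanded only from
  the second coloured edge of the cut onwards.\<close>

definition bicoloured :: "(('e, 'v) edge \<times> 'c) list \<Rightarrow> 'v set \<Rightarrow> bool" where
  "bicoloured M D \<longleftrightarrow> (\<forall>c. (\<forall>m\<in>set M. crosses D (fst m) \<longrightarrow> snd m = c) \<longrightarrow>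
     length (hits M D) \<le> 1)"

lemma bicoloured_Cons:
  assumes "bicoloured M D" "crosses D e \<Longrightarrow>
     (case hits M D of [] \<Rightarrow> True | m # ms \<Rightarrow> ms \<noteq> [] \<or> snd m \<noteq> c)"
  shows "bicoloured ((e, c) # M) D"
proof (cases "crosses D e")
  case True
  show ?thesis unfolding bicoloured_def
  proof (intro allI impI)
    fix c' assume mono: "\<forall>m\<in>set ((e, c) # M). crosses D (fst m) \<longrightarrow> snd m = c'"
    then have c': "c' = c" and M: "\<forall>m\<in>set M. crosses D (fst m) \<longrightarrow> snd m = c" using True by auto
    have le: "length (hits M D) \<le> 1"
      using assms(1) M unfolding bicoloured_def by blast
    show "length (filter (\<lambda>m. crosses D (fst m)) ((e, c) # M)) \<le> 1"
    proof (cases "hits M D")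
      case (Cons m ms)
      then have "m \<in> set (hits M D)" by simp
      then have "snd m = c" using M by simp
      then show ?thesis using assms(2)[OF True] Cons le by simp
    qed simp
  qed
next
  case False
  then show ?thesis using assms(1) by (simp add: bicoloured_def)
qed

text \<open>By \<open>up\<close>, if two nested sets crossed by \<open>e\<close> are each crossed by a single coloured edge, then by
  the same one.  So each end of \<open>e\<close> forbids at most one colour.\<close>

lemma colour_ok_exists:
  assumes lam: "\<And>A B. A \<in> set Ds \<Longrightarrow> B \<in> set Ds \<Longrightarrow> set A \<subseteq> set B \<or> set B \<subseteq> set A \<or> set A \<inter> set B = {}"
    and up: "\<And>A B m. A \<in> set Ds \<Longrightarrow> B \<in> set Ds \<Longrightarrow> set A \<subseteq> set B \<Longrightarrow> crosses (set A) e \<Longrightarrow> crosses (set B) e \<Longrightarrow>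
      m \<in> set M \<Longrightarrow> crosses (set A) (fst m) \<Longrightarrow> crosses (set B) (fst m)"
    and Cs: "card (set Cs) \<ge> 3"
  shows "\<exists>c\<in>set Cs. colour_ok Ds e M c"
proof (rule ccontr)
  assume "\<not> ?thesis"
  then have bad: "\<exists>D\<in>set Ds. crosses (set D) e \<and> (\<exists>m. hits M (set D) = [m] \<and> snd m = c)"
    if "c \<in> set Cs" for c
    using that unfolding colour_ok_def by (fastforce split: list.splits)
  \<comment> \<open>Two blocking shores with a common vertex are nested, so by \<open>up\<close> the
    only coloured edge of one crosses the other as well and is its only coloured edge.\<close>
  have same: "m = m'" if "A \<in> set Ds" "B \<in> set Ds" "x \<in> set A" "x \<in> set B" "crosses (set A) e" "crosses (set B) e"
    "hits M (set A) = [m]" "hits M (set B) = [m']" for A B m m' x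
  proof -
    have mm: "set (hits M (set A)) = {m}" "set (hits M (set B)) = {m'}"
      using that(7,8) by simp_all
    have "m \<in> set M" "crosses (set A) (fst m)" "m' \<in> set M" "crosses (set B) (fst m')" using mm by auto
    moreover have "set A \<subseteq> set B \<or> set B \<subseteq> set A" using lam[OF that(1,2)] that(3,4) by blast
    ultimately have "crosses (set B) (fst m) \<or> crosses (set A) (fst m')"
      using up[OF that(1,2) _ that(5,6)] up[OF that(2,1) _ that(6,5)] by blast
    then have "m \<in> set (hits M (set B)) \<or> m' \<in> set (hits M (set A))"
      using mm by auto
    then show ?thesis unfolding mm by auto
  qed
  obtain X where "X \<subseteq> set Cs" "card X = 3" using Cs obtain_subset_with_card_n by metis
  then obtain c1 c2 c3 where c: "c1 \<in> set Cs" "c2 \<in> set Cs" "c3 \<in> set Cs" "c1 \<noteq> c2" "c1 \<noteq> c3" "c2 \<noteq> c3"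
    by (auto simp: card_3_iff)
  obtain D1 m1 where 1: "D1 \<in> set Ds" "crosses (set D1) e" "hits M (set D1) = [m1]" "snd m1 = c1"
    using bad[OF c(1)] by blast
  obtain D2 m2 where 2: "D2 \<in> set Ds" "crosses (set D2) e" "hits M (set D2) = [m2]" "snd m2 = c2"
    using bad[OF c(2)] by blast
  obtain D3 m3 where 3: "D3 \<in> set Ds" "crosses (set D3) e" "hits M (set D3) = [m3]" "snd m3 = c3"
    using bad[OF c(3)] by blast
  have d12: "x \<notin> set D1 \<or> x \<notin> set D2" for x using same[OF 1(1) 2(1) _ _ 1(2) 2(2) 1(3) 2(3)] c(4) 1(4) 2(4) by blast
  have d13: "x \<notin> set D1 \<or> x \<notin> set D3" for x using same[OF 1(1) 3(1) _ _ 1(2) 3(2) 1(3) 3(3)] c(5) 1(4) 3(4) by blast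
  have d23: "x \<notin> set D2 \<or> x \<notin> set D3" for x using same[OF 2(1) 3(1) _ _ 2(2) 3(2) 2(3) 3(3)] c(6) 2(4) 3(4) by blast
  \<comment> \<open>Each of the three shores contains exactly one end of \<open>e\<close>, and they
    are pairwise disjoint: three shores for two ends.\<close>
  show False using 1(2) 2(2) 3(2) d12[of "src e"] d12[of "tgt e"] d13[of "src e"] d13[of "tgt e"] d23[of "src e"] d23[of "tgt e"]
    unfolding crosses_def by blast
qed

definition colour_inv :: "'c list \<Rightarrow> 'v list list \<Rightarrow> (('e, 'v) edge \<times> 'c) list \<Rightarrow> bool" where
  "colour_inv Cs Ds M \<longleftrightarrow> distinct (map fst M) \<and> snd ` set M \<subseteq> set Cs \<and> (\<forall>D\<in>set Ds. bicoloured M (set D))"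

lemma assign_inv:
  assumes lam: "\<And>A B. A \<in> set Ds \<Longrightarrow> B \<in> set Ds \<Longrightarrow> set A \<subseteq> set B \<or> set B \<subseteq> set A \<or> set A \<inter> set B = {}"
    and up: "\<And>A B m. e \<notin> fst ` set M \<Longrightarrow> A \<in> set Ds \<Longrightarrow> B \<in> set Ds \<Longrightarrow> set A \<subseteq> set B \<Longrightarrow> crosses (set A) e \<Longrightarrow> crosses (set B) e \<Longrightarrow>
      m \<in> set M \<Longrightarrow> crosses (set A) (fst m) \<Longrightarrow> crosses (set B) (fst m)"
    and Cs: "card (set Cs) \<ge> 3" and inv: "colour_inv Cs Ds M"
  shows "colour_inv Cs Ds (assign Cs Ds e M) \<and> fst ` set (assign Cs Ds e M) = insert e (fst ` set M)"
proof (cases "e \<in> fst ` set M")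
  case True
  then show ?thesis using inv by (auto simp: assign_def)
next
  case False
  have "\<exists>c\<in>set Cs. colour_ok Ds e M c"
    by (rule colour_ok_exists[OF lam _ Cs]) (use up[OF False] in blast)+
  then have "filter (colour_ok Ds e M) Cs \<noteq> []" by (auto simp: filter_empty_conv)
  then obtain c cs where cs: "filter (colour_ok Ds e M) Cs = c # cs" by (meson neq_Nil_conv)
  then have "c \<in> set (filter (colour_ok Ds e M) Cs)" by simp
  then have c: "c \<in> set Cs" "colour_ok Ds e M c" by simp_all
  have eq: "assign Cs Ds e M = (e, c) # M" using False cs by (simp add: assign_def)
  have "bicoloured ((e, c) # M) (set D)" if "D \<in> set Ds" for D
    by (rule bicoloured_Cons) (use that inv c(2) in \<open>auto simp: colour_inv_def colour_ok_def\<close>)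
  then show ?thesis using inv False c(1) unfolding eq colour_inv_def by auto
qed

text \<open>The order of the shores yields the premise \<open>up\<close> of the greedy step. Suppose
  \<open>m\<close> crosses \<open>A\<close> but not the larger \<open>B\<close>. Then both ends of
  \<open>m\<close> lie in \<open>B\<close>, and the shore \<open>Z\<close> on whose account
  \<open>m\<close> was coloured lies properly inside \<open>B\<close>. So \<open>B\<close> was
  treated before, and \<open>e\<close>, which crosses it, is already coloured.\<close>

lemma colouring_step:
  fixes N :: "('e, 'v) edge list"
  assumes lam: "laminar (map set Ds)" and Ds: "Ds = pre @ D # suf"
    and Cs: "card (set Cs) \<ge> 3"
    and sub: "set es \<subseteq> {e \<in> set N. crosses (set D) e}"
    and inv: "colour_inv Cs Ds M"
    and dom: "fst ` set M = {e \<in> set N. \<exists>B\<in>set suf. crosses (set B) e}"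
  shows "colour_inv Cs Ds (foldr (assign Cs Ds) es M) \<and>
    fst ` set (foldr (assign Cs Ds) es M) = set es \<union> fst ` set M"
  using sub
proof (induction es)
  case Nil
  then show ?case using inv by simp
next
  case (Cons e es)
  let ?M = "foldr (assign Cs Ds) es M"
  have IH: "colour_inv Cs Ds ?M" "fst ` set ?M = set es \<union> fst ` set M" using Cons by auto
  have lam1: "set A \<subseteq> set B \<or> set B \<subseteq> set A \<or> set A \<inter> set B = {}" if "A \<in> set Ds" "B \<in> set Ds" for A B
    using lam that unfolding laminar_def by auto
  have ord: "\<not> set B \<subset> set A" if "A \<in> set pre \<and> B \<in> set (D # suf) \<or> A = D \<and> B \<in> set suf" for A B
  proof -
    have "sorted_wrt (\<lambda>A B. \<not> set B \<subset> set A) (pre @ D # suf)"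
      using lam by (simp only: laminar_def Ds sorted_wrt_map)
    then show ?thesis using that unfolding sorted_wrt_append sorted_wrt.simps by fastforce
  qed
  have "colour_inv Cs Ds (assign Cs Ds e ?M) \<and> fst ` set (assign Cs Ds e ?M) = insert e (fst ` set ?M)"
  proof (rule assign_inv[OF lam1 _ Cs IH(1)])
    fix A B m
    assume e: "e \<notin> fst ` set ?M" and AB: "A \<in> set Ds" "B \<in> set Ds" "set A \<subseteq> set B"
      and cr: "crosses (set A) e" "crosses (set B) e"
      and m: "m \<in> set ?M" "crosses (set A) (fst m)"
    show "crosses (set B) (fst m)"
    proof (rule ccontr)
      assume nB: "\<not> crosses (set B) (fst m)"
      have "fst m \<in> set es \<or> fst m \<in> fst ` set M" using m(1) IH(2) by blast
      moreover have "crosses (set D) (fst m)" if "fst m \<in> set es" using that Cons.prems by auto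
      ultimately obtain Z where Z: "Z \<in> set (D # suf)" "crosses (set Z) (fst m)"
        unfolding dom by auto
      have ends: "src (fst m) \<in> set B" "tgt (fst m) \<in> set B"
        using m(2) nB AB(3) unfolding crosses_def by auto
      have "Z \<in> set Ds" using Z(1) Ds by auto
      then have "set Z \<subset> set B" using lam1[of Z B] AB(2) Z(2) ends unfolding crosses_def by blast
      then have "B \<in> set suf" using ord[of B Z] Z(1) AB(2) unfolding Ds by auto
      then have "e \<in> fst ` set M" using cr(2) Cons.prems dom by auto
      then show False using e IH(2) by auto
    qed
  qed auto
  then show ?case using IH(2) by auto
qed

lemma colouring_inv:
  fixes N :: "('e, 'v) edge list"
  assumes lam: "laminar (map set Ds)" and Cs: "card (set Cs) \<ge> 3"
  shows "colour_inv Cs Ds (colouring Cs N Ds) \<and>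
    fst ` set (colouring Cs N Ds) = {e \<in> set N. \<exists>B\<in>set Ds. crosses (set B) e}"
proof -
  have "colour_inv Cs Ds (foldr (\<lambda>D M. foldr (assign Cs Ds) (filter (crosses (set D)) N) M) suf []) \<and>
    fst ` set (foldr (\<lambda>D M. foldr (assign Cs Ds) (filter (crosses (set D)) N) M) suf []) =
      {e \<in> set N. \<exists>B\<in>set suf. crosses (set B) e}" if "Ds = pre @ suf" for pre suf
    using that
  proof (induction suf arbitrary: pre)
    case Nil
    then show ?case by (simp add: colour_inv_def bicoloured_def)
  next
    case (Cons D suf)
    let ?M = "foldr (\<lambda>D M. foldr (assign Cs Ds) (filter (crosses (set D)) N) M) suf []"
    have IH: "colour_inv Cs Ds ?M" "fst ` set ?M = {e \<in> set N. \<exists>B\<in>set suf. crosses (set B) e}"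
      using Cons.IH[of "pre @ [D]"] Cons.prems by simp_all
    have "colour_inv Cs Ds (foldr (assign Cs Ds) (filter (crosses (set D)) N) ?M) \<and>
      fst ` set (foldr (assign Cs Ds) (filter (crosses (set D)) N) ?M) =
        set (filter (crosses (set D)) N) \<union> fst ` set ?M"
      by (rule colouring_step[OF lam Cons.prems Cs _ IH]) simp
    then show ?case using IH(2) by auto
  qed
  from this[of "[]" Ds] show ?thesis by (simp add: colouring_def)
qed

section \<open>Sizes of cuts and the removal of a colour class\<close>

definition cut :: "('e, 'v) edge list \<Rightarrow> 'v set \<Rightarrow> nat" where
  "cut E S = length (filter (crosses S) E)"

definition cut_ge :: "nat \<Rightarrow> 'v set \<Rightarrow> ('e, 'v) edge list \<Rightarrow> bool" where
  "cut_ge k V E \<longleftrightarrow> (\<forall>S. V \<inter> S \<noteq> {} \<longrightarrow> \<not> V \<subseteq> S \<longrightarrow> k \<le> cut E S)"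

text \<open>Tree edges carry no colour, so a cut with two tree edges keeps both. A cut with a single
  tree edge is a fundamental cut; its other edges, at least two, show two colours, so one of them
  survives besides the tree edge.\<close>

theorem colour_class_removable:
  fixes E :: "('e, 'v) edge list" and L :: "('e, 'v) tree_cuts"
  assumes tf: "tree_family V L" and LE: "fst ` set L \<subseteq> set E" and E: "\<forall>e\<in>set E. src e \<in> V \<and> tgt e \<in> V \<and> src e \<noteq> tgt e"
    and ge: "cut_ge 3 V E" and dist: "distinct E" and Cs: "card (set Cs) \<ge> 3"
  defines "M \<equiv> colouring Cs (filter (\<lambda>e. e \<notin> set (map fst L)) E) (map snd L)"
  shows "cut_ge 2 V (filter (\<lambda>e. (e, c) \<notin> set M) E)"
    and "\<And>e. e \<in> set E \<Longrightarrow> e \<notin> fst ` set L \<Longrightarrow> \<exists>c\<in>set Cs. (e, c) \<in> set M"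
proof -
  let ?N = "filter (\<lambda>e. e \<notin> set (map fst L)) E"
  let ?Ds = "map snd L"
  have lam: "laminar (map set ?Ds)" using tf by (simp add: tree_family_def)
  have inv: "colour_inv Cs ?Ds M" and dom: "fst ` set M = {e \<in> set ?N. \<exists>B\<in>set ?Ds. crosses (set B) e}"
    using colouring_inv[OF lam Cs, of ?N] by (simp_all add: M_def)
  \<comment> \<open>The shores separate any two vertices, so every edge that is no loop lies in a
    fundamental cut and gets coloured unless it is in the tree.\<close>
  have "\<exists>B\<in>set ?Ds. crosses (set B) e" if "e \<in> set E" for e
  proof -
    have "src e \<in> V" "tgt e \<in> V" "src e \<noteq> tgt e" using E that by auto
    then have "\<exists>q\<in>set L. (src e \<in> set (snd q)) \<noteq> (tgt e \<in> set (snd q))"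
      using tf unfolding tree_family_def by blast
    then show ?thesis by (auto simp: crosses_def)
  qed
  then have dom: "fst ` set M = set ?N" unfolding dom by auto
  show "\<exists>c\<in>set Cs. (e, c) \<in> set M" if "e \<in> set E" "e \<notin> fst ` set L" for e
  proof -
    have "e \<in> fst ` set M" unfolding dom using that by auto
    then obtain m where "m \<in> set M" "e = fst m" by blast
    then have "snd m \<in> set Cs" "(e, snd m) \<in> set M" using inv unfolding colour_inv_def by auto
    then show ?thesis by blast
  qed
  show "cut_ge 2 V (filter (\<lambda>e. (e, c) \<notin> set M) E)"
    unfolding cut_ge_def
  proof (intro allI impI)
    fix S assume S: "V \<inter> S \<noteq> {}" "\<not> V \<subseteq> S"
    let ?F = "filter (\<lambda>e. (e, c) \<notin> set M) E"
    have cutF: "cut ?F S = card {e \<in> set ?F. crosses S e}"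
      unfolding cut_def by (subst distinct_card[symmetric]) (use dist in simp_all)
    have TF: "e \<in> set ?F" if "e \<in> fst ` set L" for e
    proof -
      have "e \<notin> fst ` set M" unfolding dom using that by auto
      then have "(e, c) \<notin> set M" by force
      then show ?thesis using that LE by auto
    qed
    have conT: "con V (fst ` set L)" using tf by (simp add: tree_family_def)
    then obtain t where t: "t \<in> fst ` set L" "crosses S t" using S unfolding con_def by blast
    have "\<exists>f. f \<in> set ?F \<and> crosses S f \<and> f \<noteq> t"
    proof (cases "\<exists>f\<in>fst ` set L. crosses S f \<and> f \<noteq> t")
      case True
      then show ?thesis using TF by blast
    next
      case False
      obtain q where q: "q \<in> set L" "t = fst q" using t(1) by blast
      let ?D = "set (snd q)"
      \<comment> \<open>\<open>S\<close> and the shore \<open>?D\<close> are both crossed by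
        \<open>t\<close> and by no other tree edge. Their symmetric difference is crossed by none,
        so on \<open>V\<close> the set \<open>S\<close> is \<open>?D\<close> or its
        complement.\<close>
      have "\<not> crosses {x. (x \<in> S) \<noteq> (x \<in> ?D)} e" if "e \<in> fst ` set L" for e
      proof -
        obtain q' where q': "q' \<in> set L" "e = fst q'" using \<open>e \<in> fst ` set L\<close> by blast
        have "crosses ?D e \<longleftrightarrow> t = e" using tf q q' unfolding tree_family_def by auto
        moreover have "crosses S e \<longleftrightarrow> t = e" using False t(2) that by blast
        ultimately show ?thesis unfolding crosses_xor by simp
      qed
      then have "V \<subseteq> {x. (x \<in> S) \<noteq> (x \<in> ?D)} \<or> V \<inter> {x. (x \<in> S) \<noteq> (x \<in> ?D)} = {}"
        using conT unfolding con_def by blast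
      then have SD: "crosses S e \<longleftrightarrow> crosses ?D e" if "e \<in> set E" for e
        using E that unfolding crosses_def by blast
      have "3 \<le> card {e \<in> set E. crosses S e}"
      proof -
        have "3 \<le> length (filter (crosses S) E)" using ge S unfolding cut_ge_def cut_def by blast
        also have "\<dots> = card (set (filter (crosses S) E))"
          by (rule distinct_card[symmetric]) (use dist in simp)
        finally show ?thesis by simp
      qed
      also have "{e \<in> set E. crosses S e} = insert t {e \<in> set ?N. crosses ?D e}"
        using False t LE SD by auto
      also have "card \<dots> \<le> Suc (card {e \<in> set ?N. crosses ?D e})" by (simp add: card_insert_le_m1)
      also have "{e \<in> set ?N. crosses ?D e} = fst ` {m \<in> set M. crosses ?D (fst m)}"
        unfolding dom[symmetric] by auto
      also have "card \<dots> \<le> card {m \<in> set M. crosses ?D (fst m)}" by (rule card_image_le) simp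
      also have "\<dots> \<le> length (hits M ?D)"
        using card_length[of "hits M ?D"] by simp
      finally have two: "\<not> length (hits M ?D) \<le> 1" by simp
      have "bicoloured M ?D" using inv q(1) by (simp add: colour_inv_def)
      then obtain m where m: "m \<in> set M" "crosses ?D (fst m)" "snd m \<noteq> c"
        using two unfolding bicoloured_def by blast
      have fm: "fst m \<in> set ?N" using m(1) dom by blast
      have "(fst m, c) \<notin> set M"
        using inv m(1,3) eq_key_imp_eq_value[of M "fst m" c "snd m"] unfolding colour_inv_def by auto
      moreover have "crosses S (fst m)" using SD m(2) fm by simp
      moreover have "fst m \<noteq> t" using fm t(1) by auto
      moreover have "fst m \<in> set E" using fm by simp
      ultimately have "fst m \<in> set ?F \<and> crosses S (fst m) \<and> fst m \<noteq> t" by simp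
      then show ?thesis by (rule exI)
    qed
    then obtain f where f: "f \<in> set ?F" "crosses S f" "f \<noteq> t" by blast
    have "card {t, f} \<le> card {e \<in> set ?F. crosses S e}"
      by (rule card_mono) (use f t TF in auto)
    then show "2 \<le> cut ?F S" using f(3) unfolding cutF by simp
  qed
qed

section \<open>Deleting an edge of a cubic graph\<close>

text \<open>If both choices of \<open>j\<close> failed, then the symmetric difference of the two separating sets would
  separate \<open>V\<close>.\<close>

lemma attach_end:
  assumes xor: "\<And>S T. Q S \<Longrightarrow> Q T \<Longrightarrow> Q {s. (s \<in> S) \<noteq> (s \<in> T)}"
    and con: "\<And>S. Q S \<Longrightarrow> same S z w \<Longrightarrow> undivided V S"
    and V: "z \<in> V" "w \<in> V" "p \<in> V"
  shows "\<exists>j\<in>{z, w}. \<forall>S. Q S \<longrightarrow> same S u p \<longrightarrow> same S v j \<longrightarrow> same S u v \<longrightarrow>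
    undivided ({u, v} \<union> V) S"
proof (rule ccontr)
  assume neg: "\<not> ?thesis"
  have ex0: "\<not> (\<forall>S. Q S \<longrightarrow> same S u p \<longrightarrow> same S v j \<longrightarrow> same S u v \<longrightarrow>
    undivided ({u, v} \<union> V) S)" if "j \<in> {z, w}" for j
    using that by (intro notI) (rule notE[OF neg], rule bexI)
  have ex: "\<exists>S. Q S \<and> same S u p \<and> same S v j \<and> same S u v \<and>
      \<not> {u, v} \<union> V \<subseteq> S \<and> ({u, v} \<union> V) \<inter> S \<noteq> {}" if "j \<in> {z, w}" for j
    using ex0[OF that] by (simp only: not_all not_imp de_Morgan_disj simp_thms)
  obtain S where S: "Q S" "same S u p" "same S v z" "same S u v"
      "\<not> {u, v} \<union> V \<subseteq> S" "({u, v} \<union> V) \<inter> S \<noteq> {}"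
    using ex[of z] by auto
  obtain T where T: "Q T" "same T u p" "same T v w" "same T u v"
      "\<not> {u, v} \<union> V \<subseteq> T" "({u, v} \<union> V) \<inter> T \<noteq> {}"
    using ex[of w] by auto
  have "\<not> same S z w" using con[OF S(1)] S(2-6) V by auto
  moreover have "\<not> same T z w" using con[OF T(1)] T(2-6) V by auto
  ultimately have
    zw: "z \<in> {s. (s \<in> S) \<noteq> (s \<in> T)} \<longleftrightarrow> w \<in> {s. (s \<in> S) \<noteq> (s \<in> T)}" and
    zp: "z \<in> {s. (s \<in> S) \<noteq> (s \<in> T)} \<longleftrightarrow> p \<notin> {s. (s \<in> S) \<noteq> (s \<in> T)}"
    using S(2-4) T(2-4) by auto
  show False using con[OF xor[OF S(1) T(1)] zw] zp V by auto
qed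

text \<open>This is \<open>attach_end\<close> with the roles of \<open>u\<close> and
  \<open>v\<close> exchanged and the condition on \<open>z\<close> and \<open>w\<close> absorbed
  into the predicate: both halves of \<open>zw\<close> and the edge \<open>uv\<close> are present,
  and one half of \<open>xy\<close> has to be chosen.\<close>

lemma attach_subdivided:
  assumes xor: "\<And>S T. Q S \<Longrightarrow> Q T \<Longrightarrow> Q {s. (s \<in> S) \<noteq> (s \<in> T)}"
    and con: "\<And>S. Q S \<Longrightarrow> same S x y \<Longrightarrow> same S z w \<Longrightarrow> undivided V S"
    and V: "x \<in> V" "y \<in> V" "z \<in> V"
  shows "\<exists>i\<in>{x, y}. \<forall>S. Q S \<longrightarrow> same S u i \<longrightarrow> same S u v \<longrightarrow> same S v z \<longrightarrow> same S v w \<longrightarrow>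
    undivided ({u, v} \<union> V) S"
proof -
  have "\<exists>i\<in>{x, y}. \<forall>S. Q S \<and> same S z w \<longrightarrow> same S v z \<longrightarrow> same S u i \<longrightarrow> same S v u \<longrightarrow>
      undivided ({v, u} \<union> V) S"
  proof (rule attach_end)
    fix S T assume "Q S \<and> same S z w" "Q T \<and> same T z w"
    then show "Q {s. (s \<in> S) \<noteq> (s \<in> T)} \<and> same {s. (s \<in> S) \<noteq> (s \<in> T)} z w"
      using xor[of S T] by simp
  next
    fix S assume "Q S \<and> same S z w" "same S x y"
    then show "undivided V S" using con[of S] by simp
  qed (fact V)+
  then show ?thesis by (simp add: insert_commute) blast
qed

text \<open>
  The edge \<open>xy\<close> of colour \<open>ca\<close> is subdivided by \<open>u\<close>, the edge \<open>zw\<close> of colour \<open>cb\<close> by \<open>v\<close>, and \<open>uv\<close> is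
  added.  If \<open>ca = cb\<close>, this colour goes to \<open>uv\<close> and to one half of either edge, and the other two
  colours to the other halves.  If not, \<open>uv\<close> and a half of \<open>zw\<close> get \<open>cb\<close>, a half of \<open>xy\<close> and the other
  half of \<open>zw\<close> get \<open>ca\<close>, and the third colour goes to the other half of \<open>xy\<close>.
\<close>

lemma colour_split_edges:
  fixes Q :: "'c \<Rightarrow> 'v set \<Rightarrow> bool"
  assumes xor: "\<And>c S T. Q c S \<Longrightarrow> Q c T \<Longrightarrow> Q c {s. (s \<in> S) \<noteq> (s \<in> T)}"
    and con: "\<And>c S. c \<in> Cs \<Longrightarrow> Q c S \<Longrightarrow> (c \<noteq> ca \<longrightarrow> same S x y) \<Longrightarrow> (c \<noteq> cb \<longrightarrow> same S z w)
      \<Longrightarrow> undivided V S"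
    and V: "x \<in> V" "y \<in> V" "z \<in> V" "w \<in> V"
    and Cs: "card Cs = 3" "ca \<in> Cs" "cb \<in> Cs"
  shows "\<exists>c1\<in>Cs. \<exists>c2\<in>Cs. \<exists>c3\<in>Cs. \<exists>c4\<in>Cs. \<exists>c5\<in>Cs. \<forall>c\<in>Cs. \<forall>S. Q c S \<longrightarrow> (c \<noteq> c1 \<longrightarrow> same S u x) \<longrightarrow>
    (c \<noteq> c2 \<longrightarrow> same S u y) \<longrightarrow> (c \<noteq> c3 \<longrightarrow> same S v z) \<longrightarrow>
    (c \<noteq> c4 \<longrightarrow> same S v w) \<longrightarrow> (c \<noteq> c5 \<longrightarrow> same S u v) \<longrightarrow>
    undivided ({u, v} \<union> V) S"
proof -
  let ?R = "\<lambda>c1 c2 c3 c4 c5 c. \<forall>S. Q c S \<longrightarrow> (c \<noteq> c1 \<longrightarrow> same S u x) \<longrightarrow>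
    (c \<noteq> c2 \<longrightarrow> same S u y) \<longrightarrow> (c \<noteq> c3 \<longrightarrow> same S v z) \<longrightarrow>
    (c \<noteq> c4 \<longrightarrow> same S v w) \<longrightarrow> (c \<noteq> c5 \<longrightarrow> same S u v) \<longrightarrow>
    undivided ({u, v} \<union> V) S"
  \<comment> \<open>\<open>p\<close> is the end of \<open>xy\<close> whose half does not receive
    \<open>ca\<close>. Where the colour \<open>ca\<close> is left out, \<open>u\<close> hangs at
    \<open>p\<close>.\<close>
  have split_a: "\<exists>c1 c2 p. (c1 = ca \<and> c2 = c \<and> p = y \<or> c1 = c \<and> c2 = ca \<and> p = x) \<and>
      (\<forall>c3 c4 c5. c3 \<noteq> c \<longrightarrow> c4 \<noteq> c \<longrightarrow> c5 \<noteq> c \<longrightarrow> ?R c1 c2 c3 c4 c5 c)"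
    if c: "c \<in> Cs" "c \<noteq> ca" "c \<noteq> cb" for c
  proof -
    have "\<exists>i\<in>{x, y}. \<forall>S. Q c S \<longrightarrow> same S u i \<longrightarrow> same S u v \<longrightarrow> same S v z \<longrightarrow> same S v w \<longrightarrow>
        undivided ({u, v} \<union> V) S"
    proof (rule attach_subdivided)
      show "Q c {s. (s \<in> S) \<noteq> (s \<in> T)}" if "Q c S" "Q c T" for S T using that by (rule xor)
      show "undivided V S" if "Q c S" "same S x y" "same S z w" for S
        using con[OF c(1), of S] that by simp
    qed (fact V)+
    then obtain i where "i = x \<or> i = y" and i: "\<And>S. Q c S \<Longrightarrow> same S u i \<Longrightarrow> same S u v \<Longrightarrow>
        same S v z \<Longrightarrow> same S v w \<Longrightarrow> undivided ({u, v} \<union> V) S"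
      by auto
    then show ?thesis
    proof (elim disjE)
      assume "i = x"
      then show ?thesis using i c(2) by - (rule exI[of _ ca], rule exI[of _ c], rule exI[of _ y], auto)
    next
      assume "i = y"
      then show ?thesis using i c(2) by - (rule exI[of _ c], rule exI[of _ ca], rule exI[of _ x], auto)
    qed
  qed
  have split_b: "\<exists>c3 c4. (c3 = cb \<and> c4 = c \<or> c3 = c \<and> c4 = cb) \<and>
      (\<forall>c1 c2 c5. c1 \<noteq> c \<longrightarrow> c2 \<noteq> c \<longrightarrow> c5 \<noteq> c \<longrightarrow> ?R c1 c2 c3 c4 c5 c)"
    if c: "c \<in> Cs" "c \<noteq> ca" "c \<noteq> cb" for c
  proof -
    have "\<exists>j\<in>{z, w}. \<forall>S. Q c S \<longrightarrow> same S v j \<longrightarrow> same S v u \<longrightarrow> same S u x \<longrightarrow> same S u y \<longrightarrow>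
        undivided ({v, u} \<union> V) S"
    proof (rule attach_subdivided)
      show "Q c {s. (s \<in> S) \<noteq> (s \<in> T)}" if "Q c S" "Q c T" for S T using that by (rule xor)
      show "undivided V S" if "Q c S" "same S z w" "same S x y" for S
        using con[OF c(1), of S] that by simp
    qed (fact V)+
    then obtain j where "j = z \<or> j = w" and j: "\<And>S. Q c S \<Longrightarrow> same S v j \<Longrightarrow> same S v u \<Longrightarrow>
        same S u x \<Longrightarrow> same S u y \<Longrightarrow> undivided ({u, v} \<union> V) S"
      by (auto simp: insert_commute)
    then show ?thesis
    proof (elim disjE)
      assume "j = z"
      then show ?thesis using j c(3) by - (rule exI[of _ cb], rule exI[of _ c], auto)
    next
      assume "j = w"
      then show ?thesis using j c(3) by - (rule exI[of _ c], rule exI[of _ cb], auto)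
    qed
  qed
  show ?thesis
  proof (cases "ca = cb")
    case True
    obtain \<beta> \<gamma> where Ceq: "Cs = {ca, \<beta>, \<gamma>}" "\<beta> \<noteq> ca" "\<gamma> \<noteq> ca" "\<beta> \<noteq> \<gamma>"
      using Cs(1,2) by (auto simp: card_3_iff)
    then have in_Cs: "\<beta> \<in> Cs" "\<gamma> \<in> Cs" by auto
    obtain c1 c2 p where c12: "c1 = ca \<and> c2 = \<beta> \<and> p = y \<or> c1 = \<beta> \<and> c2 = ca \<and> p = x" and
      R1: "\<forall>c3 c4 c5. c3 \<noteq> \<beta> \<longrightarrow> c4 \<noteq> \<beta> \<longrightarrow> c5 \<noteq> \<beta> \<longrightarrow> ?R c1 c2 c3 c4 c5 \<beta>"
      using split_a[OF in_Cs(1) Ceq(2) Ceq(2)[unfolded True]] by (elim exE conjE) (rule that)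
    note R\<beta> = R1[THEN spec, THEN spec, THEN spec, THEN mp, THEN mp, THEN mp]
    obtain c3 c4 where c34: "c3 = ca \<and> c4 = \<gamma> \<or> c3 = \<gamma> \<and> c4 = ca" and
      R2: "\<forall>c1 c2 c5. c1 \<noteq> \<gamma> \<longrightarrow> c2 \<noteq> \<gamma> \<longrightarrow> c5 \<noteq> \<gamma> \<longrightarrow> ?R c1 c2 c3 c4 c5 \<gamma>"
      using split_b[OF in_Cs(2) Ceq(3) Ceq(3)[unfolded True], folded True] by (elim exE conjE) (rule that)
    note R\<gamma> = R2[THEN spec, THEN spec, THEN spec, THEN mp, THEN mp, THEN mp]
    \<comment> \<open>Where \<open>ca\<close> is left out, \<open>xy\<close> and \<open>zw\<close>
      were absent before the subdivision as well, so \<open>V\<close> is connected without them;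
      \<open>u\<close> and \<open>v\<close> are then attached as pendant vertices by the half of
      either edge that is not coloured \<open>ca\<close>.\<close>
    have "?R c1 c2 c3 c4 ca ca"
    proof (intro allI impI)
      fix S assume S: "Q ca S" "ca \<noteq> c1 \<longrightarrow> same S u x" "ca \<noteq> c2 \<longrightarrow> same S u y"
        "ca \<noteq> c3 \<longrightarrow> same S v z" "ca \<noteq> c4 \<longrightarrow> same S v w"
      have "undivided V S" using con[OF Cs(2) S(1)] True by auto
      moreover have "same S u x \<or> same S u y" using S(2,3) c12 Ceq(2) by metis
      moreover have "same S v z \<or> same S v w" using S(4,5) c34 Ceq(3) by metis
      ultimately show "undivided ({u, v} \<union> V) S" using V by blast
    qed
    moreover have "?R c1 c2 c3 c4 ca \<beta>" by (rule R\<beta>) (use c34 Ceq in auto)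
    moreover have "?R c1 c2 c3 c4 ca \<gamma>" by (rule R\<gamma>) (use c12 Ceq in auto)
    ultimately have "\<forall>c\<in>Cs. ?R c1 c2 c3 c4 ca c" unfolding Ceq(1) by (simp only: ball_simps simp_thms)
    moreover have "c1 \<in> Cs" "c2 \<in> Cs" "c3 \<in> Cs" "c4 \<in> Cs" using c12 c34 in_Cs Cs(2) by auto
    ultimately show ?thesis using Cs(2) by (intro bexI)
  next
    case False
    obtain \<gamma> where Ceq: "Cs = {ca, cb, \<gamma>}" "\<gamma> \<noteq> ca" "\<gamma> \<noteq> cb"
      using Cs False by (auto simp: card_3_iff)
    then have in_Cs: "\<gamma> \<in> Cs" by auto
    obtain c1 c2 p where c12: "c1 = ca \<and> c2 = \<gamma> \<and> p = y \<or> c1 = \<gamma> \<and> c2 = ca \<and> p = x" and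
      R1: "\<forall>c3 c4 c5. c3 \<noteq> \<gamma> \<longrightarrow> c4 \<noteq> \<gamma> \<longrightarrow> c5 \<noteq> \<gamma> \<longrightarrow> ?R c1 c2 c3 c4 c5 \<gamma>"
      using split_a[OF in_Cs Ceq(2,3)] by (elim exE conjE) (rule that)
    note R\<gamma> = R1[THEN spec, THEN spec, THEN spec, THEN mp, THEN mp, THEN mp]
    have pV: "p \<in> V" using c12 V by auto
    \<comment> \<open>The choice at \<open>xy\<close> was made for the third colour and fixes
      \<open>p\<close>. The choice at \<open>zw\<close> is still free and is made for
      \<open>ca\<close>: \<open>j\<close> is the end whose half stays when \<open>ca\<close> is left
      out.\<close>
    obtain j where j: "j = z \<or> j = w" "\<And>S. Q ca S \<Longrightarrow> same S u p \<Longrightarrow> same S v j \<Longrightarrow>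
        same S u v \<Longrightarrow> undivided ({u, v} \<union> V) S"
    proof -
      have "\<exists>j\<in>{z, w}. \<forall>S. Q ca S \<longrightarrow> same S u p \<longrightarrow> same S v j \<longrightarrow> same S u v \<longrightarrow>
        undivided ({u, v} \<union> V) S"
      proof (rule attach_end)
        fix S assume "Q ca S" "same S z w"
        then show "undivided V S" using con[OF Cs(2), of S] by simp
      qed (fact xor V pV)+
      then show ?thesis using that by auto
    qed
    obtain c3 c4 where c34: "c3 = ca \<and> c4 = cb \<and> j = w \<or> c3 = cb \<and> c4 = ca \<and> j = z"
      using j(1) by blast
    have "?R c1 c2 c3 c4 cb ca"
    proof (intro allI impI)
      fix S assume S: "Q ca S" "ca \<noteq> c1 \<longrightarrow> same S u x" "ca \<noteq> c2 \<longrightarrow> same S u y"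
        "ca \<noteq> c3 \<longrightarrow> same S v z" "ca \<noteq> c4 \<longrightarrow> same S v w" "ca \<noteq> cb \<longrightarrow> same S u v"
      show "undivided ({u, v} \<union> V) S"
      proof (rule j(2)[OF S(1)])
        show "same S u p" using c12 S(2,3) Ceq(2) by metis
        show "same S v j" using c34 S(4,5) False by metis
        show "same S u v" using S(6) False by blast
      qed
    qed
    \<comment> \<open>Where \<open>cb\<close> is left out, both halves of \<open>xy\<close> are
      present and replace \<open>xy\<close>, while \<open>v\<close> is pendant at one end of
      \<open>zw\<close>, which was absent before too.\<close>
    moreover have "?R c1 c2 c3 c4 cb cb"
    proof (intro allI impI)
      fix S assume S: "Q cb S" "cb \<noteq> c1 \<longrightarrow> same S u x" "cb \<noteq> c2 \<longrightarrow> same S u y"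
        "cb \<noteq> c3 \<longrightarrow> same S v z" "cb \<noteq> c4 \<longrightarrow> same S v w"
      have u: "same S u x \<and> same S u y" using S(2,3) c12 Ceq(3) False by metis
      then have "undivided V S" using con[OF Cs(3) S(1)] by auto
      moreover have "same S v z \<or> same S v w" using S(4,5) c34 False by metis
      ultimately show "undivided ({u, v} \<union> V) S" using V u by blast
    qed
    moreover have "?R c1 c2 c3 c4 cb \<gamma>" by (rule R\<gamma>) (use c34 Ceq in auto)
    ultimately have "\<forall>c\<in>Cs. ?R c1 c2 c3 c4 cb c" unfolding Ceq(1) by (simp only: ball_simps simp_thms)
    moreover have "c1 \<in> Cs" "c2 \<in> Cs" "c3 \<in> Cs" "c4 \<in> Cs" using c12 c34 in_Cs Cs(2,3) by auto
    ultimately show ?thesis using Cs(3) by (intro bexI)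
  qed
qed

section \<open>Cut functions, degree sums and parity in cubic graphs\<close>

lemma cut_Cons: "cut (e # E) S = of_bool (crosses S e) + cut E S"
  by (simp add: cut_def)

lemma cut_submodular: "cut E (A \<inter> B) + cut E (A \<union> B) \<le> cut E A + cut E B"
proof (induction E)
  case (Cons e E)
  have "of_bool (crosses (A \<inter> B) e) + of_bool (crosses (A \<union> B) e) \<le> (of_bool (crosses A e) + of_bool (crosses B e) :: nat)"
    by (cases "src e \<in> A"; cases "src e \<in> B"; cases "tgt e \<in> A"; cases "tgt e \<in> B"; simp add: crosses_def)
  then show ?case using Cons by (simp add: cut_Cons)
qed (simp add: cut_def)

lemma cut_posimodular: "cut E (A - B) + cut E (B - A) \<le> cut E A + cut E B"
proof (induction E)
  case (Cons e E)
  have "of_bool (crosses (A - B) e) + of_bool (crosses (B - A) e) \<le> (of_bool (crosses A e) + of_bool (crosses B e) :: nat)"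
    by (cases "src e \<in> A"; cases "src e \<in> B"; cases "tgt e \<in> A"; cases "tgt e \<in> B"; simp add: crosses_def)
  then show ?case using Cons by (simp add: cut_Cons)
qed (simp add: cut_def)

definition inc :: "'v \<Rightarrow> ('e, 'v) edge \<Rightarrow> bool" where
  "inc v e \<longleftrightarrow> src e = v \<or> tgt e = v"

lemma sum_degree:
  assumes "finite S" "\<forall>e\<in>set E. src e \<noteq> tgt e"
  shows "(\<Sum>v\<in>S. length (filter (inc v) E)) = cut E S + 2 * length (filter (\<lambda>e. src e \<in> S \<and> tgt e \<in> S) E)"
  using assms(2)
proof (induction E)
  case (Cons e E)
  have "(\<Sum>v\<in>S. length (filter (inc v) (e # E))) =
      (\<Sum>v\<in>S. (if inc v e then 1 else 0) + length (filter (inc v) E))"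
    by (intro sum.cong) auto
  also have "\<dots> = (\<Sum>v\<in>S. if inc v e then 1 else 0) + (\<Sum>v\<in>S. length (filter (inc v) E))"
    by (simp add: sum.distrib)
  also have "(\<Sum>v\<in>S. if inc v e then 1 else 0) = card (S \<inter> {src e, tgt e})"
  proof -
    have "(\<Sum>v\<in>S. if inc v e then 1 else 0) = card {v \<in> S. inc v e}"
      using sum.inter_filter[OF assms(1), of "\<lambda>_. 1::nat" "\<lambda>v. inc v e"] by simp
    also have "{v \<in> S. inc v e} = S \<inter> {src e, tgt e}" by (auto simp: inc_def)
    finally show ?thesis .
  qed
  also have "\<dots> = (if src e \<in> S then 1 else 0) + (if tgt e \<in> S then 1 else 0)"
    using Cons.prems by auto
  finally show ?case using Cons by (auto simp: cut_def crosses_def)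
qed (simp add: cut_def)

text \<open>A cubic graph has no isolated vertices, so its edge list determines the vertex set and
  can stand for the whole graph.\<close>

definition vset :: "('e, 'v) edge list \<Rightarrow> 'v set" where
  "vset E = src ` set E \<union> tgt ` set E"

definition cubic3 :: "('e, 'v) edge list \<Rightarrow> bool" where
  "cubic3 E \<longleftrightarrow> distinct (map fst E) \<and> (\<forall>e\<in>set E. src e \<noteq> tgt e)
     \<and> (\<forall>v\<in>vset E. length (filter (inc v) E) = 3) \<and> cut_ge 3 (vset E) E"

lemma finite_vset [simp]: "finite (vset E)" by (simp add: vset_def)

lemma vsetI: "e \<in> set E \<Longrightarrow> src e \<in> vset E" "e \<in> set E \<Longrightarrow> tgt e \<in> vset E"
  by (auto simp: vset_def)

lemma cubic3_loopfree: "cubic3 E \<Longrightarrow> e \<in> set E \<Longrightarrow> src e \<noteq> tgt e"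
  by (auto simp: cubic3_def)

lemma cubic3_cut: "cubic3 E \<Longrightarrow> vset E \<inter> S \<noteq> {} \<Longrightarrow> \<not> vset E \<subseteq> S \<Longrightarrow> 3 \<le> cut E S"
  by (simp add: cubic3_def cut_ge_def)

lemma cubic3_degree_sum:
  assumes "cubic3 E" "S \<subseteq> vset E"
  shows "3 * card S = cut E S + 2 * length (filter (\<lambda>e. src e \<in> S \<and> tgt e \<in> S) E)"
proof -
  have "finite S" using assms(2) finite_subset finite_vset by blast
  moreover have "(\<Sum>v\<in>S. length (filter (inc v) E)) = (\<Sum>v\<in>S. 3)"
    using assms by (intro sum.cong) (auto simp: cubic3_def)
  ultimately show ?thesis using sum_degree[of S E] assms(1) by (simp add: cubic3_def)
qed

text \<open>The degree sum over \<open>S\<close> is odd exactly when \<open>card S\<close> is, and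
  edges inside \<open>S\<close> count twice in it.\<close>

lemma cubic3_parity: "cubic3 E \<Longrightarrow> S \<subseteq> vset E \<Longrightarrow> even (cut E S) \<longleftrightarrow> even (card S)"
  using cubic3_degree_sum[of E S] by presburger

lemma cut_compl: "cut E (vset E - S) = cut E S"
  unfolding cut_def by (intro arg_cong[of _ _ length] filter_cong) (auto simp: crosses_def vset_def)

definition nontrivial :: "('e, 'v) edge list \<Rightarrow> 'v set \<Rightarrow> bool" where
  "nontrivial E S \<longleftrightarrow> S \<subseteq> vset E \<and> cut E S = 3 \<and> 2 \<le> card S \<and> 2 \<le> card (vset E - S)"

lemma nontrivial_compl: "nontrivial E S \<Longrightarrow> nontrivial E (vset E - S)"
  unfolding nontrivial_def by (simp add: cut_compl double_diff)

text \<open>The edges inside a smallest shore of a nontrivial 3-edge cut lie in no nontrivial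
  3-edge cut: two crossing 3-edge cuts of a cubic graph uncross by parity.\<close>

lemma exists_edge_avoiding_cuts:
  assumes cubic3: "cubic3 E" and card: "2 < card (vset E)"
  shows "\<exists>e\<in>set E. \<forall>W. nontrivial E W \<longrightarrow> \<not> crosses W e"
proof (cases "\<exists>S. nontrivial E S")
  case False
  have "vset E \<noteq> {}" using card by auto
  then have "hd E \<in> set E" by (auto simp: vset_def)
  then show ?thesis using False by (intro bexI[of _ "hd E"]) simp_all
next
  case True
  then obtain S where S: "nontrivial E S" and min: "\<And>T. nontrivial E T \<Longrightarrow> card S \<le> card T"
    using ex_has_least_nat[of "nontrivial E" _ card] by blast
  have SV: "S \<subseteq> vset E" "cut E S = 3" "2 \<le> card S" "2 \<le> card (vset E - S)"
    using S by (auto simp: nontrivial_def)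
  have fin: "finite S" using SV(1) finite_subset finite_vset by blast
  have ge: "3 \<le> cut E T" if "T \<subseteq> vset E" "T \<noteq> {}" "T \<noteq> vset E" for T
  proof -
    have "vset E \<inter> T \<noteq> {}" "\<not> vset E \<subseteq> T" using that by auto
    then show ?thesis by (rule cubic3_cut[OF cubic3])
  qed
  \<comment> \<open>If no edge ran inside \<open>S\<close>, the degree sum \<open>3 * card S\<close>
    would equal the cut size 3 and \<open>S\<close> would be a single vertex.\<close>
  have "filter (\<lambda>e. src e \<in> S \<and> tgt e \<in> S) E \<noteq> []"
  proof
    assume "filter (\<lambda>e. src e \<in> S \<and> tgt e \<in> S) E = []"
    then have "3 * card S = 3" using cubic3_degree_sum[OF cubic3 SV(1)] SV(2) by simp
    then show False using SV(3) by simp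
  qed
  then have "\<exists>e\<in>set E. src e \<in> S \<and> tgt e \<in> S" by (simp add: filter_empty_conv)
  then obtain e where e: "e \<in> set E" "src e \<in> S" "tgt e \<in> S" by blast
  have odd_S: "odd (card S)" using cubic3_parity[OF cubic3 SV(1)] SV(2) by simp
  have evV: "even (card (vset E))" using cubic3_parity[OF cubic3 subset_refl]
    by (simp add: cut_def crosses_def vsetI filter_empty_conv[THEN iffD2])
  \<comment> \<open>Submodularity makes \<open>S \<inter> W\<close> the shore of a smaller 3-edge
    cut, which by minimality is a single vertex. The differences then have even cardinality and,
    unless empty, at least four cut edges each. Posimodularity does not allow this twice, so
    \<open>W\<close> lies in \<open>S\<close> and is itself a single vertex.\<close>
  have no_odd: False if W: "nontrivial E W" "crosses W e" "odd (card (S \<inter> W))" for W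
  proof -
    have WV: "W \<subseteq> vset E" "cut E W = 3" "2 \<le> card W" using W(1) by (auto simp: nontrivial_def)
    have finW: "finite W" using WV(1) finite_subset finite_vset by blast
    have odd_W: "odd (card W)" using cubic3_parity[OF cubic3 WV(1)] WV(2) by simp
    have cS: "card S = card (S \<inter> W) + card (S - W)" using fin by (metis card_Int_Diff)
    have cW: "card W = card (S \<inter> W) + card (W - S)" using finW by (metis card_Int_Diff Int_commute)
    have cU: "card (S \<union> W) + card (S \<inter> W) = card S + card W" using card_Un_Int[OF fin finW] by simp
    have ne: "S - W \<noteq> {}" using W(2) e by (auto simp: crosses_def)
    have inter_ne: "S \<inter> W \<noteq> {}" using W(3) by (metis card.empty even_zero)
    have "odd (card (S \<union> W))" using cU odd_S odd_W W(3) by presburger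
    \<comment> \<open>The union is odd and the number of vertices even, so the union is proper and
      its cut has at least three edges.\<close>
    then have UV: "S \<union> W \<noteq> vset E" using evV by metis
    have "3 \<le> cut E (S \<union> W)" by (rule ge) (use SV WV UV inter_ne in auto)
    moreover have "cut E (S \<inter> W) + cut E (S \<union> W) \<le> 6"
      using cut_submodular[of E S W] SV(2) WV(2) by simp
    moreover have "3 \<le> cut E (S \<inter> W)" by (rule ge) (use SV WV ne inter_ne in auto)
    ultimately have c3: "cut E (S \<inter> W) = 3" by simp
    have less: "card (S \<inter> W) < card S" using cS ne fin by (metis card_gt_0_iff finite_Diff less_add_same_cancel1)
    then have "\<not> nontrivial E (S \<inter> W)" using min by (meson not_le)
    moreover have "2 \<le> card (vset E - S \<inter> W)"
      using SV(4) card_mono[of "vset E - S \<inter> W" "vset E - S"] by fastforce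
    ultimately have "card (S \<inter> W) < 2" using c3 SV(1) unfolding nontrivial_def by auto
    then have c1: "card (S \<inter> W) = 1" using W(3) by (metis One_nat_def less_2_cases odd_pos not_less_zero)
    have "even (card (S - W))" using cS odd_S W(3) by presburger
    moreover have "3 \<le> cut E (S - W)" by (rule ge) (use SV WV ne inter_ne in auto)
    ultimately have "4 \<le> cut E (S - W)" using cubic3_parity[OF cubic3, of "S - W"] SV(1) by (cases "cut E (S - W) = 3") auto
    moreover have "4 \<le> cut E (W - S)" if "W - S \<noteq> {}"
    proof -
      have "even (card (W - S))" using cW odd_W W(3) by presburger
      moreover have "3 \<le> cut E (W - S)" by (rule ge) (use that SV WV inter_ne in auto)
      ultimately show ?thesis using cubic3_parity[OF cubic3, of "W - S"] WV(1) by (cases "cut E (W - S) = 3") auto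
    qed
    moreover have "cut E (S - W) + cut E (W - S) \<le> 6"
      using cut_posimodular[of E S W] SV(2) WV(2) by simp
    ultimately have "W - S = {}" by fastforce
    then have "card (W - S) = 0" by (simp only: card.empty)
    then have "card W = 1" using cW c1 by linarith
    then show False using WV(3) by simp
  qed
  have "\<not> crosses W e" if W: "nontrivial E W" for W
  proof
    assume cr: "crosses W e"
    show False
    proof (cases "odd (card (S \<inter> W))")
      case True
      then show False using no_odd[OF W cr] by blast
    next
      case False
      \<comment> \<open>Since \<open>card S\<close> is odd and \<open>S \<inter> W\<close> even,
        \<open>S - W\<close> is odd, and the complement of \<open>W\<close> takes the place of
        \<open>W\<close>.\<close>
      have "S \<inter> (vset E - W) = S - W" using SV(1) by auto
      then have "odd (card (S \<inter> (vset E - W)))"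
        using False odd_S fin by (metis card_Int_Diff even_add)
      moreover have "crosses (vset E - W) e" using cr e SV(1) by (auto simp: crosses_def)
      ultimately show False using no_odd[OF nontrivial_compl[OF W]] by blast
    qed
  qed
  then show ?thesis using e(1) by blast
qed

section \<open>One reduction: deleting an edge and suppressing its ends\<close>

definition oth :: "'v \<Rightarrow> ('e, 'v) edge \<Rightarrow> 'v" where
  "oth v e = (if src e = v then tgt e else src e)"

type_synonym ('e, 'v) quintuple =
  "('e, 'v) edge \<times> ('e, 'v) edge \<times> ('e, 'v) edge \<times> ('e, 'v) edge \<times> ('e, 'v) edge"

definition side1 :: "('e, 'v) edge list \<Rightarrow> ('e, 'v) edge \<Rightarrow> ('e, 'v) edge list" where
  "side1 E e = filter (\<lambda>f. inc (src e) f \<and> f \<noteq> e) E"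

text \<open>Edges at both ends of \<open>e\<close> are left to \<open>side1\<close>. So the two
  sides and \<open>rest\<close> are disjoint for any edge list whatsoever, which the size bounds for
  the running time rely on.\<close>

definition side2 :: "('e, 'v) edge list \<Rightarrow> ('e, 'v) edge \<Rightarrow> ('e, 'v) edge list" where
  "side2 E e = filter (\<lambda>f. inc (tgt e) f \<and> \<not> inc (src e) f) E"

definition rest :: "('e, 'v) edge list \<Rightarrow> ('e, 'v) edge \<Rightarrow> ('e, 'v) edge list" where
  "rest E e = filter (\<lambda>f. \<not> inc (src e) f \<and> \<not> inc (tgt e) f) E"

text \<open>The edges that replace the paths through \<open>u\<close> and \<open>v\<close> reuse the identifiers of \<open>a1\<close> and \<open>b1\<close>.\<close>

definition suppressed ::
    "('e, 'v) edge list \<Rightarrow> ('e, 'v) edge \<Rightarrow> ('e, 'v) edge \<Rightarrow> ('e, 'v) edge \<Rightarrow> ('e, 'v) edge \<Rightarrow> ('e, 'v) edge \<Rightarrow>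
     ('e, 'v) edge list" where
  "suppressed E e a1 a2 b1 b2 =
     (fst a1, oth (src e) a1, oth (src e) a2) # (fst b1, oth (tgt e) b1, oth (tgt e) b2) # rest E e"

text \<open>The result is an optional value in the form of a list. The nested one-level case
  distinctions match the rule by which their running time is derived later.\<close>

definition reduce :: "('e, 'v) edge list \<Rightarrow> ('e, 'v) edge \<Rightarrow> (('e, 'v) quintuple \<times> ('e, 'v) edge list) list" where
  "reduce E e =
     (case side1 E e of [] \<Rightarrow> [] | a1 # A \<Rightarrow> (case A of [] \<Rightarrow> [] | a2 # _ \<Rightarrow>
     (case side2 E e of [] \<Rightarrow> [] | b1 # B \<Rightarrow> (case B of [] \<Rightarrow> [] | b2 # _ \<Rightarrow>
        [((e, a1, a2, b1, b2), suppressed E e a1 a2 b1 b2)]))))"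

text \<open>Of the six edge ends at \<open>u\<close> and \<open>v\<close>, two parallel edges use up
  four, so at most two edges would leave \<open>{u, v}\<close>, although there are further
  vertices.\<close>

lemma no_parallel:
  assumes cubic3: "cubic3 E" and card: "2 < card (vset E)" and fg: "f \<in> set E" "g \<in> set E" "f \<noteq> g"
    and "src f = u \<and> tgt f = v \<or> src f = v \<and> tgt f = u" "src g = u \<and> tgt g = v \<or> src g = v \<and> tgt g = u"
  shows False
proof -
  have "src f \<noteq> tgt f" using cubic3 fg(1) by (rule cubic3_loopfree)
  then have uv: "u \<noteq> v" "{u, v} \<subseteq> vset E" using assms(6) vsetI[OF fg(1)] by (elim disjE conjE; simp)+
  have inside: "src f \<in> {u, v} \<and> tgt f \<in> {u, v}" "src g \<in> {u, v} \<and> tgt g \<in> {u, v}"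
    using assms(6,7) by (elim disjE conjE; simp)+
  have "card (set (filter (\<lambda>e. src e \<in> {u, v} \<and> tgt e \<in> {u, v}) E)) \<ge> card {f, g}"
    using fg(1,2) inside by (intro card_mono) simp_all
  then have "2 \<le> length (filter (\<lambda>e. src e \<in> {u, v} \<and> tgt e \<in> {u, v}) E)"
    using fg(3) card_length[of "filter (\<lambda>e. src e \<in> {u, v} \<and> tgt e \<in> {u, v}) E"] by simp
  then have "cut E {u, v} \<le> 2" using cubic3_degree_sum[OF cubic3 uv(2)] uv(1) by simp
  moreover have "3 \<le> cut E {u, v}"
  proof (rule cubic3_cut[OF cubic3])
    show "vset E \<inter> {u, v} \<noteq> {}" using uv(2) by simp
    show "\<not> vset E \<subseteq> {u, v}"
    proof
      assume "vset E \<subseteq> {u, v}"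
      then have "card (vset E) \<le> card {u, v}" by (intro card_mono) simp_all
      then show False using card uv(1) by simp
    qed
  qed
  ultimately show False by simp
qed

lemma inc_oth: "inc u a \<Longrightarrow> crosses S a \<longleftrightarrow> (u \<in> S) \<noteq> (oth u a \<in> S)"
  by (auto simp: inc_def oth_def crosses_def)

lemma inc_iff_oth: "inc u a \<Longrightarrow> inc t a \<longleftrightarrow> t = u \<or> t = oth u a"
  by (auto simp: inc_def oth_def)

lemma inc_Pair: "inc t (i, p, q) \<longleftrightarrow> t = p \<or> t = q"
  by (auto simp: inc_def)

lemma filter_length_mset: "mset xs = mset ys \<Longrightarrow> length (filter P xs) = length (filter P ys)"
  by (metis mset_filter size_mset)

lemma length_two_obtain:
  assumes "length xs = 2" obtains a b where "xs = [a, b]"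
  using assms by (metis One_nat_def Suc_1 length_0_conv length_Suc_conv)

lemma distinct_edges: "cubic3 E \<Longrightarrow> distinct E"
  by (auto simp: cubic3_def distinct_map)

lemma parallel_edges_eq:
  assumes "cubic3 E" "2 < card (vset E)" "f \<in> set E" "g \<in> set E" "s \<noteq> t" "inc s f" "inc t f" "inc s g" "inc t g"
  shows "f = g"
proof (rule ccontr)
  assume "f \<noteq> g"
  show False
    by (rule no_parallel[OF assms(1-4) \<open>f \<noteq> g\<close>, of s t]) (use assms(5-9) in \<open>(simp only: inc_def, metis)+\<close>)
qed

lemma reduce_shape:
  assumes cubic3: "cubic3 E" and card: "2 < card (vset E)" and e: "e \<in> set E"
  shows "\<exists>a1 a2 b1 b2. side1 E e = [a1, a2] \<and> side2 E e = [b1, b2]"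
proof -
  let ?u = "src e" and ?v = "tgt e"
  have dist: "distinct E" using cubic3 by (rule distinct_edges)
  have uv: "?u \<noteq> ?v" using cubic3 e by (rule cubic3_loopfree)
  have deg: "card {f \<in> set E. inc t f} = 3" if "t \<in> vset E" for t
  proof -
    have "length (filter (inc t) E) = 3" using cubic3 that by (simp add: cubic3_def)
    then show ?thesis using distinct_card[of "filter (inc t) E"] dist by simp
  qed
  have "length (side1 E e) = card (set (side1 E e))"
    by (rule distinct_card[symmetric]) (simp add: side1_def dist)
  also have "set (side1 E e) = {f \<in> set E. inc ?u f} - {e}" by (auto simp: side1_def)
  also have "card \<dots> = 2"
    using deg[of ?u] e vsetI[OF e] by (subst card_Diff_singleton) (auto simp: inc_def)
  finally have 1: "length (side1 E e) = 2" .
  have "length (side2 E e) = card (set (side2 E e))"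
    by (rule distinct_card[symmetric]) (simp add: side2_def dist)
  also have "set (side2 E e) = {f \<in> set E. inc ?v f} - {e}"
  proof -
    have "f = e" if "f \<in> set E" "inc ?v f" "inc ?u f" for f
      by (rule parallel_edges_eq[OF cubic3 card that(1) e uv that(3,2)]) (simp_all add: inc_def)
    moreover have "inc ?u e" by (simp add: inc_def)
    ultimately show ?thesis unfolding side2_def set_filter by blast
  qed
  also have "card \<dots> = 2"
    using deg[of ?v] e vsetI[OF e] by (subst card_Diff_singleton) (auto simp: inc_def)
  finally have 2: "length (side2 E e) = 2" .
  from 1 2 show ?thesis by (metis length_two_obtain)
qed

locale reduction =
  fixes E :: "('e, 'v) edge list" and e a1 a2 b1 b2 :: "('e, 'v) edge"
  assumes cubic3: "cubic3 E" and card: "2 < card (vset E)" and e: "e \<in> set E"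
    and side1: "side1 E e = [a1, a2]" and side2: "side2 E e = [b1, b2]"
begin

abbreviation "u \<equiv> src e"
abbreviation "v \<equiv> tgt e"
abbreviation "x \<equiv> oth u a1"
abbreviation "y \<equiv> oth u a2"
abbreviation "z \<equiv> oth v b1"
abbreviation "w \<equiv> oth v b2"
abbreviation "R \<equiv> rest E e"
abbreviation "E' \<equiv> suppressed E e a1 a2 b1 b2"

lemma uv: "u \<noteq> v"
  using cubic3 e by (rule cubic3_loopfree)

lemma set_a: "{a1, a2} = {f \<in> set E. inc u f \<and> f \<noteq> e}"
  using arg_cong[OF side1, of set] by (auto simp: side1_def)

lemma set_b: "{b1, b2} = {f \<in> set E. inc v f \<and> \<not> inc u f}"
  using arg_cong[OF side2, of set] by (auto simp: side2_def)

lemma a_facts: "a1 \<in> set E" "a2 \<in> set E" "inc u a1" "inc u a2" "a1 \<noteq> e" "a2 \<noteq> e"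
  using set_a by auto

lemma b_facts: "b1 \<in> set E" "b2 \<in> set E" "inc v b1" "inc v b2" "\<not> inc u b1" "\<not> inc u b2"
  using set_b by auto

lemma inc_e: "inc u e" "inc v e" by (simp_all add: inc_def)

lemma a_not_v: "\<not> inc v a1" "\<not> inc v a2"
  using parallel_edges_eq[OF cubic3 card a_facts(1) e uv a_facts(3) _ inc_e]
    parallel_edges_eq[OF cubic3 card a_facts(2) e uv a_facts(4) _ inc_e] a_facts(5,6) by blast+

lemma distinct_parts: "distinct (e # a1 # a2 # b1 # b2 # R)"
proof -
  have "distinct (side1 E e)" "distinct (side2 E e)" "distinct R"
    using distinct_edges[OF cubic3] by (simp_all add: side1_def side2_def rest_def)
  then have "a1 \<noteq> a2" "b1 \<noteq> b2" "distinct R" using side1 side2 by auto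
  moreover have "b1 \<noteq> a1" "b1 \<noteq> a2" "b2 \<noteq> a1" "b2 \<noteq> a2" "b1 \<noteq> e" "b2 \<noteq> e"
    using a_facts b_facts inc_e by metis+
  moreover have "e \<notin> set R" "a1 \<notin> set R" "a2 \<notin> set R" "b1 \<notin> set R" "b2 \<notin> set R"
    using a_facts b_facts inc_e unfolding rest_def by simp_all
  ultimately show ?thesis using a_facts(5,6) by simp
qed

lemma set_parts: "set E = set (e # a1 # a2 # b1 # b2 # R)"
proof -
  have "set E = insert e ({f \<in> set E. inc u f \<and> f \<noteq> e} \<union> {f \<in> set E. inc v f \<and> \<not> inc u f} \<union>
      {f \<in> set E. \<not> inc u f \<and> \<not> inc v f})"
    using e by blast
  also have "\<dots> = set (e # a1 # a2 # b1 # b2 # R)"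
    unfolding set_a[symmetric] set_b[symmetric] by (simp add: rest_def insert_commute Un_assoc)
  finally show ?thesis .
qed

text \<open>\<open>E\<close> is a permutation of the list with the five affected edges in front, so
  degrees and cuts may be counted there.\<close>

lemma filter_parts: "length (filter P E) = length (filter P (e # a1 # a2 # b1 # b2 # R))"
  by (rule filter_length_mset)
    (use set_eq_iff_mset_eq_distinct[OF distinct_edges[OF cubic3] distinct_parts] set_parts in blast)

lemma ids_parts: "distinct (map fst (e # a1 # a2 # b1 # b2 # R))"
proof -
  have "inj_on fst (set E)" using cubic3 by (simp add: cubic3_def distinct_map)
  then show ?thesis using distinct_parts unfolding distinct_map set_parts by blast
qed

lemma inc_R: "f \<in> set R \<Longrightarrow> \<not> inc u f \<and> \<not> inc v f"
  by (simp add: rest_def)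

lemma oth_neq: "oth s f \<noteq> s" if "f \<in> set E"
  using cubic3_loopfree[OF cubic3 that] by (auto simp: oth_def)

lemma ends_xyzw: "x \<noteq> u" "y \<noteq> u" "z \<noteq> v" "w \<noteq> v" "x \<noteq> v" "y \<noteq> v" "z \<noteq> u" "w \<noteq> u"
  using oth_neq a_facts b_facts a_not_v inc_iff_oth by metis+

text \<open>Otherwise \<open>a1\<close> and \<open>a2\<close> would be parallel. Hence the edge that
  replaces them is no loop.\<close>

lemma xy: "x \<noteq> y"
proof
  assume "x = y"
  then have "inc x a1" "inc x a2" using inc_iff_oth[OF a_facts(3)] inc_iff_oth[OF a_facts(4)] by simp_all
  then have "a1 = a2"
    using parallel_edges_eq[OF cubic3 card a_facts(1,2), of u x] a_facts ends_xyzw by metis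
  then show False using distinct_parts by simp
qed

lemma zw: "z \<noteq> w"
proof
  assume "z = w"
  then have "inc z b1" "inc z b2" using inc_iff_oth[OF b_facts(3)] inc_iff_oth[OF b_facts(4)] by simp_all
  then have "b1 = b2"
    using parallel_edges_eq[OF cubic3 card b_facts(1,2), of v z] b_facts ends_xyzw by metis
  then show False using distinct_parts by simp
qed

lemma vset_iff: "t \<in> vset F \<longleftrightarrow> (\<exists>f\<in>set F. inc t f)"
  by (auto simp: vset_def inc_def)

lemma inc_parts:
  assumes "t \<noteq> u" "t \<noteq> v"
  shows "inc t e \<longleftrightarrow> False" "inc t a1 \<longleftrightarrow> t = x" "inc t a2 \<longleftrightarrow> t = y"
    "inc t b1 \<longleftrightarrow> t = z" "inc t b2 \<longleftrightarrow> t = w"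
  using assms inc_iff_oth[OF a_facts(3), of t] inc_iff_oth[OF a_facts(4), of t]
    inc_iff_oth[OF b_facts(3), of t] inc_iff_oth[OF b_facts(4), of t]
  by (simp_all add: inc_def[of _ e])

lemma vset_suppressed: "vset E' = vset E - {u, v}"
proof (rule set_eqI)
  fix t
  have 1: "t \<in> vset E' \<longleftrightarrow> t = x \<or> t = y \<or> t = z \<or> t = w \<or> (\<exists>f\<in>set R. inc t f)"
    unfolding vset_iff suppressed_def by (simp add: inc_Pair disj_assoc)
  have 2: "t \<in> vset E \<longleftrightarrow> inc t e \<or> inc t a1 \<or> inc t a2 \<or> inc t b1 \<or> inc t b2 \<or> (\<exists>f\<in>set R. inc t f)"
    unfolding vset_iff set_parts by simp
  show "t \<in> vset E' \<longleftrightarrow> t \<in> vset E - {u, v}"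
  proof (cases "t = u \<or> t = v")
    case True
    then have "t \<noteq> x \<and> t \<noteq> y \<and> t \<noteq> z \<and> t \<noteq> w" using ends_xyzw by metis
    moreover have "\<not> (\<exists>f\<in>set R. inc t f)" using True inc_R by metis
    ultimately have "t \<notin> vset E'" unfolding 1 by simp
    then show ?thesis using True by simp
  next
    case False
    then show ?thesis using 1 2 inc_parts[of t] by simp
  qed
qed

lemma xyzw_in: "x \<in> vset E'" "y \<in> vset E'" "z \<in> vset E'" "w \<in> vset E'"
  unfolding suppressed_def vset_def by simp_all

lemma ids_suppressed: "distinct (map fst E')"
  using ids_parts by (simp add: suppressed_def)

lemma cubic3_suppressed:
  assumes "cut_ge 3 (vset E') E'"
  shows "cubic3 E'"
  unfolding cubic3_def
proof (intro conjI ballI)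
  show "distinct (map fst E')" by (rule ids_suppressed)
  show "cut_ge 3 (vset E') E'" by fact
  show "src f \<noteq> tgt f" if "f \<in> set E'" for f
  proof -
    have "f \<in> set R \<Longrightarrow> f \<in> set E" by (simp add: rest_def)
    moreover have "f = (fst a1, x, y) \<or> f = (fst b1, z, w) \<or> f \<in> set R"
      using that unfolding suppressed_def by simp
    ultimately show ?thesis using xy zw cubic3_loopfree[OF cubic3, of f] by (elim disjE) simp_all
  qed
  show "length (filter (inc t) E') = 3" if t: "t \<in> vset E'" for t
  proof -
    have tuv: "t \<in> vset E" "t \<noteq> u" "t \<noteq> v" using t vset_suppressed by auto
    have "3 = length (filter (inc t) E)" using cubic3 tuv by (simp add: cubic3_def)
    \<comment> \<open>Each replacement edge inherits one end from either of the two edges it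
      replaces. A vertex may occur at both replacement edges, for instance if \<open>x = z\<close>,
      hence the full case distinction.\<close>
    also have "\<dots> = length (filter (inc t) E')"
      unfolding filter_parts suppressed_def
      using xy zw inc_parts[OF tuv(2,3)]
      by (cases "t = x"; cases "t = y"; cases "t = z"; cases "t = w"; simp add: inc_Pair)
    finally show ?thesis by simp
  qed
qed

text \<open>A set \<open>S\<close> extends to a set \<open>T\<close> of the larger graph whose cut
  is that of \<open>S\<close>, plus \<open>e\<close> if it crosses. So a cut with at most two edges
  can only arise from a 3-edge cut that contains \<open>e\<close>, and that one is
  nontrivial.\<close>

lemma cut_ge_suppressed:
  assumes avoid: "\<And>W. nontrivial E W \<Longrightarrow> \<not> crosses W e"
  shows "cut_ge 3 (vset E') E'"
  unfolding cut_ge_def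
proof (intro allI impI)
  fix S assume S: "vset E' \<inter> S \<noteq> {}" "\<not> vset E' \<subseteq> S"
  let ?V = "vset E'"
  define P where "P = (x \<in> S \<and> y \<in> S)"
  define Q where "Q = (z \<in> S \<and> w \<in> S)"
  \<comment> \<open>\<open>u\<close> follows \<open>x\<close> and \<open>y\<close> if they lie on
    the same side and stays outside otherwise; then the two edges at \<open>u\<close> contribute as
    much as the edge that replaces them. The same holds for \<open>v\<close>.\<close>
  define T where "T = (S \<inter> ?V) \<union> (if P then {u} else {}) \<union> (if Q then {v} else {})"
  have memT: "u \<in> T \<longleftrightarrow> P" "v \<in> T \<longleftrightarrow> Q" and T_old: "\<And>t. t \<in> ?V \<Longrightarrow> t \<in> T \<longleftrightarrow> t \<in> S"
    using uv vset_suppressed by (auto simp: T_def)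
  have R_cross: "crosses T f \<longleftrightarrow> crosses S f" if "f \<in> set R" for f
  proof -
    have "src f \<in> ?V" "tgt f \<in> ?V" using that unfolding suppressed_def vset_def by auto
    then show ?thesis using T_old by (simp add: crosses_def)
  qed
  have cT: "cut E T = of_bool (P \<noteq> Q) + cut E' S"
  proof -
    have "cut R T = cut R S" unfolding cut_def
      by (intro arg_cong[of _ _ length] filter_cong) (use R_cross in auto)
    moreover have "cut E T = cut (e # a1 # a2 # b1 # b2 # R) T" unfolding cut_def by (rule filter_parts)
    moreover have "crosses T e \<longleftrightarrow> P \<noteq> Q" using memT by (simp add: crosses_def)
    moreover have "crosses T a1 \<longleftrightarrow> P \<noteq> (x \<in> S)" "crosses T a2 \<longleftrightarrow> P \<noteq> (y \<in> S)"
      "crosses T b1 \<longleftrightarrow> Q \<noteq> (z \<in> S)" "crosses T b2 \<longleftrightarrow> Q \<noteq> (w \<in> S)"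
      using inc_oth a_facts b_facts memT T_old xyzw_in by metis+
    ultimately show ?thesis
      unfolding suppressed_def by (simp add: cut_Cons crosses_def[of S "(_, _, _)"] P_def Q_def)
  qed
  obtain s t where st: "s \<in> ?V" "s \<in> S" "t \<in> ?V" "t \<notin> S" using S by blast
  have TV: "T \<subseteq> vset E" using vset_suppressed vsetI[OF e] by (auto simp: T_def)
  have sT: "s \<in> T" "t \<notin> T" "t \<in> vset E" "s \<in> vset E" using st T_old vset_suppressed by auto
  then have "3 \<le> cut E T" by (intro cubic3_cut[OF cubic3]) blast+
  show "3 \<le> cut E' S"
  proof (rule ccontr)
    assume less: "\<not> 3 \<le> cut E' S"
    have PQ: "P \<noteq> Q"
    proof
      assume "P = Q"
      then show False using less cT \<open>3 \<le> cut E T\<close> by simp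
    qed
    then have c3: "cut E T = 3" using less cT \<open>3 \<le> cut E T\<close> by simp
    have cr: "crosses T e" using PQ memT by (simp add: crosses_def)
    have finT: "finite T" using TV finite_subset finite_vset by blast
    have suv: "s \<noteq> u" "s \<noteq> v" "t \<noteq> u" "t \<noteq> v" using st vset_suppressed by auto
    \<comment> \<open>Exactly one of \<open>u\<close> and \<open>v\<close> lies in \<open>T\<close>,
      so each side contains one of them besides an old vertex.\<close>
    have "2 \<le> card T"
    proof -
      obtain r where "r \<in> T" "r \<in> {u, v}" using PQ memT by auto
      then have "card {s, r} \<le> card T" by (intro card_mono finT) (use sT in auto)
      then show ?thesis using suv \<open>r \<in> {u, v}\<close> by auto
    qed
    moreover have "2 \<le> card (vset E - T)"
    proof -
      obtain r where "r \<notin> T" "r \<in> {u, v}" using PQ memT by auto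
      then have "card {t, r} \<le> card (vset E - T)" by (intro card_mono) (use sT vsetI[OF e] in auto)
      then show ?thesis using suv \<open>r \<in> {u, v}\<close> by auto
    qed
    ultimately have "nontrivial E T" using TV c3 by (simp add: nontrivial_def)
    then show False using avoid cr by blast
  qed
qed

end

section \<open>Three spanning trees without a common edge\<close>

lemma conD: "con V F \<Longrightarrow> \<forall>e\<in>F. \<not> crosses S e \<Longrightarrow> undivided V S"
  by (simp add: con_def)

definition without :: "('e, 'v) edge list \<Rightarrow> ('e \<times> 'c) list \<Rightarrow> 'c \<Rightarrow> ('e, 'v) edge list" where
  "without E K c = filter (\<lambda>f. (fst f, c) \<notin> set K) E"

text \<open>Colours are attached to identifiers and not to edges with their ends, because a
  reduction changes the ends but keeps identifiers.\<close>

definition edge_colouring :: "'c set \<Rightarrow> ('e, 'v) edge list \<Rightarrow> ('e \<times> 'c) list \<Rightarrow> bool" where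
  "edge_colouring Cs E K \<longleftrightarrow> distinct (map fst K) \<and> fst ` set K = fst ` set E \<and> snd ` set K \<subseteq> Cs"

text \<open>Equivalently, each colour class avoids some spanning tree. As every edge has a colour,
  it is missing from one of the three trees.\<close>

definition cotree_colouring :: "'c set \<Rightarrow> ('e, 'v) edge list \<Rightarrow> ('e \<times> 'c) list \<Rightarrow> bool" where
  "cotree_colouring Cs E K \<longleftrightarrow> edge_colouring Cs E K
     \<and> (\<forall>c\<in>Cs. con (vset E) (set (without E K c)))"

text \<open>In the smaller graph the identifiers of \<open>a1\<close> and \<open>b1\<close> name the
  two replacement edges, so their old entries are dropped.\<close>

definition recolour ::
    "('e, 'v) quintuple \<Rightarrow> ('e \<times> 'c) list \<Rightarrow> 'c \<times> 'c \<times> 'c \<times> 'c \<times> 'c \<Rightarrow> ('e \<times> 'c) list" where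
  "recolour = (\<lambda>(e, a1, a2, b1, b2) K (c1, c2, c3, c4, c5).
     (fst a1, c1) # (fst a2, c2) # (fst b1, c3) # (fst b2, c4) # (fst e, c5) #
       filter (\<lambda>k. fst k \<noteq> fst a1 \<and> fst k \<noteq> fst b1) K)"

context reduction
begin

lemma ids: "fst e \<noteq> fst a1" "fst e \<noteq> fst a2" "fst e \<noteq> fst b1" "fst e \<noteq> fst b2" "fst a1 \<noteq> fst a2"
    "fst a1 \<noteq> fst b1" "fst a1 \<noteq> fst b2" "fst a2 \<noteq> fst b1" "fst a2 \<noteq> fst b2" "fst b1 \<noteq> fst b2"
    "fst e \<notin> fst ` set R" "fst a1 \<notin> fst ` set R" "fst a2 \<notin> fst ` set R" "fst b1 \<notin> fst ` set R" "fst b2 \<notin> fst ` set R"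
  using ids_parts by simp_all

lemma recolour_old:
  assumes "fst ` set K = fst ` set E'"
  shows "fst ` set (filter (\<lambda>k. fst k \<noteq> fst a1 \<and> fst k \<noteq> fst b1) K) = fst ` set R"
proof -
  have "fst ` set K = {fst a1, fst b1} \<union> fst ` set R" unfolding assms suppressed_def by auto
  moreover have "fst ` set (filter (\<lambda>k. fst k \<noteq> fst a1 \<and> fst k \<noteq> fst b1) K) = fst ` set K - {fst a1, fst b1}"
    by force
  ultimately show ?thesis using ids(12,14) by (simp add: insert_Diff_if)
qed

lemma edge_colouring_recolour:
  assumes K: "edge_colouring Cs E' K" and c: "c1 \<in> Cs" "c2 \<in> Cs" "c3 \<in> Cs" "c4 \<in> Cs" "c5 \<in> Cs"
  shows "edge_colouring Cs E (recolour (e, a1, a2, b1, b2) K (c1, c2, c3, c4, c5))" (is "edge_colouring _ _ ?K")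
proof -
  let ?old = "filter (\<lambda>k. fst k \<noteq> fst a1 \<and> fst k \<noteq> fst b1) K"
  have Keq: "?K = (fst a1, c1) # (fst a2, c2) # (fst b1, c3) # (fst b2, c4) # (fst e, c5) # ?old"
    by (simp add: recolour_def)
  have dK: "distinct (map fst K)" and domK: "fst ` set K = fst ` set E'" and ranK: "snd ` set K \<subseteq> Cs"
    using K by (simp_all add: edge_colouring_def)
  have domK0: "fst ` set ?old = fst ` set R" using domK by (rule recolour_old)
  show ?thesis unfolding edge_colouring_def
  proof (intro conjI)
    have "distinct (map fst ?old)" using dK by (simp add: distinct_map_filter)
    moreover have "set (map fst ?old) = fst ` set R" using domK0 by simp
    ultimately show "distinct (map fst ?K)" unfolding Keq using ids
      by (simp only: list.map distinct.simps list.set insert_iff fst_conv set_map empty_iff) simp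
    show "fst ` set ?K = fst ` set E" unfolding Keq set_parts using domK0 by (simp add: insert_commute)
    show "snd ` set ?K \<subseteq> Cs" unfolding Keq using c ranK by auto
  qed
qed

lemma recolour_exists:
  assumes K: "cotree_colouring Cs E' K" and Cs: "card Cs = 3"
  shows "\<exists>cs\<in>Cs \<times> Cs \<times> Cs \<times> Cs \<times> Cs. cotree_colouring Cs E (recolour (e, a1, a2, b1, b2) K cs)"
proof -
  have domK: "fst ` set K = fst ` set E'" and ranK: "snd ` set K \<subseteq> Cs"
    and conK: "\<And>c. c \<in> Cs \<Longrightarrow> con (vset E') (set (without E' K c))"
    using K by (auto simp: cotree_colouring_def edge_colouring_def)
  have "fst a1 \<in> fst ` set K" "fst b1 \<in> fst ` set K" unfolding domK suppressed_def by auto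
  then obtain ca cb where ca: "(fst a1, ca) \<in> set K" and cb: "(fst b1, cb) \<in> set K" by auto
  have caC: "ca \<in> Cs" "cb \<in> Cs" using ca cb ranK by force+
  \<comment> \<open>The untouched edges enter the colouring argument only through this predicate,
    which is closed under symmetric difference.\<close>
  define Q where "Q c S \<longleftrightarrow> (\<forall>f\<in>set R. (fst f, c) \<notin> set K \<longrightarrow> \<not> crosses S f)" for c S
  have "\<exists>c1\<in>Cs. \<exists>c2\<in>Cs. \<exists>c3\<in>Cs. \<exists>c4\<in>Cs. \<exists>c5\<in>Cs. \<forall>c\<in>Cs. \<forall>S. Q c S \<longrightarrow> (c \<noteq> c1 \<longrightarrow> same S u x) \<longrightarrow>
    (c \<noteq> c2 \<longrightarrow> same S u y) \<longrightarrow> (c \<noteq> c3 \<longrightarrow> same S v z) \<longrightarrow>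
    (c \<noteq> c4 \<longrightarrow> same S v w) \<longrightarrow> (c \<noteq> c5 \<longrightarrow> same S u v) \<longrightarrow>
    undivided ({u, v} \<union> vset E') S"
  proof (rule colour_split_edges[where ca = ca and cb = cb])
    show "Q c {s. (s \<in> S) \<noteq> (s \<in> T)}" if "Q c S" "Q c T" for c S T
      using that unfolding Q_def crosses_xor by simp
    show "undivided (vset E') S"
      if "c \<in> Cs" "Q c S" "c \<noteq> ca \<longrightarrow> same S x y" "c \<noteq> cb \<longrightarrow> same S z w" for c S
    proof -
      have "\<not> crosses S f" if f: "f \<in> set (without E' K c)" for f
      proof -
        have "f \<in> set E'" and fK: "(fst f, c) \<notin> set K" using f by (auto simp: without_def)
        then consider "f = (fst a1, x, y)" | "f = (fst b1, z, w)" | "f \<in> set R"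
          by (auto simp: suppressed_def)
        then show ?thesis
        proof cases
          case 1
          then have "c \<noteq> ca" using fK ca by auto
          then show ?thesis using 1 \<open>c \<noteq> ca \<longrightarrow> same S x y\<close> by (simp add: crosses_def)
        next
          case 2
          then have "c \<noteq> cb" using fK cb by auto
          then show ?thesis using 2 \<open>c \<noteq> cb \<longrightarrow> same S z w\<close> by (simp add: crosses_def)
        next
          case 3
          then show ?thesis using fK \<open>Q c S\<close> by (simp add: Q_def)
        qed
      qed
      then show ?thesis using conK[OF \<open>c \<in> Cs\<close>] unfolding con_def by simp
    qed
  qed (use xyzw_in Cs caC in simp_all)
  then obtain c1 c2 c3 c4 c5 where c: "c1 \<in> Cs" "c2 \<in> Cs" "c3 \<in> Cs" "c4 \<in> Cs" "c5 \<in> Cs"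
    and all: "\<forall>c\<in>Cs. \<forall>S. Q c S \<longrightarrow> (c \<noteq> c1 \<longrightarrow> same S u x) \<longrightarrow>
    (c \<noteq> c2 \<longrightarrow> same S u y) \<longrightarrow> (c \<noteq> c3 \<longrightarrow> same S v z) \<longrightarrow>
    (c \<noteq> c4 \<longrightarrow> same S v w) \<longrightarrow> (c \<noteq> c5 \<longrightarrow> same S u v) \<longrightarrow>
    undivided ({u, v} \<union> vset E') S"
    by (elim bexE) (rule that)
  note all' = all[THEN bspec, THEN spec, THEN mp, THEN mp, THEN mp, THEN mp, THEN mp, THEN mp]
  let ?K = "recolour (e, a1, a2, b1, b2) K (c1, c2, c3, c4, c5)"
  let ?old = "filter (\<lambda>k. fst k \<noteq> fst a1 \<and> fst k \<noteq> fst b1) K"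
  have Keq: "?K = (fst a1, c1) # (fst a2, c2) # (fst b1, c3) # (fst b2, c4) # (fst e, c5) # ?old"
    by (simp add: recolour_def)
  have domK0: "fst ` set ?old = fst ` set R" using domK by (rule recolour_old)
  have notin0: "(i, c) \<notin> set ?old" if "i \<notin> fst ` set R" for i c
  proof
    assume "(i, c) \<in> set ?old"
    then have "i \<in> fst ` set ?old" by (intro image_eqI[of _ _ "(i, c)"]) simp_all
    then show False using that unfolding domK0 by simp
  qed
  have notin: "(fst e, c) \<notin> set ?old" "(fst a1, c) \<notin> set ?old" "(fst a2, c) \<notin> set ?old" "(fst b1, c) \<notin> set ?old" "(fst b2, c) \<notin> set ?old" for c
    by (rule notin0, rule ids)+
  have mem: "(fst e, c) \<in> set ?K \<longleftrightarrow> c = c5" "(fst a1, c) \<in> set ?K \<longleftrightarrow> c = c1" "(fst a2, c) \<in> set ?K \<longleftrightarrow> c = c2"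
    "(fst b1, c) \<in> set ?K \<longleftrightarrow> c = c3" "(fst b2, c) \<in> set ?K \<longleftrightarrow> c = c4" for c
    unfolding Keq using notin ids(1-10) by auto
  have memR: "(fst f, c) \<in> set ?K \<longleftrightarrow> (fst f, c) \<in> set K" if "f \<in> set R" for f c
  proof -
    have "fst f \<in> fst ` set R" using that by simp
    then have "fst f \<noteq> fst e" "fst f \<noteq> fst a1" "fst f \<noteq> fst a2" "fst f \<noteq> fst b1" "fst f \<noteq> fst b2" using ids(11-15) by metis+
    then show ?thesis unfolding Keq by simp
  qed
  have "cotree_colouring Cs E ?K" unfolding cotree_colouring_def
  proof (intro conjI ballI)
    show "edge_colouring Cs E ?K"
      by (rule edge_colouring_recolour) (use K c in \<open>simp_all add: cotree_colouring_def\<close>)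
  next
    fix c assume cC: "c \<in> Cs"
    show "con (vset E) (set (without E ?K c))" unfolding con_def
    proof (intro allI impI)
      fix S assume nc: "\<forall>f\<in>set (without E ?K c). \<not> crosses S f"
      have nc': "\<not> crosses S f" if "f \<in> set E" "(fst f, c) \<notin> set ?K" for f
        using that by (intro bspec[OF nc]) (simp add: without_def)
      have Rsub: "f \<in> set R \<Longrightarrow> f \<in> set E" for f by (simp add: rest_def)
      have "undivided ({u, v} \<union> vset E') S"
      proof (rule all'[OF cC])
        show "Q c S" unfolding Q_def
        proof (intro ballI impI)
          fix f assume "f \<in> set R" "(fst f, c) \<notin> set K"
          then show "\<not> crosses S f" by (intro nc') (use Rsub memR in simp_all)
        qed
        show "c \<noteq> c1 \<longrightarrow> same S u x" using nc'[OF a_facts(1)] mem inc_oth[OF a_facts(3)] by simp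
        show "c \<noteq> c2 \<longrightarrow> same S u y" using nc'[OF a_facts(2)] mem inc_oth[OF a_facts(4)] by simp
        show "c \<noteq> c3 \<longrightarrow> same S v z" using nc'[OF b_facts(1)] mem inc_oth[OF b_facts(3)] by simp
        show "c \<noteq> c4 \<longrightarrow> same S v w" using nc'[OF b_facts(2)] mem inc_oth[OF b_facts(4)] by simp
        show "c \<noteq> c5 \<longrightarrow> same S u v" using nc'[OF e] mem by (simp add: crosses_def)
      qed
      moreover have "vset E = {u, v} \<union> vset E'" using vset_suppressed vsetI[OF e] by auto
      ultimately show "undivided (vset E) S" by simp
    qed
  qed
  then show ?thesis using c by (intro bexI[of _ "(c1, c2, c3, c4, c5)"]) simp_all
qed

end

section \<open>Testing 3-edge-connectedness and searching for a reducible edge\<close>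

definition vlist :: "('e, 'v) edge list \<Rightarrow> 'v list" where
  "vlist E = map (\<lambda>e. src e) E @ map (\<lambda>e. tgt e) E"

text \<open>The case \<open>f = g\<close> covers the deletion of a single edge.\<close>

definition three_conn :: "('e, 'v) edge list \<Rightarrow> bool" where
  "three_conn E \<longleftrightarrow> (\<forall>f\<in>set E. \<forall>g\<in>set E. connects (vlist E) (filter (\<lambda>e. e \<noteq> f \<and> e \<noteq> g) E))"

lemma set_vlist: "set (vlist E) = vset E"
  by (auto simp: vlist_def vset_def)

lemma connects_vlist:
  assumes "E \<noteq> []" "set F \<subseteq> set E"
  shows "connects (vlist E) F \<longleftrightarrow> con (vset E) (set F)"
  unfolding set_vlist[symmetric]
  by (rule connects_iff_con) (use assms in \<open>auto simp: vlist_def\<close>)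

lemma three_conn_iff:
  assumes ne: "E \<noteq> []" and dist: "distinct E"
  shows "three_conn E \<longleftrightarrow> cut_ge 3 (vset E) E"
proof
  assume tc: "three_conn E"
  have con: "con (vset E) {e \<in> set E. e \<noteq> f \<and> e \<noteq> g}" if "f \<in> set E" "g \<in> set E" for f g
    using tc that connects_vlist[OF ne, of "filter (\<lambda>e. e \<noteq> f \<and> e \<noteq> g) E"] by (auto simp: three_conn_def)
  show "cut_ge 3 (vset E) E" unfolding cut_ge_def
  proof (intro allI impI, rule ccontr)
    fix S assume S: "vset E \<inter> S \<noteq> {}" "\<not> vset E \<subseteq> S" "\<not> 3 \<le> cut E S"
    let ?C = "filter (crosses S) E"
    have len: "length ?C \<le> 2" using S(3) by (simp add: cut_def)
    \<comment> \<open>A cut with fewer than two edges is padded: \<open>f = g\<close> if it has one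
      edge, and an arbitrary edge if it is empty.\<close>
    have "\<exists>f\<in>set E. \<exists>g\<in>set E. set ?C \<subseteq> {f, g}"
    proof (cases ?C)
      case Nil
      then show ?thesis using hd_in_set[OF ne] by (intro bexI[of _ "hd E"]) simp_all
    next
      case (Cons f fs)
      have fE: "f \<in> set E" using arg_cong[OF Cons, of set] by auto
      show ?thesis
      proof (cases fs)
        case Nil
        then show ?thesis using Cons fE by (intro bexI[of _ f]) simp_all
      next
        case (Cons g gs)
        then have C: "?C = [f, g]" using \<open>?C = f # fs\<close> len by simp
        have "g \<in> set ?C" unfolding C by simp
        then have "g \<in> set E" by simp
        then show ?thesis using C fE by (intro bexI[of _ f] bexI[of _ g]) simp_all
      qed
    qed
    then obtain f g where fg: "f \<in> set E" "g \<in> set E" "set ?C \<subseteq> {f, g}" by blast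
    have "\<forall>e\<in>{e \<in> set E. e \<noteq> f \<and> e \<noteq> g}. \<not> crosses S e" using fg(3) by auto
    then show False using conD[OF con[OF fg(1,2)]] S(1,2) by blast
  qed
next
  assume ge: "cut_ge 3 (vset E) E"
  show "three_conn E" unfolding three_conn_def
  proof (intro ballI)
    fix f g assume fg: "f \<in> set E" "g \<in> set E"
    have "con (vset E) (set (filter (\<lambda>e. e \<noteq> f \<and> e \<noteq> g) E))" unfolding con_def
    proof (intro allI impI, rule ccontr)
      fix S assume nc: "\<forall>e\<in>set (filter (\<lambda>e. e \<noteq> f \<and> e \<noteq> g) E). \<not> crosses S e"
        and S: "\<not> (undivided (vset E) S)"
      have "set (filter (crosses S) E) \<subseteq> {f, g}" using nc by auto
      then have "card (set (filter (crosses S) E)) \<le> card {f, g}" by (intro card_mono) simp_all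
      also have "\<dots> \<le> 2" by (simp add: card_insert_if)
      finally have "cut E S \<le> 2" using distinct_card[of "filter (crosses S) E"] dist by (simp add: cut_def)
      moreover have "3 \<le> cut E S" using ge S unfolding cut_ge_def by simp
      ultimately show False by simp
    qed
    then show "connects (vlist E) (filter (\<lambda>e. e \<noteq> f \<and> e \<noteq> g) E)"
      by (subst connects_vlist[OF ne]) auto
  qed
qed

text \<open>Testing connectedness suffices, since the degrees and the absence of loops carry over to
  every reduction by \<open>cubic3_suppressed\<close>.\<close>

definition candidates :: "('e, 'v) edge list \<Rightarrow> (('e, 'v) quintuple \<times> ('e, 'v) edge list) list" where
  "candidates E = filter (\<lambda>r. three_conn (snd r)) (concat (map (reduce E) E))"

lemma reduction_reduce:
  assumes "cubic3 E" "2 < card (vset E)" "e \<in> set E"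
  shows "\<exists>a1 a2 b1 b2. reduction E e a1 a2 b1 b2 \<and> reduce E e = [((e, a1, a2, b1, b2), suppressed E e a1 a2 b1 b2)]"
proof -
  obtain a1 a2 b1 b2 where "side1 E e = [a1, a2]" "side2 E e = [b1, b2]"
    using reduce_shape[OF assms] by blast
  then show ?thesis using assms by (intro exI[of _ a1] exI[of _ a2] exI[of _ b1] exI[of _ b2]) (simp add: reduction_def reduce_def)
qed

lemma suppressed_not_Nil: "suppressed E e a1 a2 b1 b2 \<noteq> []"
  by (simp add: suppressed_def)

lemma candidates_sound:
  assumes cubic3: "cubic3 E" and card: "2 < card (vset E)" and r: "r \<in> set (candidates E)"
  shows "\<exists>e a1 a2 b1 b2. reduction E e a1 a2 b1 b2 \<and> r = ((e, a1, a2, b1, b2), suppressed E e a1 a2 b1 b2)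
    \<and> cubic3 (suppressed E e a1 a2 b1 b2)"
proof -
  have "\<exists>e\<in>set E. r \<in> set (reduce E e)" and tc: "three_conn (snd r)" using r by (auto simp: candidates_def)
  then obtain e where e: "e \<in> set E" "r \<in> set (reduce E e)" by blast
  obtain a1 a2 b1 b2 where red: "reduction E e a1 a2 b1 b2"
    and "reduce E e = [((e, a1, a2, b1, b2), suppressed E e a1 a2 b1 b2)]"
    using reduction_reduce[OF cubic3 card e(1)] by blast
  then have r_eq: "r = ((e, a1, a2, b1, b2), suppressed E e a1 a2 b1 b2)" using e(2) by simp
  have "distinct (suppressed E e a1 a2 b1 b2)"
    using reduction.ids_suppressed[OF red] by (simp add: distinct_map)
  then have "cut_ge 3 (vset (suppressed E e a1 a2 b1 b2)) (suppressed E e a1 a2 b1 b2)"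
    using tc three_conn_iff[OF suppressed_not_Nil, of E e a1 a2 b1 b2] unfolding r_eq by simp
  then have "cubic3 (suppressed E e a1 a2 b1 b2)" by (rule reduction.cubic3_suppressed[OF red])
  then show ?thesis using red r_eq by (intro exI conjI)
qed

lemma candidates_complete:
  assumes cubic3: "cubic3 E" and card: "2 < card (vset E)"
  shows "candidates E \<noteq> []"
proof -
  obtain e where e: "e \<in> set E" "\<And>W. nontrivial E W \<Longrightarrow> \<not> crosses W e"
    using exists_edge_avoiding_cuts[OF cubic3 card] by blast
  obtain a1 a2 b1 b2 where red: "reduction E e a1 a2 b1 b2"
    and eq: "reduce E e = [((e, a1, a2, b1, b2), suppressed E e a1 a2 b1 b2)]"
    using reduction_reduce[OF cubic3 card e(1)] by blast
  have "distinct (suppressed E e a1 a2 b1 b2)"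
    using reduction.ids_suppressed[OF red] by (simp add: distinct_map)
  then have "three_conn (suppressed E e a1 a2 b1 b2)"
    using reduction.cut_ge_suppressed[OF red e(2)] three_conn_iff[OF suppressed_not_Nil, of E e a1 a2 b1 b2] by simp
  then have "((e, a1, a2, b1, b2), suppressed E e a1 a2 b1 b2) \<in> set (candidates E)"
    using e(1) eq unfolding candidates_def by force
  then show ?thesis by auto
qed

text \<open>On two vertices every edge joins both, so \<open>side2\<close> is empty. The search thus
  stops by itself at three parallel edges.\<close>

lemma candidates_small:
  assumes cubic3: "cubic3 E" and card: "card (vset E) \<le> 2"
  shows "candidates E = []"
proof -
  have "reduce E e = []" if e: "e \<in> set E" for e
  proof -
    have uv: "src e \<noteq> tgt e" using cubic3 e by (rule cubic3_loopfree)
    have "vset E = {src e, tgt e}"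
      using card_seteq[of "vset E" "{src e, tgt e}"] vsetI[OF e] uv card by simp
    then have "inc (src e) f" if "f \<in> set E" for f
      using vsetI[OF that] cubic3_loopfree[OF cubic3 that] by (auto simp: inc_def)
    then have "side2 E e = []" by (simp add: side2_def filter_empty_conv)
    then show ?thesis by (simp add: reduce_def split: list.splits)
  qed
  then show ?thesis by (simp add: candidates_def)
qed

section \<open>The construction of the nine subgraphs and its correctness\<close>

definition palette :: "nat list" where "palette = [0, 1, 2]"

lemma card_palette: "card (set palette) = 3" by (simp add: palette_def)

definition reduce_step ::
    "('e, 'v) edge list \<times> (('e, 'v) edge list \<times> ('e, 'v) quintuple) list \<Rightarrow>
     ('e, 'v) edge list \<times> (('e, 'v) edge list \<times> ('e, 'v) quintuple) list" where
  "reduce_step st = (case candidates (fst st) of [] \<Rightarrow> st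
     | r # _ \<Rightarrow> (snd r, snd st @ [(fst st, fst r)]))"

definition reductions ::
    "('e, 'v) edge list \<Rightarrow> ('e, 'v) edge list \<times> (('e, 'v) edge list \<times> ('e, 'v) quintuple) list" where
  "reductions E = (reduce_step ^^ length E) (E, [])"

definition valid :: "('e, 'v) edge list \<Rightarrow> ('e \<times> nat) list \<Rightarrow> bool" where
  "valid E K \<longleftrightarrow> (\<forall>c\<in>set palette. connects (vlist E) (without E K c))"

text \<open>Meant for two vertices joined by three edges; the empty lists are mere defaults.\<close>

definition base_colouring :: "('e, 'v) edge list \<Rightarrow> ('e \<times> nat) list" where
  "base_colouring E = (case E of [] \<Rightarrow> [] | f # E1 \<Rightarrow> (case E1 of [] \<Rightarrow> [] | g # E2 \<Rightarrow>
     (case E2 of [] \<Rightarrow> [] | h # _ \<Rightarrow> [(fst f, 0), (fst g, 1), (fst h, 2)])))"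

definition colour_tuples :: "(nat \<times> nat \<times> nat \<times> nat \<times> nat) list" where
  "colour_tuples = List.product palette (List.product palette (List.product palette (List.product palette palette)))"

text \<open>All 243 recolourings are tried instead of following the case distinction of
  \<open>colour_split_edges\<close>; the default \<open>K\<close> is never reached on the inputs in
  question.\<close>

definition unreduce :: "('e, 'v) edge list \<times> ('e, 'v) quintuple \<Rightarrow> ('e \<times> nat) list \<Rightarrow> ('e \<times> nat) list" where
  "unreduce r K = (case filter (valid (fst r)) (map (recolour (snd r) K) colour_tuples) of [] \<Rightarrow> K | K' # _ \<Rightarrow> K')"

text \<open>New reductions are appended to the history, so \<open>foldr\<close> undoes the latest
  one first.\<close>

definition cotrees :: "('e, 'v) edge list \<Rightarrow> ('e \<times> nat) list" where
  "cotrees E = foldr unreduce (snd (reductions E)) (base_colouring (fst (reductions E)))"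

definition classes :: "('e, 'v) edge list \<Rightarrow> ('e, 'v) edge list \<Rightarrow> (('e, 'v) edge \<times> nat) list" where
  "classes E F = (let L = snd (grow (vlist E) F)
     in colouring palette (filter (\<lambda>e. e \<notin> set (map fst L)) E) (map snd L))"

definition subgraphs :: "('e, 'v) edge list \<Rightarrow> ('e, 'v) edge list list" where
  "subgraphs E = concat (map (\<lambda>c. map (\<lambda>d. filter (\<lambda>e. (e, d) \<notin> set (classes E (without E (cotrees E) c))) E) palette) palette)"

lemma set_without: "set (without E K c) \<subseteq> set E" by (auto simp: without_def)

lemma valid_iff: "E \<noteq> [] \<Longrightarrow> valid E K \<longleftrightarrow> (\<forall>c\<in>set palette. con (vset E) (set (without E K c)))"
  by (simp add: valid_def connects_vlist set_without)

lemma base_colouring: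
  assumes cubic3: "cubic3 E" and ne: "E \<noteq> []" and card: "card (vset E) \<le> 2"
  shows "cotree_colouring (set palette) E (base_colouring E)"
proof -
  have e: "hd E \<in> set E" using ne by simp
  define s t where "s = src (hd E)" and "t = tgt (hd E)"
  have st: "s \<noteq> t" using cubic3_loopfree[OF cubic3 e] by (simp add: s_def t_def)
  have sv: "s \<in> vset E" "t \<in> vset E" using vsetI[OF e] by (simp_all add: s_def t_def)
  then have V: "vset E = {s, t}" using card_seteq[of "vset E" "{s, t}"] st card by simp
  have ends: "src f = s \<and> tgt f = t \<or> src f = t \<and> tgt f = s" if "f \<in> set E" for f
  proof -
    have "src f \<in> {s, t}" "tgt f \<in> {s, t}" "src f \<noteq> tgt f"
      using vsetI[OF that] cubic3_loopfree[OF cubic3 that] unfolding V by simp_all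
    then show ?thesis by auto
  qed
  have "filter (inc s) E = E" by (rule filter_True) (use ends in \<open>auto simp: inc_def\<close>)
  moreover have "length (filter (inc s) E) = 3" using cubic3 sv by (simp add: cubic3_def)
  ultimately have "length E = 3" by simp
  then obtain f g h where E: "E = [f, g, h]" by (auto simp: numeral_3_eq_3 length_Suc_conv)
  have dist: "distinct [fst f, fst g, fst h]" using cubic3 unfolding E by (simp add: cubic3_def)
  have K: "base_colouring E = [(fst f, 0), (fst g, 1), (fst h, 2)]" by (simp add: E base_colouring_def)
  have "con (vset E) (set (without E (base_colouring E) c))" if "c \<in> set palette" for c
  proof -
    \<comment> \<open>On two vertices a single remaining edge connects, and each colour occurs on
      only one of the three.\<close>
    have "without E (base_colouring E) c \<noteq> []"
    proof (cases "c = 0")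
      case True
      then show ?thesis unfolding without_def E K[unfolded E] using dist by auto
    next
      case False
      then show ?thesis unfolding without_def E K[unfolded E] using dist by auto
    qed
    then have "hd (without E (base_colouring E) c) \<in> set (without E (base_colouring E) c)" by simp
    then obtain r where r: "r \<in> set (without E (base_colouring E) c)" ..
    then have rE: "r \<in> set E" using set_without[of E "base_colouring E" c] by blast
    show ?thesis unfolding con_def
    proof (intro allI impI)
      fix S assume "\<forall>e\<in>set (without E (base_colouring E) c). \<not> crosses S e"
      then have "\<not> crosses S r" using r by (rule bspec)
      then have "same S s t" using ends[OF rE] by (auto simp: crosses_def)
      then show "undivided (vset E) S" unfolding V by auto
    qed
  qed
  moreover have "edge_colouring (set palette) E (base_colouring E)"
    using dist unfolding edge_colouring_def K by (simp add: E palette_def insert_commute)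
  ultimately show ?thesis unfolding cotree_colouring_def by blast
qed

inductive chain ::
    "('e, 'v) edge list \<Rightarrow> (('e, 'v) edge list \<times> ('e, 'v) quintuple) list \<Rightarrow> ('e, 'v) edge list \<Rightarrow> bool" where
  chain_Nil: "chain E [] E"
| chain_snoc: "chain E Rs E1 \<Longrightarrow> reduction E1 e a1 a2 b1 b2 \<Longrightarrow>
    chain E (Rs @ [(E1, (e, a1, a2, b1, b2))]) (suppressed E1 e a1 a2 b1 b2)"

text \<open>The search may find another tuple than the one known to exist. This does no harm:
  \<open>valid\<close> tests the connectedness, and any tuple over the palette gives an edge
  colouring.\<close>

lemma unreduce_correct:
  assumes red: "reduction E e a1 a2 b1 b2"
    and K: "cotree_colouring (set palette) (suppressed E e a1 a2 b1 b2) K"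
  shows "cotree_colouring (set palette) E (unreduce (E, (e, a1, a2, b1, b2)) K)"
proof -
  let ?q = "(e, a1, a2, b1, b2)"
  let ?Cs = "set palette \<times> set palette \<times> set palette \<times> set palette \<times> set palette"
  have ne: "E \<noteq> []" using reduction.e[OF red] by auto
  obtain cs where cs: "cs \<in> ?Cs"
    and ok: "cotree_colouring (set palette) E (recolour ?q K cs)"
    using reduction.recolour_exists[OF red K card_palette] by (elim bexE) (rule that)
  have "valid E (recolour ?q K cs)" using ok by (simp add: valid_iff[OF ne] cotree_colouring_def)
  then have "recolour ?q K cs \<in> set (filter (valid E) (map (recolour ?q K) colour_tuples))"
    using cs by (simp add: colour_tuples_def)
  then obtain K' Ks where K': "filter (valid E) (map (recolour ?q K) colour_tuples) = K' # Ks"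
    by (cases "filter (valid E) (map (recolour ?q K) colour_tuples)") simp_all
  then have "K' \<in> set (filter (valid E) (map (recolour ?q K) colour_tuples))" by simp
  then have v: "valid E K'" and "K' \<in> recolour ?q K ` set colour_tuples" by simp_all
  then obtain cs' where "cs' \<in> set colour_tuples" and K'eq: "K' = recolour ?q K cs'" by (elim imageE) (rule that)
  then have cs': "cs' \<in> ?Cs"
    by (simp add: colour_tuples_def)
  obtain c1 c2 c3 c4 c5 where c: "cs' = (c1, c2, c3, c4, c5)" by (rule prod_cases5)
  have "edge_colouring (set palette) E K'" unfolding K'eq c
    by (rule reduction.edge_colouring_recolour[OF red]) (use K cs' in \<open>simp_all add: cotree_colouring_def c\<close>)
  then have "cotree_colouring (set palette) E K'" using v by (simp add: cotree_colouring_def valid_iff[OF ne])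
  then show ?thesis by (simp add: unreduce_def K')
qed

lemma chain_correct:
  "chain E Rs E' \<Longrightarrow> cotree_colouring (set palette) E' K \<Longrightarrow> cotree_colouring (set palette) E (foldr unreduce Rs K)"
proof (induction arbitrary: K rule: chain.induct)
  case (chain_snoc E Rs E1 e a1 a2 b1 b2)
  show ?case using chain_snoc.IH[OF unreduce_correct[OF chain_snoc.hyps(2) chain_snoc.prems]] by simp
qed simp

text \<open>Every round that changes the state loses a vertex; once at most two vertices are left,
  nothing changes any more. Hence the number of rounds bounds the vertices that remain.\<close>

lemma reduce_steps:
  assumes cubic3: "cubic3 E" and ne: "E \<noteq> []"
  defines "st \<equiv> \<lambda>n. (reduce_step ^^ n) (E, [])"
  shows "chain E (snd (st n)) (fst (st n)) \<and> cubic3 (fst (st n)) \<and> fst (st n) \<noteq> [] \<and>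
    (card (vset (fst (st n))) \<le> 2 \<or> card (vset (fst (st n))) + n \<le> card (vset E))"
proof (induction n)
  case 0
  show ?case using assms by (simp add: st_def chain_Nil)
next
  case (Suc n)
  let ?F = "fst (st n)"
  have st: "st (Suc n) = reduce_step (st n)" by (simp add: st_def)
  have ch: "chain E (snd (st n)) ?F" and F: "cubic3 ?F" "?F \<noteq> []" using Suc.IH by simp_all
  show ?case
  proof (cases "card (vset ?F) \<le> 2")
    case True
    then have "st (Suc n) = st n" using candidates_small[OF F(1)] by (simp add: st reduce_step_def)
    then show ?thesis using Suc.IH True by simp
  next
    case False
    then obtain r rs where r: "candidates ?F = r # rs"
      using candidates_complete[OF F(1)] by (cases "candidates ?F") simp_all
    have card: "2 < card (vset ?F)" using False by simp
    have "r \<in> set (candidates ?F)" by (simp add: r)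
    from candidates_sound[OF F(1) card this] obtain e a1 a2 b1 b2 where red: "reduction ?F e a1 a2 b1 b2"
      and r': "r = ((e, a1, a2, b1, b2), suppressed ?F e a1 a2 b1 b2)" "cubic3 (suppressed ?F e a1 a2 b1 b2)"
      by (elim exE conjE) (rule that)
    have eq: "st (Suc n) = (suppressed ?F e a1 a2 b1 b2, snd (st n) @ [(?F, (e, a1, a2, b1, b2))])"
      by (simp add: st reduce_step_def r r'(1))
    have "card (vset (suppressed ?F e a1 a2 b1 b2)) < card (vset ?F)"
      unfolding reduction.vset_suppressed[OF red]
      by (rule psubset_card_mono) (use vsetI[OF reduction.e[OF red]] in auto)
    then show ?thesis unfolding eq using chain_snoc[OF ch red] r'(2) suppressed_not_Nil Suc.IH False by simp
  qed
qed

text \<open>From \<open>3 * card (vset E) = 2 * length E\<close>: hence \<open>length E\<close>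
  rounds of reduction are enough.\<close>

lemma card_vset_le: "cubic3 E \<Longrightarrow> card (vset E) \<le> length E"
  using cubic3_degree_sum[of E "vset E"] length_filter_le[of "\<lambda>e. src e \<in> vset E \<and> tgt e \<in> vset E" E]
  by (simp add: cut_def crosses_def vsetI filter_empty_conv[THEN iffD2])

lemma cotrees_correct:
  assumes cubic3: "cubic3 E" and ne: "E \<noteq> []"
  shows "cotree_colouring (set palette) E (cotrees E)"
proof -
  have *: "chain E (snd (reductions E)) (fst (reductions E))" "cubic3 (fst (reductions E))" "fst (reductions E) \<noteq> []"
    and c: "card (vset (fst (reductions E))) \<le> 2 \<or> card (vset (fst (reductions E))) + length E \<le> card (vset E)"
    using reduce_steps[OF cubic3 ne, of "length E"] by (simp_all add: reductions_def)
  have "card (vset (fst (reductions E))) \<le> 2" using c card_vset_le[OF cubic3] by auto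
  then show ?thesis unfolding cotrees_def by (intro chain_correct[OF *(1)] base_colouring *(2,3))
qed

text \<open>For the last claim let \<open>c\<close> be the colour of \<open>e\<close> in the first
  colouring. The tree grown without \<open>c\<close> misses \<open>e\<close>, so \<open>e\<close>
  has a colour \<open>d\<close> in the second colouring, and the subgraph for \<open>c\<close> and
  \<open>d\<close> omits it.\<close>

theorem subgraphs_correct:
  assumes cubic3: "cubic3 E" and ne: "E \<noteq> []"
  shows "length (subgraphs E) = 9"
    and "F \<in> set (subgraphs E) \<Longrightarrow> distinct F \<and> set F \<subseteq> set E \<and> cut_ge 2 (vset E) F"
    and "e \<in> set E \<Longrightarrow> \<exists>F\<in>set (subgraphs E). e \<notin> set F"
proof -
  let ?K = "cotrees E"
  have K: "cotree_colouring (set palette) E ?K" using cubic3 ne by (rule cotrees_correct)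
  show "length (subgraphs E) = 9" by (simp add: subgraphs_def palette_def)
  have E: "\<forall>e\<in>set E. src e \<in> vset E \<and> tgt e \<in> vset E \<and> src e \<noteq> tgt e"
    using vsetI cubic3_loopfree[OF cubic3] by blast
  have key: "tree_family (vset E) (snd (grow (vlist E) (without E ?K c)))"
    "fst ` set (snd (grow (vlist E) (without E ?K c))) \<subseteq> set (without E ?K c)" if c: "c \<in> set palette" for c
  proof -
    have "con (vset E) (set (without E ?K c))" using K c by (simp add: cotree_colouring_def)
    then have cn: "connects (vlist E) (without E ?K c)" by (simp add: connects_vlist[OF ne set_without])
    have v: "vlist E \<noteq> []" using ne by (simp add: vlist_def)
    have sub: "\<forall>e\<in>set (without E ?K c). src e \<in> set (vlist E) \<and> tgt e \<in> set (vlist E)"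
      using E set_without[of E ?K c] unfolding set_vlist by blast
    show "tree_family (vset E) (snd (grow (vlist E) (without E ?K c)))"
      "fst ` set (snd (grow (vlist E) (without E ?K c))) \<subseteq> set (without E ?K c)"
      using connects_tree_family[OF v sub cn] by (simp_all add: set_vlist)
  qed
  have ge: "cut_ge 3 (vset E) E" using cubic3 by (simp add: cubic3_def)
  have card3: "card (set palette) \<ge> 3" by (simp add: card_palette)
  have removable: "cut_ge 2 (vset E) (filter (\<lambda>e. (e, d) \<notin> set (classes E (without E ?K c))) E)"
    if "c \<in> set palette" for c d
    unfolding classes_def Let_def
    by (rule colour_class_removable(1)[OF key(1)[OF that] _ E ge distinct_edges[OF cubic3] card3])
      (use key(2)[OF that] set_without[of E ?K c] in blast)
  show "distinct F \<and> set F \<subseteq> set E \<and> cut_ge 2 (vset E) F" if "F \<in> set (subgraphs E)"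
    using that removable distinct_edges[OF cubic3] by (auto simp: subgraphs_def)
  show "\<exists>F\<in>set (subgraphs E). e \<notin> set F" if e: "e \<in> set E"
  proof -
    have "fst e \<in> fst ` set ?K" using K e by (simp add: cotree_colouring_def edge_colouring_def)
    then obtain k where k: "k \<in> set ?K" "fst k = fst e" by force
    let ?c = "snd k"
    have c: "?c \<in> set palette" using K k(1) by (auto simp: cotree_colouring_def edge_colouring_def)
    have "(fst e, ?c) \<in> set ?K" using k by (metis prod.collapse)
    then have "e \<notin> set (without E ?K ?c)" by (simp add: without_def)
    then have "e \<notin> fst ` set (snd (grow (vlist E) (without E ?K ?c)))" using key(2)[OF c] by blast
    then obtain d where d: "d \<in> set palette" "(e, d) \<in> set (classes E (without E ?K ?c))"
      unfolding classes_def Let_def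
      using colour_class_removable(2)[OF key(1)[OF c] _ E ge distinct_edges[OF cubic3] card3 e] key(2)[OF c] set_without[of E ?K ?c]
      by blast
    let ?F = "filter (\<lambda>e. (e, d) \<notin> set (classes E (without E ?K ?c))) E"
    have "?F \<in> set (subgraphs E)" using c d(1) unfolding subgraphs_def by auto
    moreover have "e \<notin> set ?F" using d(2) by simp
    ultimately show ?thesis by (rule bexI[rotated])
  qed
qed

section \<open>Passing between graphs and edge lists\<close>

definition lists_graph :: "('v, 'e) graph \<Rightarrow> ('e, 'v) edge list \<Rightarrow> bool" where
  "lists_graph G E \<longleftrightarrow> distinct (map fst E) \<and> fst ` set E = edges G \<and>
     (\<forall>e\<in>set E. ends G (fst e) = {src e, tgt e})"

lemma cubic3_of_graph:
  assumes G: "wf_graph G" "cubic G" "edge_connected 3 G" and E: "lists_graph G E"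
  shows "cubic3 E" "vset E = verts G" "E \<noteq> []"
proof -
  have dist: "distinct (map fst E)" and ids: "fst ` set E = edges G"
    and ends: "\<And>e. e \<in> set E \<Longrightarrow> ends G (fst e) = {src e, tgt e}"
    using E by (auto simp: lists_graph_def)
  have inj: "inj_on fst (set E)" and distE: "distinct E" using dist by (simp_all add: distinct_map)
  have loopfree: "src e \<noteq> tgt e" and inV: "{src e, tgt e} \<subseteq> verts G" if "e \<in> set E" for e
  proof -
    have "fst e \<in> edges G" using that ids by blast
    then have "card (ends G (fst e)) = 2" "ends G (fst e) \<subseteq> verts G" using G(1) by (simp_all add: wf_graph_def)
    then show "src e \<noteq> tgt e" "{src e, tgt e} \<subseteq> verts G" unfolding ends[OF that] by auto
  qed
  have deg: "length (filter (inc v) E) = 3" if "v \<in> verts G" for v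
  proof -
    have "3 = card {i \<in> edges G. v \<in> ends G i}" using G(2) that by (simp add: cubic_def degree_in_def)
    also have "{i \<in> edges G. v \<in> ends G i} = fst ` set (filter (inc v) E)"
    proof -
      have "v \<in> ends G (fst e) \<longleftrightarrow> inc v e" if "e \<in> set E" for e
        unfolding ends[OF that] by (auto simp: inc_def)
      then show ?thesis unfolding ids[symmetric] set_filter by blast
    qed
    also have "card \<dots> = card (set (filter (inc v) E))"
      by (rule card_image) (rule inj_on_subset[OF inj], simp)
    also have "\<dots> = length (filter (inc v) E)" by (rule distinct_card) (use distE in simp)
    finally show ?thesis by simp
  qed
  show V: "vset E = verts G"
  proof
    show "vset E \<subseteq> verts G" using inV by (auto simp: vset_def)
    show "verts G \<subseteq> vset E"
    proof
      fix v assume "v \<in> verts G"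
      then have "filter (inc v) E \<noteq> []" using deg by force
      then have "\<exists>e\<in>set E. inc v e" by (simp add: filter_empty_conv)
      then show "v \<in> vset E" by (auto simp: vset_def inc_def)
    qed
  qed
  have conn: "con (verts G) (set E - D)" and ne: "verts G \<noteq> {}" if "D \<subseteq> set E" "card D < 3" for D
  proof -
    have "card (fst ` D) < 3"
      using that finite_subset[OF that(1)] card_image_le[of D fst] by simp
    moreover have "fst ` D \<subseteq> edges G" using that(1) ids by blast
    ultimately have "connected_by G (edges G - fst ` D)" using G(3) by (simp add: edge_connected_def)
    moreover have "edges G - fst ` D = fst ` (set E - D)"
      unfolding ids[symmetric] using inj_on_image_set_diff[OF inj, of "set E" D] that(1) by auto
    ultimately have "connected_by G (fst ` (set E - D))" by simp
    then show "con (verts G) (set E - D)" "verts G \<noteq> {}"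
      using connected_by_iff_con[of "set E - D" G] ends by simp_all
  qed
  have ge: "cut_ge 3 (vset E) E" unfolding cut_ge_def V
  proof (intro allI impI, rule ccontr)
    fix S assume S: "verts G \<inter> S \<noteq> {}" "\<not> verts G \<subseteq> S" "\<not> 3 \<le> cut E S"
    let ?D = "set (filter (crosses S) E)"
    have "card ?D < 3" using S(3) card_length[of "filter (crosses S) E"] by (simp add: cut_def)
    then have "con (verts G) (set E - ?D)" by (intro conn) simp_all
    moreover have "\<forall>e\<in>set E - ?D. \<not> crosses S e" by simp
    ultimately show False using conD S(1,2) by blast
  qed
  show "cubic3 E" unfolding cubic3_def using dist loopfree deg V ge by simp
  \<comment> \<open>The graph without vertices does not count as connected, and every vertex has
    incident edges.\<close>
  have "verts G \<noteq> {}" using ne[of "{}"] by simp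
  then show "E \<noteq> []" using V by (auto simp: vset_def)
qed

lemma two_edge_connected_spanning_of_cuts:
  assumes E: "lists_graph G E" and V: "vset E = verts G" "E \<noteq> []"
    and F: "distinct F" "set F \<subseteq> set E" "cut_ge 2 (vset E) F"
  shows "two_edge_connected_spanning G (fst ` set F)"
proof -
  have ends: "ends G (fst e) = {src e, tgt e}" if "e \<in> set E" for e
    using E that by (simp add: lists_graph_def)
  have endsF: "ends G (fst e) = {src e, tgt e}" if "e \<in> set F" for e
    by (rule ends) (use F(2) that in blast)
  have ne: "verts G \<noteq> {}" using vsetI[OF hd_in_set[OF V(2)]] V(1) by auto
  \<comment> \<open>A cut with two edges of \<open>F\<close> keeps one of them, whichever
    \<open>e\<close> is taken away.\<close>
  have con: "con (verts G) (set F - {e})" for e unfolding con_def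
  proof (intro allI impI, rule ccontr)
    fix S assume nc: "\<forall>f\<in>set F - {e}. \<not> crosses S f" and S: "\<not> (undivided (verts G) S)"
    have "set (filter (crosses S) F) \<subseteq> {e}" using nc by auto
    then have "card (set (filter (crosses S) F)) \<le> card {e}" by (intro card_mono) simp_all
    then have "cut F S \<le> 1" using distinct_card[of "filter (crosses S) F"] F(1) by (simp add: cut_def)
    moreover have "2 \<le> cut F S" using F(3) S unfolding cut_ge_def V(1) by simp
    ultimately show False by simp
  qed
  have conn: "connected_by G (fst ` (set F - {e}))" for e
    by (rule iffD2[OF connected_by_iff_con]) (use endsF ne con[of e] in simp_all)
  have "con (verts G) (set F)" using con by (rule con_mono) blast
  then have "connected_by G (fst ` set F)"
    using ne by (intro iffD2[OF connected_by_iff_con]) (use endsF in simp_all)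
  moreover have "connected_by G (fst ` set F - {i})" if "i \<in> fst ` set F" for i
  proof -
    obtain e where e: "e \<in> set F" "i = fst e" using \<open>i \<in> fst ` set F\<close> by blast
    have "inj_on fst (set E)" using E by (simp add: lists_graph_def distinct_map)
    then have "inj_on fst (set F)" using F(2) by (rule inj_on_subset)
    then have "fst ` set F - {i} = fst ` (set F - {e})"
      using inj_on_image_set_diff[of fst "set F" "set F" "{e}"] e by auto
    then show ?thesis using conn by simp
  qed
  moreover have "fst ` set F \<subseteq> edges G" using E F(2) unfolding lists_graph_def by blast
  ultimately show ?thesis by (simp add: two_edge_connected_spanning_def)
qed

lemma convex_weights_uniform:
  fixes Fs :: "'e set list"
  assumes "length Fs = 9"
  shows "convex_weights (map (Pair (1 / 9)) Fs)"
proof -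
  have "(\<Sum>(w, F)\<leftarrow>map (Pair (1 / 9 :: real)) xs. w) = length xs / 9" for xs :: "'e set list"
    by (induction xs) (simp_all add: field_simps)
  from this[of Fs] have "(\<Sum>(w, F)\<leftarrow>map (Pair (1 / 9 :: real)) Fs. w) = 1" using assms by simp
  then show ?thesis unfolding convex_weights_def by auto
qed

text \<open>The set \<open>F\<close> contributes nothing at \<open>e\<close>, and the other eight at
  most 1/9 each.\<close>

lemma combination_uniform_le:
  assumes "length Fs = 9" "F \<in> set Fs" "e \<notin> F"
  shows "combination (map (Pair (1 / 9)) Fs) e \<le> 8 / 9"
proof -
  have le: "combination (map (Pair (1 / 9)) xs) e \<le> length xs / 9" for xs
    by (induction xs) (auto simp: combination_def indicator_def)
  obtain xs ys where Fs: "Fs = xs @ F # ys" using assms(2) by (meson split_list)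
  have "combination (map (Pair (1 / 9)) Fs) e =
      combination (map (Pair (1 / 9)) xs) e + combination (map (Pair (1 / 9)) ys) e"
    using assms(3) by (simp add: Fs combination_def)
  also have "\<dots> \<le> length xs / 9 + length ys / 9" by (intro add_mono le)
  also have "\<dots> = 8 / 9" using assms(1) by (simp add: Fs field_simps)
  finally show ?thesis .
qed

theorem subgraphs_combination:
  assumes G: "wf_graph G" "cubic G" "edge_connected 3 G" and E: "lists_graph G E"
  shows "dominated_2ec_combination G (\<lambda>e. 8 / 9) (map (\<lambda>F. (1 / 9, fst ` set F)) (subgraphs E))"
proof -
  note c3 = cubic3_of_graph[OF G E]
  note sub = subgraphs_correct[OF c3(1,3)]
  let ?Fs = "map (\<lambda>F. fst ` set F) (subgraphs E)"
  have eq: "map (\<lambda>F. (1 / 9, fst ` set F)) (subgraphs E) = map (Pair (1 / 9 :: real)) ?Fs" by simp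
  have "convex_weights (map (Pair (1 / 9)) ?Fs)" by (rule convex_weights_uniform) (simp add: sub(1))
  moreover have "two_edge_connected_spanning G (fst ` set F)" if "F \<in> set (subgraphs E)" for F
    by (rule two_edge_connected_spanning_of_cuts[OF E c3(2,3)]) (use sub(2)[OF that] in simp_all)
  moreover have "dominates_on (edges G) (\<lambda>e. 8 / 9) (combination (map (Pair (1 / 9)) ?Fs))"
    unfolding dominates_on_def
  proof
    fix i assume "i \<in> edges G"
    then obtain e where e: "e \<in> set E" "i = fst e" using E unfolding lists_graph_def by blast
    obtain F where F: "F \<in> set (subgraphs E)" "e \<notin> set F" using sub(3)[OF e(1)] by blast
    have "inj_on fst (set E)" using E by (simp add: lists_graph_def distinct_map)
    then have "i \<notin> fst ` set F" using sub(2)[OF F(1)] F(2) e by (auto simp: inj_on_def)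
    then show "combination (map (Pair (1 / 9)) ?Fs) i \<le> 8 / 9"
      by (intro combination_uniform_le[of _ "fst ` set F"]) (use sub(1) F(1) in auto)
  qed
  ultimately show ?thesis unfolding dominated_2ec_combination_def eq by auto
qed

lemma exists_lists_graph:
  fixes G :: "('v, 'e) graph"
  assumes "wf_graph G"
  shows "\<exists>E. lists_graph G E"
proof -
  obtain xs where xs: "set xs = edges G" "distinct xs"
    using assms finite_distinct_list[of "edges G"] by (auto simp: wf_graph_def)
  have "\<exists>p. ends G i = {fst p, snd p}" if "i \<in> edges G" for i
  proof -
    have "card (ends G i) = 2" using assms that by (simp add: wf_graph_def)
    then obtain x y where "ends G i = {x, y}" by (auto simp: card_2_iff)
    then show ?thesis by (intro exI[of _ "(x, y)"]) simp
  qed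
  then obtain p where p: "\<forall>i\<in>edges G. ends G i = {fst (p i), snd (p i)}"
    using bchoice[of "edges G" "\<lambda>i p. ends G i = {fst p, snd p}"] by blast
  have "lists_graph G (map (\<lambda>i. (i, p i)) xs)"
    using xs p by (simp add: lists_graph_def comp_def image_image)
  then show ?thesis ..
qed

lemma lists_graph_of: "lists_graph (graph_of n es) (zip [0..<length es] es)"
proof -
  have "zip [0..<length es] es = map (\<lambda>i. (i, es ! i)) [0..<length es]"
    by (rule nth_equalityI) simp_all
  then show ?thesis by (simp add: lists_graph_def graph_of_def comp_def image_image lessThan_atLeast0)
qed

section \<open>Polynomial-time functions\<close>

text \<open>The coefficients are natural numbers, so polynomial bounds are monotone without side
  conditions and can be nested.\<close>

lemma poly_mono_nat: "x \<le> y \<Longrightarrow> poly p x \<le> poly p (y :: nat)"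
  by (induction p) (auto intro!: add_mono mult_mono)

text \<open>The type of a value fixes its encoding, so rules about running time can be chained by
  type inference. Injectivity makes equality decidable by comparing trees.\<close>

class enc =
  fixes enc :: "'a \<Rightarrow> tree"
  assumes inj_enc: "inj enc"

lemma enc_eq_iff [simp]: "enc x = enc y \<longleftrightarrow> x = y"
  using inj_enc by (auto simp: inj_def)

instantiation tree :: enc
begin
definition enc_tree :: "tree \<Rightarrow> tree" where [simp]: "enc_tree t = t"
instance by standard (simp add: inj_def)
end

instantiation bool :: enc
begin
definition enc_bool :: "bool \<Rightarrow> tree" where "enc_bool = enc_bit"
instance by standard (simp add: inj_def enc_bool_def enc_bit_def)
end

instantiation nat :: enc
begin
definition enc_nat_inst: "enc = enc_nat"
instance by standard (simp add: enc_nat_inst inj_enc_nat)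
end

instantiation prod :: (enc, enc) enc
begin
definition enc_prod :: "'a \<times> 'b \<Rightarrow> tree" where "enc_prod = enc_pair enc enc"
instance by standard (simp add: enc_prod_def inj_enc_pair inj_enc)
end

instantiation list :: (enc) enc
begin
definition enc_list_inst: "enc = enc_list enc"
instance by standard (simp add: enc_list_inst inj_enc_list inj_enc)
end

abbreviation sz :: "'a::enc \<Rightarrow> nat" where "sz x \<equiv> size (enc x)"

lemma enc_Pair: "enc (a, b) = Node (enc a) (enc b)" by (simp add: enc_prod_def enc_pair_def)
lemma enc_Nil: "enc [] = Leaf" by (simp add: enc_list_inst enc_list_def)
lemma enc_Cons: "enc (x # xs) = Node (enc x) (enc xs)" by (simp add: enc_list_inst enc_list_def)
lemma enc_True: "enc True = Node Leaf Leaf" by (simp add: enc_bool_def enc_bit_def)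
lemma enc_False: "enc False = Leaf" by (simp add: enc_bool_def enc_bit_def)
lemmas enc_simps = enc_Pair enc_Nil enc_Cons enc_True enc_False

lemma sz_Pair: "sz (a, b) = sz a + sz b + 1" by (simp add: enc_simps)
lemma sz_Nil: "sz [] = 0" by (simp add: enc_simps)
lemma sz_Cons: "sz (x # xs) = sz x + sz xs + 1" by (simp add: enc_simps)
lemma sz_fst: "sz (fst p) \<le> sz p" and sz_snd: "sz (snd p) \<le> sz p"
  by (cases p; simp add: sz_Pair)+
lemma sz_bool: "sz (b :: bool) \<le> 1" by (cases b) (simp_all add: enc_simps)
lemmas sz_simps = sz_Pair sz_Nil sz_Cons

lemma sz_append: "sz (xs @ ys) = sz xs + sz ys"
  by (induction xs) (simp_all add: sz_simps)

lemma sz_member: "x \<in> set xs \<Longrightarrow> sz x \<le> sz xs"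
  by (induction xs) (auto simp: sz_simps)

lemma length_le_sz: "length xs \<le> sz xs"
  by (induction xs) (simp_all add: sz_simps)

lemma sz_list_le: "\<forall>x\<in>set xs. sz x \<le> k \<Longrightarrow> sz xs \<le> length xs * (k + 1)"
  by (induction xs) (auto simp: sz_simps)

lemma sz_filter: "sz (filter P xs) \<le> sz xs"
  by (induction xs) (auto simp: sz_simps)

definition pbound :: "('a::enc \<Rightarrow> nat) \<Rightarrow> bool" where
  "pbound g \<longleftrightarrow> (\<exists>p. \<forall>x. g x \<le> poly p (sz x))"

lemma pbound_mono: "pbound g \<Longrightarrow> (\<And>x. f x \<le> g x) \<Longrightarrow> pbound f"
  unfolding pbound_def by (meson le_trans)

lemma pbound_const: "pbound (\<lambda>x. k)"
  unfolding pbound_def by (intro exI[of _ "[:k:]"]) simp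

lemma pbound_sz: "pbound (\<lambda>x. sz x)"
  unfolding pbound_def by (intro exI[of _ "[:0, 1:]"]) simp

lemma pbound_add: assumes "pbound f" "pbound g" shows "pbound (\<lambda>x. f x + g x)"
proof -
  obtain p q where "\<forall>x. f x \<le> poly p (sz x)" "\<forall>x. g x \<le> poly q (sz x)" using assms unfolding pbound_def by blast
  then show ?thesis unfolding pbound_def by (intro exI[of _ "p + q"]) (auto intro: add_mono)
qed

lemma pbound_mult: assumes "pbound f" "pbound g" shows "pbound (\<lambda>x. f x * g x)"
proof -
  obtain p q where "\<forall>x. f x \<le> poly p (sz x)" "\<forall>x. g x \<le> poly q (sz x)" using assms unfolding pbound_def by blast
  then show ?thesis unfolding pbound_def by (intro exI[of _ "p * q"]) (auto intro: mult_mono)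
qed

lemma pbound_Suc: "pbound f \<Longrightarrow> pbound (\<lambda>x. Suc (f x))"
  using pbound_add[OF _ pbound_const[of 1]] by simp

lemma pbound_poly: assumes "pbound f" shows "pbound (\<lambda>x. poly p (f x))"
proof -
  obtain q where "\<forall>x. f x \<le> poly q (sz x)" using assms unfolding pbound_def by blast
  then show ?thesis unfolding pbound_def
    by (intro exI[of _ "pcompose p q"]) (auto simp: poly_pcompose intro: poly_mono_nat)
qed

lemmas pbound_intros = pbound_const pbound_sz pbound_add pbound_mult pbound_Suc pbound_poly

lemma pbound_comp:
  assumes "pbound T" "pbound (\<lambda>x. sz (g x))" shows "pbound (\<lambda>x. T (g x))"
proof -
  obtain p where p: "\<forall>x. T x \<le> poly p (sz x)" using assms(1) unfolding pbound_def by blast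
  have "pbound (\<lambda>x. poly p (sz (g x)))" by (rule pbound_poly) fact
  then show ?thesis by (rule pbound_mono) (use p in simp)
qed

section \<open>Relocatable code and its combination\<close>

definition loaded :: "program \<Rightarrow> nat \<Rightarrow> expr list \<Rightarrow> bool" where
  "loaded P k c \<longleftrightarrow> (\<forall>i<length c. k + i < length P \<and> P ! (k + i) = c ! i)"

lemma loaded_append: "loaded P k (c @ d) \<longleftrightarrow> loaded P k c \<and> loaded P (k + length c) d"
proof
  assume l: "loaded P k (c @ d)"
  show "loaded P k c \<and> loaded P (k + length c) d" unfolding loaded_def
  proof (intro conjI allI impI)
    fix i assume "i < length c"
    then show "k + i < length P" "P ! (k + i) = c ! i"
      using l[unfolded loaded_def, rule_format, of i] by (simp_all add: nth_append)
  next
    fix i assume "i < length d"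
    then show "k + length c + i < length P" "P ! (k + length c + i) = d ! i"
      using l[unfolded loaded_def, rule_format, of "length c + i"] by (simp_all add: nth_append add.assoc)
  qed
next
  assume l: "loaded P k c \<and> loaded P (k + length c) d"
  show "loaded P k (c @ d)" unfolding loaded_def
  proof (intro allI impI)
    fix i assume i: "i < length (c @ d)"
    show "k + i < length P \<and> P ! (k + i) = (c @ d) ! i"
    proof (cases "i < length c")
      case True
      then show ?thesis using l by (simp add: loaded_def nth_append)
    next
      case False
      then show ?thesis using l[THEN conjunct2, unfolded loaded_def, rule_format, of "i - length c"] i
        by (simp add: nth_append)
    qed
  qed
qed

lemma loaded_Cons: "loaded P k (e # c) \<longleftrightarrow> k < length P \<and> P ! k = e \<and> loaded P (Suc k) c"
  using loaded_append[of P k "[e]" c] by (simp add: loaded_def)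

definition calls :: "program \<Rightarrow> nat \<Rightarrow> ('a::enc \<Rightarrow> 'b::enc) \<Rightarrow> ('a \<Rightarrow> nat) \<Rightarrow> bool" where
  "calls P k f T \<longleftrightarrow> k < length P \<and> (\<forall>x. \<exists>t\<le>T x. eval P [enc x] (P ! k) (enc (f x)) t)"

text \<open>The code \<open>c k\<close> of a function may be placed at any position \<open>k\<close> of a program, so that pieces of
  code can be put together.  The size of the result needs its own bound because evaluation steps may
  share subtrees.\<close>

definition ptime :: "('a::enc \<Rightarrow> 'b::enc) \<Rightarrow> bool" where
  "ptime f \<longleftrightarrow> pbound (\<lambda>x. sz (f x)) \<and> (\<exists>m c T. pbound T \<and> (\<forall>k. length (c k) = m) \<and>
     (\<forall>P k. loaded P k (c k) \<longrightarrow> calls P k f T))"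

lemma ptime_sz: "ptime f \<Longrightarrow> pbound (\<lambda>x. sz (f x))"
  by (simp add: ptime_def)

abbreviation uncurry2 :: "('a \<Rightarrow> 'b \<Rightarrow> 'c) \<Rightarrow> 'a \<times> 'b \<Rightarrow> 'c" where
  "uncurry2 f \<equiv> \<lambda>z. f (fst z) (snd z)"

abbreviation uncurry3 :: "('a \<Rightarrow> 'b \<Rightarrow> 'c \<Rightarrow> 'd) \<Rightarrow> 'a \<times> 'b \<times> 'c \<Rightarrow> 'd" where
  "uncurry3 f \<equiv> \<lambda>z. f (fst z) (fst (snd z)) (snd (snd z))"

text \<open>This is the linker: the new bodies come first, followed by the code of up to three
  components. The length of a piece of code does not depend on its position, so the addresses are
  known beforehand. Fewer components are handled by repeating one.\<close>

lemma ptime_build: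
  fixes f :: "'a1::enc \<Rightarrow> 'b1::enc" and g :: "'a2::enc \<Rightarrow> 'b2::enc" and h :: "'a3::enc \<Rightarrow> 'b3::enc"
    and r :: "'a::enc \<Rightarrow> 'b::enc"
  assumes fgh: "ptime f" "ptime g" "ptime h" and sz: "pbound (\<lambda>x. sz (r x))"
    and len: "\<And>k kf kg kh. length (body k kf kg kh) = n"
    and run: "\<And>Tf Tg Th. pbound Tf \<Longrightarrow> pbound Tg \<Longrightarrow> pbound Th \<Longrightarrow>
      \<exists>T. pbound T \<and> (\<forall>P k kf kg kh. calls P kf f Tf \<longrightarrow> calls P kg g Tg \<longrightarrow> calls P kh h Th \<longrightarrow>
        loaded P k (body k kf kg kh) \<longrightarrow> calls P k r T)"
  shows "ptime r"
proof -
  obtain mf cf Tf where f: "pbound Tf" "\<And>k. length (cf k) = mf" "\<And>P k. loaded P k (cf k) \<Longrightarrow> calls P k f Tf"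
    using fgh(1) unfolding ptime_def by blast
  obtain mg cg Tg where g: "pbound Tg" "\<And>k. length (cg k) = mg" "\<And>P k. loaded P k (cg k) \<Longrightarrow> calls P k g Tg"
    using fgh(2) unfolding ptime_def by blast
  obtain mh ch Th where h: "pbound Th" "\<And>k. length (ch k) = mh" "\<And>P k. loaded P k (ch k) \<Longrightarrow> calls P k h Th"
    using fgh(3) unfolding ptime_def by blast
  obtain T where T: "pbound T" "\<forall>P k kf kg kh. calls P kf f Tf \<longrightarrow> calls P kg g Tg \<longrightarrow> calls P kh h Th \<longrightarrow>
        loaded P k (body k kf kg kh) \<longrightarrow> calls P k r T"
    using run[OF f(1) g(1) h(1)] by blast
  let ?c = "\<lambda>k. body k (k + n) (k + n + mf) (k + n + mf + mg) @ cf (k + n) @ cg (k + n + mf) @ ch (k + n + mf + mg)"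
  have "calls P k r T" if "loaded P k (?c k)" for P k
    using that T(2) f(3) g(3) h(3) unfolding loaded_append len f(2) g(2) by blast
  moreover have "length (?c k) = n + mf + mg + mh" for k by (simp add: len f(2) g(2) h(2))
  ultimately show ?thesis unfolding ptime_def using sz T(1) by (intro conjI exI[of _ "n + mf + mg + mh"] exI[of _ ?c] exI[of _ T]) simp_all
qed

lemma eval_call1:
  "eval P env a x s \<Longrightarrow> eval P [x] (P ! k) y t \<Longrightarrow> k < length P \<Longrightarrow> eval P env (ECall k [a]) y (s + t + 1)"
  using Call[of k P env "[a]" "[x]" "s + 0" y t] Args_Cons[of P env a x s "[]" "[]" 0] Args_Nil by simp

lemma eval_call2:
  "eval P env a x s \<Longrightarrow> eval P env b x' s' \<Longrightarrow> eval P [x, x'] (P ! k) y t \<Longrightarrow> k < length P \<Longrightarrow>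
    eval P env (ECall k [a, b]) y (s + s' + t + 1)"
  using Call[of k P env "[a, b]" "[x, x']" "s + (s' + 0)" y t] Args_Cons[of P env a x s "[b]" "[x']" "s' + 0"]
    Args_Cons[of P env b x' s' "[]" "[]" 0] Args_Nil by simp

lemma eval_var0: "eval P (x # env) (EVar 0) x 1"
  using Var[of 0 "x # env" P] by simp

lemma eval_var1: "eval P (x # y # env) (EVar 1) y 1"
  using Var[of 1 "x # y # env" P] by simp

lemma eval_callv: "eval P [x] (P ! k) y t \<Longrightarrow> k < length P \<Longrightarrow> eval P (x # env) (ECall k [EVar 0]) y (1 + t + 1)"
  by (rule eval_call1[OF eval_var0])

lemma callsE: "calls P k f T \<Longrightarrow> \<exists>t\<le>T x. eval P [enc x] (P ! k) (enc (f x)) t \<and> k < length P"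
  by (simp add: calls_def)

fun quoted :: "tree \<Rightarrow> expr" where
  "quoted Leaf = ELeaf"
| "quoted (Node a b) = ENode (quoted a) (quoted b)"

lemma eval_quoted: "eval P env (quoted x) x (Suc (2 * size x))"
proof (induction x)
  case Leaf
  show ?case using eval_evals.Leaf by simp
next
  case (Node a b)
  have "Suc (2 * size a) + Suc (2 * size b) + 1 = Suc (2 * size (tree.Node a b))" by simp
  then show ?case using eval_evals.Node[OF Node.IH] by (metis quoted.simps(2))
qed

lemma ptime_const: "ptime (\<lambda>x::'a::enc. c :: 'b::enc)"
  unfolding ptime_def
proof (intro conjI exI allI impI)
  show "pbound (\<lambda>x::'a. Suc (2 * size (enc c)))" "pbound (\<lambda>x::'a. sz c)" by (rule pbound_const)+
  show "length [quoted (enc c)] = 1" by simp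
  fix P k assume "loaded P k [quoted (enc c)]"
  then show "calls P k (\<lambda>x::'a. c) (\<lambda>x. Suc (2 * size (enc c)))"
    unfolding calls_def loaded_Cons using eval_quoted by auto
qed

lemma ptime_id: "ptime (\<lambda>x::'a::enc. x)"
  unfolding ptime_def
proof (intro conjI exI allI impI)
  show "pbound (\<lambda>x::'a. 1)" "pbound (\<lambda>x::'a. sz x)" by (rule pbound_intros)+
  show "length [EVar 0] = 1" by simp
  fix P k assume "loaded P k [EVar 0]"
  then show "calls P k (\<lambda>x::'a. x) (\<lambda>x. 1)"
    unfolding calls_def loaded_Cons using eval_var0 by auto
qed

text \<open>Programs see only encodings, so a function may change its result type as long as the
  trees agree.\<close>

lemma ptime_enc_cong:
  fixes f :: "'a::enc \<Rightarrow> 'b::enc" and g :: "'a \<Rightarrow> 'c::enc"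
  assumes "ptime f" "\<And>x. enc (g x) = enc (f x)" shows "ptime g"
  using assms by (simp add: ptime_def calls_def)

lemma ptime_comp:
  fixes f :: "'b::enc \<Rightarrow> 'c::enc" and g :: "'a::enc \<Rightarrow> 'b"
  assumes f: "ptime f" and g: "ptime g" shows "ptime (\<lambda>x. f (g x))"
proof (rule ptime_build[OF f g f])
  show "pbound (\<lambda>x. sz (f (g x)))" by (rule pbound_comp[OF ptime_sz[OF f] ptime_sz[OF g]])
  show "length [ECall kf [ECall kg [EVar 0]]] = 1" for kf kg by simp
  fix Tf Th :: "'b \<Rightarrow> nat" and Tg :: "'a \<Rightarrow> nat" assume T: "pbound Tf" "pbound Tg"
  show "\<exists>T. pbound T \<and> (\<forall>P k kf kg kh. calls P kf f Tf \<longrightarrow> calls P kg g Tg \<longrightarrow> calls P kh f Th \<longrightarrow>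
      loaded P k [ECall kf [ECall kg [EVar 0]]] \<longrightarrow> calls P k (\<lambda>x. f (g x)) T)"
  proof (intro exI[of _ "\<lambda>x. 1 + Tg x + 1 + Tf (g x) + 1"] conjI allI impI)
    show "pbound (\<lambda>x. 1 + Tg x + 1 + Tf (g x) + 1)"
      by (intro pbound_intros T pbound_comp[OF T(1)] ptime_sz g)
    fix P k kf kg assume c: "calls P kf f Tf" "calls P kg g Tg" and l: "loaded P k [ECall kf [ECall kg [EVar 0]]]"
    have "\<exists>t\<le>1 + Tg x + 1 + Tf (g x) + 1. eval P [enc x] (ECall kf [ECall kg [EVar 0]]) (enc (f (g x))) t" for x
    proof -
      obtain t1 where t1: "t1 \<le> Tg x" "eval P [enc x] (P ! kg) (enc (g x)) t1" "kg < length P" using callsE[OF c(2)] by blast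
      obtain t2 where t2: "t2 \<le> Tf (g x)" "eval P [enc (g x)] (P ! kf) (enc (f (g x))) t2" "kf < length P" using callsE[OF c(1)] by blast
      have "eval P [enc x] (ECall kf [ECall kg [EVar 0]]) (enc (f (g x))) (1 + t1 + 1 + t2 + 1)"
        by (rule eval_call1[OF eval_callv[OF t1(2,3)] t2(2,3)])
      then show ?thesis using t1(1) t2(1) by (intro exI[of _ "1 + t1 + 1 + t2 + 1"]) simp
    qed
    then show "calls P k (\<lambda>x. f (g x)) (\<lambda>x. 1 + Tg x + 1 + Tf (g x) + 1)"
      using l by (simp add: calls_def loaded_Cons)
  qed
qed

lemma ptime_node:
  fixes f :: "'a::enc \<Rightarrow> 'b::enc" and g :: "'a \<Rightarrow> 'c::enc" and r :: "'a \<Rightarrow> 'd::enc"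
  assumes f: "ptime f" and g: "ptime g" and r: "\<And>x. enc (r x) = Node (enc (f x)) (enc (g x))"
  shows "ptime r"
proof (rule ptime_build[OF f g f])
  have "pbound (\<lambda>x. sz (f x) + sz (g x) + 1)" by (intro pbound_intros ptime_sz f g)
  then show "pbound (\<lambda>x. sz (r x))" by (simp add: r)
  show "length [ENode (ECall kf [EVar 0]) (ECall kg [EVar 0])] = 1" for kf kg by simp
  fix Tf Tg Th :: "'a \<Rightarrow> nat" assume T: "pbound Tf" "pbound Tg"
  show "\<exists>T. pbound T \<and> (\<forall>P k kf kg kh. calls P kf f Tf \<longrightarrow> calls P kg g Tg \<longrightarrow> calls P kh f Th \<longrightarrow>
      loaded P k [ENode (ECall kf [EVar 0]) (ECall kg [EVar 0])] \<longrightarrow> calls P k r T)"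
  proof (intro exI[of _ "\<lambda>x. (1 + Tf x + 1) + (1 + Tg x + 1) + 1"] conjI allI impI)
    show "pbound (\<lambda>x. (1 + Tf x + 1) + (1 + Tg x + 1) + 1)" by (intro pbound_intros T)
    fix P k kf kg assume c: "calls P kf f Tf" "calls P kg g Tg" and l: "loaded P k [ENode (ECall kf [EVar 0]) (ECall kg [EVar 0])]"
    have "\<exists>t\<le>(1 + Tf x + 1) + (1 + Tg x + 1) + 1. eval P [enc x] (ENode (ECall kf [EVar 0]) (ECall kg [EVar 0])) (enc (r x)) t" for x
    proof -
      obtain t1 where t1: "t1 \<le> Tf x" "eval P [enc x] (P ! kf) (enc (f x)) t1" "kf < length P" using callsE[OF c(1)] by blast
      obtain t2 where t2: "t2 \<le> Tg x" "eval P [enc x] (P ! kg) (enc (g x)) t2" "kg < length P" using callsE[OF c(2)] by blast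
      have "eval P [enc x] (ENode (ECall kf [EVar 0]) (ECall kg [EVar 0])) (enc (r x)) ((1 + t1 + 1) + (1 + t2 + 1) + 1)"
        unfolding r by (rule eval_evals.Node[OF eval_callv[OF t1(2,3)] eval_callv[OF t2(2,3)]])
      then show ?thesis using t1(1) t2(1) by (intro exI[of _ "(1 + t1 + 1) + (1 + t2 + 1) + 1"]) simp
    qed
    then show "calls P k r (\<lambda>x. (1 + Tf x + 1) + (1 + Tg x + 1) + 1)"
      using l by (simp add: calls_def loaded_Cons)
  qed
qed

lemma ptime_Pair: "ptime f \<Longrightarrow> ptime g \<Longrightarrow> ptime (\<lambda>x. (f x, g x))"
  by (erule ptime_node) (simp_all add: enc_simps)

lemma ptime_Cons: "ptime f \<Longrightarrow> ptime g \<Longrightarrow> ptime (\<lambda>x. f x # g x)"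
  by (erule ptime_node) (simp_all add: enc_simps)

lemma ptime_fst0: "ptime (fst :: 'a::enc \<times> 'b::enc \<Rightarrow> 'a)"
  unfolding ptime_def
proof (intro conjI exI allI impI)
  show "pbound (\<lambda>x::'a \<times> 'b. sz (fst x))" by (rule pbound_mono[OF pbound_sz]) (rule sz_fst)
  show "pbound (\<lambda>x::'a \<times> 'b. 2)" by (rule pbound_const)
  show "length [ELeft (EVar 0)] = 1" by simp
  fix P k assume "loaded P k [ELeft (EVar 0)]"
  moreover have "eval P [enc x] (ELeft (EVar 0)) (enc (fst x)) (1 + 1)" for x :: "'a \<times> 'b"
    using Left[OF eval_var0, of P "enc (fst x)" "enc (snd x)" "[]"] by (cases x) (simp add: enc_simps)
  ultimately show "calls P k (fst :: 'a \<times> 'b \<Rightarrow> 'a) (\<lambda>x. 2)"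
    unfolding calls_def loaded_Cons by (auto simp: numeral_2_eq_2)
qed

lemma ptime_snd0: "ptime (snd :: 'a::enc \<times> 'b::enc \<Rightarrow> 'b)"
  unfolding ptime_def
proof (intro conjI exI allI impI)
  show "pbound (\<lambda>x::'a \<times> 'b. sz (snd x))" by (rule pbound_mono[OF pbound_sz]) (rule sz_snd)
  show "pbound (\<lambda>x::'a \<times> 'b. 2)" by (rule pbound_const)
  show "length [ERight (EVar 0)] = 1" by simp
  fix P k assume "loaded P k [ERight (EVar 0)]"
  moreover have "eval P [enc x] (ERight (EVar 0)) (enc (snd x)) (1 + 1)" for x :: "'a \<times> 'b"
    using Right[OF eval_var0, of P "enc (fst x)" "enc (snd x)" "[]"] by (cases x) (simp add: enc_simps)
  ultimately show "calls P k (snd :: 'a \<times> 'b \<Rightarrow> 'b) (\<lambda>x. 2)"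
    unfolding calls_def loaded_Cons by (auto simp: numeral_2_eq_2)
qed

lemma ptime_fst: "ptime f \<Longrightarrow> ptime (\<lambda>x. fst (f x))" by (rule ptime_comp[OF ptime_fst0])
lemma ptime_snd: "ptime f \<Longrightarrow> ptime (\<lambda>x. snd (f x))" by (rule ptime_comp[OF ptime_snd0])

lemma ptime_branch:
  fixes b :: "'a::enc \<Rightarrow> 'b::enc" and f g :: "'a \<Rightarrow> 'c::enc"
  assumes b: "ptime b" and f: "ptime f" and g: "ptime g"
  shows "ptime (\<lambda>x. if enc (b x) = Leaf then g x else f x)" (is "ptime ?r")
proof (rule ptime_build[OF b f g])
  have "pbound (\<lambda>x. sz (f x) + sz (g x))" by (intro pbound_intros ptime_sz f g)
  then show "pbound (\<lambda>x. sz (?r x))" by (rule pbound_mono) simp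
  let ?e = "\<lambda>kb kf kg. EIf (ECall kb [EVar 0]) (ECall kf [EVar 0]) (ECall kg [EVar 0])"
  show "length [?e kb kf kg] = 1" for kb kf kg by simp
  fix Tb Tf Tg :: "'a \<Rightarrow> nat" assume T: "pbound Tb" "pbound Tf" "pbound Tg"
  let ?T = "\<lambda>x. (1 + Tb x + 1) + (1 + Tf x + Tg x + 1) + 1"
  show "\<exists>T. pbound T \<and> (\<forall>P k kb kf kg. calls P kb b Tb \<longrightarrow> calls P kf f Tf \<longrightarrow> calls P kg g Tg \<longrightarrow>
      loaded P k [?e kb kf kg] \<longrightarrow> calls P k ?r T)"
  proof (intro exI[of _ ?T] conjI allI impI)
    show "pbound ?T" by (intro pbound_intros T)
    fix P k kb kf kg assume c: "calls P kb b Tb" "calls P kf f Tf" "calls P kg g Tg" and l: "loaded P k [?e kb kf kg]"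
    have "\<exists>t\<le>?T x. eval P [enc x] (?e kb kf kg) (enc (?r x)) t" for x
    proof -
      obtain t0 where t0: "t0 \<le> Tb x" "eval P [enc x] (P ! kb) (enc (b x)) t0" "kb < length P" using callsE[OF c(1)] by blast
      obtain t1 where t1: "t1 \<le> Tf x" "eval P [enc x] (P ! kf) (enc (f x)) t1" "kf < length P" using callsE[OF c(2)] by blast
      obtain t2 where t2: "t2 \<le> Tg x" "eval P [enc x] (P ! kg) (enc (g x)) t2" "kg < length P" using callsE[OF c(3)] by blast
      have e0: "eval P [enc x] (ECall kb [EVar 0]) (enc (b x)) (1 + t0 + 1)" by (rule eval_callv[OF t0(2,3)])
      show ?thesis
      proof (cases "enc (b x)")
        case Leaf
        have "eval P [enc x] (?e kb kf kg) (enc (g x)) ((1 + t0 + 1) + (1 + t2 + 1) + 1)"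
          by (rule If_Leaf) (use e0 Leaf in simp, rule eval_callv[OF t2(2,3)])
        then show ?thesis using Leaf t0(1) t2(1) by (intro exI[of _ "(1 + t0 + 1) + (1 + t2 + 1) + 1"]) simp
      next
        case (Node y z)
        have "eval P [enc x] (?e kb kf kg) (enc (f x)) ((1 + t0 + 1) + (1 + t1 + 1) + 1)"
          by (rule If_Node[of _ _ _ y z]) (use e0 Node in simp, rule eval_callv[OF t1(2,3)])
        then show ?thesis using Node t0(1) t1(1) by (intro exI[of _ "(1 + t0 + 1) + (1 + t1 + 1) + 1"]) simp
      qed
    qed
    then show "calls P k ?r ?T" using l by (simp add: calls_def loaded_Cons)
  qed
qed

lemma ptime_if: "ptime b \<Longrightarrow> ptime f \<Longrightarrow> ptime g \<Longrightarrow> ptime (\<lambda>x. if b x then f x else g x)"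
proof -
  assume "ptime b" "ptime f" "ptime g"
  then have "ptime (\<lambda>x. if enc (b x) = Leaf then g x else f x)" by (rule ptime_branch)
  moreover have "(\<lambda>x. if enc (b x) = Leaf then g x else f x) = (\<lambda>x. if b x then f x else g x)"
    by (rule ext) (simp add: enc_bool_def enc_bit_def)
  ultimately show ?thesis by simp
qed

lemma pbound_triple:
  fixes T :: "'a::enc \<times> 'b::enc \<times> 'c::enc \<Rightarrow> nat"
  assumes "pbound T"
  obtains p where "\<And>x y z n. sz x + sz y + sz z + 2 \<le> n \<Longrightarrow> T (x, y, z) \<le> poly p n"
proof -
  obtain p where p: "\<forall>v. T v \<le> poly p (sz v)" using assms unfolding pbound_def by blast
  have "T (x, y, z) \<le> poly p n" if "sz x + sz y + sz z + 2 \<le> n" for x y z n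
    using le_trans[OF p[rule_format, of "(x, y, z)"] poly_mono_nat] that by (simp add: sz_Pair)
  then show ?thesis by (rule that)
qed

text \<open>A nonempty list and the pair of its head and tail have the same encoding, so a node of
  the argument and the list is already the encoded triple. The list is evaluated twice, once for the
  test and once for the branch.\<close>

lemma ptime_case_list:
  fixes l :: "'a::enc \<Rightarrow> 'b::enc list" and f :: "'a \<Rightarrow> 'c::enc" and g :: "'a \<Rightarrow> 'b \<Rightarrow> 'b list \<Rightarrow> 'c"
  assumes l: "ptime l" and f: "ptime f" and g: "ptime (uncurry3 g)"
  shows "ptime (\<lambda>x. case l x of [] \<Rightarrow> f x | y # ys \<Rightarrow> g x y ys)" (is "ptime ?r")
proof (rule ptime_build[OF l f g])
  obtain q where q: "\<And>x y z n. sz x + sz y + sz z + 2 \<le> n \<Longrightarrow> sz (g x y z) \<le> poly q n"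
    using pbound_triple[OF ptime_sz[OF g]] by auto
  have "pbound (\<lambda>x. sz (f x) + poly q (sz x + sz (l x) + 2))" by (intro pbound_intros ptime_sz f l)
  then show "pbound (\<lambda>x. sz (?r x))"
    by (rule pbound_mono) (auto split: list.split intro!: q trans_le_add2 simp: sz_Cons)
  let ?e = "\<lambda>kl kf kg. EIf (ECall kl [EVar 0]) (ECall kg [ENode (EVar 0) (ECall kl [EVar 0])]) (ECall kf [EVar 0])"
  show "length [?e kl kf kg] = 1" for kl kf kg by simp
  fix Tl Tf :: "'a \<Rightarrow> nat" and Tg :: "'a \<times> 'b \<times> 'b list \<Rightarrow> nat" assume T: "pbound Tl" "pbound Tf" "pbound Tg"
  obtain p where p: "\<And>x y z n. sz x + sz y + sz z + 2 \<le> n \<Longrightarrow> Tg (x, y, z) \<le> poly p n"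
    using pbound_triple[OF T(3)] by auto
  let ?T = "\<lambda>x. Tl x + Tl x + Tf x + poly p (sz x + sz (l x) + 2) + 20"
  show "\<exists>T. pbound T \<and> (\<forall>P k kl kf kg. calls P kl l Tl \<longrightarrow> calls P kf f Tf \<longrightarrow>
      calls P kg (uncurry3 g) Tg \<longrightarrow> loaded P k [?e kl kf kg] \<longrightarrow> calls P k ?r T)"
  proof (intro exI[of _ ?T] conjI allI impI)
    show "pbound ?T" by (intro pbound_intros T ptime_sz l)
    fix P k kl kf kg assume c: "calls P kl l Tl" "calls P kf f Tf" "calls P kg (uncurry3 g) Tg"
      and ld: "loaded P k [?e kl kf kg]"
    have "\<exists>t\<le>?T x. eval P [enc x] (?e kl kf kg) (enc (?r x)) t" for x
    proof -
      obtain t0 where t0: "t0 \<le> Tl x" "eval P [enc x] (P ! kl) (enc (l x)) t0" "kl < length P" using callsE[OF c(1)] by blast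
      have e0: "eval P [enc x] (ECall kl [EVar 0]) (enc (l x)) (1 + t0 + 1)" by (rule eval_callv[OF t0(2,3)])
      show ?thesis
      proof (cases "l x")
        case Nil
        obtain t2 where t2: "t2 \<le> Tf x" "eval P [enc x] (P ! kf) (enc (f x)) t2" "kf < length P" using callsE[OF c(2)] by blast
        have "eval P [enc x] (?e kl kf kg) (enc (f x)) ((1 + t0 + 1) + (1 + t2 + 1) + 1)"
          by (rule If_Leaf) (use e0 Nil in \<open>simp add: enc_simps\<close>, rule eval_callv[OF t2(2,3)])
        then show ?thesis using Nil t0(1) t2(1) by (intro exI[of _ "(1 + t0 + 1) + (1 + t2 + 1) + 1"]) simp
      next
        case (Cons y ys)
        obtain t1 where t1: "t1 \<le> Tg (x, y, ys)" "eval P [enc (x, y, ys)] (P ! kg) (enc (g x y ys)) t1" "kg < length P"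
          using callsE[OF c(3), of "(x, y, ys)"] by auto
        have "Tg (x, y, ys) \<le> poly p (sz x + sz (l x) + 2)" by (rule p) (simp add: Cons sz_Cons)
        then have t1': "t1 \<le> poly p (sz x + sz (l x) + 2)" using t1(1) by simp
        have "eval P [enc x] (ENode (EVar 0) (ECall kl [EVar 0])) (enc (x, y, ys)) (1 + (1 + t0 + 1) + 1)"
          using eval_evals.Node[OF eval_var0 e0] Cons by (simp add: enc_simps)
        from eval_call1[OF this t1(2,3)]
        have "eval P [enc x] (?e kl kf kg) (enc (g x y ys)) ((1 + t0 + 1) + (1 + (1 + t0 + 1) + 1 + t1 + 1) + 1)"
          by (intro If_Node[of _ _ _ "enc y" "enc ys"]) (use e0 Cons in \<open>simp_all add: enc_simps\<close>)
        then show ?thesis using Cons t0(1) t1'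
          by (intro exI[of _ "(1 + t0 + 1) + (1 + (1 + t0 + 1) + 1 + t1 + 1) + 1"]) simp
      qed
    qed
    then show "calls P k ?r ?T" using ld by (simp add: calls_def loaded_Cons)
  qed
qed

text \<open>Repeated polynomial-time steps may let an accumulator grow exponentially, so
  \<open>B\<close> has to bound it for every suffix of the list. The entry body evaluates the list,
  and the loop at \<open>Suc k\<close> recurses on its tail.\<close>

lemma ptime_foldr:
  fixes l :: "'a::enc \<Rightarrow> 'b::enc list" and s :: "'a \<Rightarrow> 'c::enc" and f :: "'a \<Rightarrow> 'b \<Rightarrow> 'c \<Rightarrow> 'c"
  assumes l: "ptime l" and s: "ptime s" and f: "ptime (uncurry3 f)"
    and B: "pbound B" and bound: "\<And>x ys zs. l x = zs @ ys \<Longrightarrow> sz (foldr (f x) ys (s x)) \<le> B x"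
  shows "ptime (\<lambda>x. foldr (f x) (l x) (s x))" (is "ptime ?r")
proof (rule ptime_build[OF l s f])
  show "pbound (\<lambda>x. sz (?r x))" by (rule pbound_mono[OF B]) (rule bound[of _ "[]"], simp)
  let ?loop = "\<lambda>k ks kf. EIf (EVar 1) (ECall kf [ENode (EVar 0) (ENode (ELeft (EVar 1))
      (ECall (Suc k) [EVar 0, ERight (EVar 1)]))]) (ECall ks [EVar 0])"
  let ?e = "\<lambda>k kl ks kf. [ECall (Suc k) [EVar 0, ECall kl [EVar 0]], ?loop k ks kf]"
  show "length (?e k kl ks kf) = 2" for k kl ks kf by simp
  fix Tl Ts :: "'a \<Rightarrow> nat" and Tf :: "'a \<times> 'b \<times> 'c \<Rightarrow> nat" assume T: "pbound Tl" "pbound Ts" "pbound Tf"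
  obtain p where p: "\<And>x y z n. sz x + sz y + sz z + 2 \<le> n \<Longrightarrow> Tf (x, y, z) \<le> poly p n"
    using pbound_triple[OF T(3)] by auto
  \<comment> \<open>The cost of one round: the step function on arguments of bounded size, the start
    value, and 20 for the constant overhead.\<close>
  define C where "C x = poly p (sz x + sz (l x) + B x + 2) + Ts x + 20" for x
  let ?T = "\<lambda>x. Tl x + (sz (l x) + 1) * C x + 5"
  show "\<exists>T. pbound T \<and> (\<forall>P k kl ks kf. calls P kl l Tl \<longrightarrow> calls P ks s Ts \<longrightarrow>
      calls P kf (uncurry3 f) Tf \<longrightarrow> loaded P k (?e k kl ks kf) \<longrightarrow> calls P k ?r T)"
  proof (intro exI[of _ ?T] conjI allI impI)
    show "pbound ?T" unfolding C_def by (intro pbound_intros T ptime_sz l B)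
    fix P k kl ks kf assume c: "calls P kl l Tl" "calls P ks s Ts" "calls P kf (uncurry3 f) Tf"
      and ld: "loaded P k (?e k kl ks kf)"
    have k: "k < length P" "P ! k = ECall (Suc k) [EVar 0, ECall kl [EVar 0]]" "Suc k < length P" "P ! Suc k = ?loop k ks kf"
      using ld by (simp_all add: loaded_Cons)
    have loop: "\<exists>t\<le>(length ys + 1) * C x. eval P [enc x, enc ys] (P ! Suc k) (enc (foldr (f x) ys (s x))) t"
      if "l x = zs @ ys" for x ys zs
      using that
    proof (induction ys arbitrary: zs)
      case Nil
      obtain t1 where t1: "t1 \<le> Ts x" "eval P [enc x] (P ! ks) (enc (s x)) t1" "ks < length P" using callsE[OF c(2)] by blast
      have "eval P [enc x, enc ([] :: 'b list)] (P ! Suc k) (enc (s x)) (1 + (1 + t1 + 1) + 1)"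
        unfolding k(4) by (rule If_Leaf[OF _ eval_callv[OF t1(2,3)]]) (use eval_var1 in \<open>simp add: enc_simps\<close>)
      then show ?case using t1(1) by (intro exI[of _ "1 + (1 + t1 + 1) + 1"]) (simp add: C_def)
    next
      case (Cons y ys)
      let ?acc = "foldr (f x) ys (s x)"
      obtain t where t: "t \<le> (length ys + 1) * C x" "eval P [enc x, enc ys] (P ! Suc k) (enc ?acc) t"
        using Cons.IH[of "zs @ [y]"] Cons.prems by auto
      obtain t1 where t1: "t1 \<le> Tf (x, y, ?acc)" "eval P [enc (x, y, ?acc)] (P ! kf) (enc (f x y ?acc)) t1" "kf < length P"
        using callsE[OF c(3), of "(x, y, ?acc)"] by auto
      have "sz ?acc \<le> B x" by (rule bound[of x "zs @ [y]"]) (simp add: Cons.prems)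
      moreover have "sz y \<le> sz (l x)" by (rule sz_member) (simp add: Cons.prems)
      ultimately have "Tf (x, y, ?acc) \<le> poly p (sz x + sz (l x) + B x + 2)" by (intro p) simp
      then have t1': "t1 \<le> C x - 20" using t1(1) by (simp add: C_def)
      have v1: "eval P [enc x, enc (y # ys)] (EVar 1) (Node (enc y) (enc ys)) 1"
        using eval_var1[of P "enc x" "enc (y # ys)" "[]"] by (simp add: enc_simps)
      have rec: "eval P [enc x, enc (y # ys)] (ECall (Suc k) [EVar 0, ERight (EVar 1)]) (enc ?acc) (1 + (1 + 1) + t + 1)"
        by (rule eval_call2[OF eval_var0 Right[OF v1] t(2) k(3)])
      have "eval P [enc x, enc (y # ys)] (ENode (EVar 0) (ENode (ELeft (EVar 1)) (ECall (Suc k) [EVar 0, ERight (EVar 1)])))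
          (enc (x, y, ?acc)) (1 + ((1 + 1) + (1 + (1 + 1) + t + 1) + 1) + 1)"
        using eval_evals.Node[OF eval_var0 eval_evals.Node[OF Left[OF v1] rec]] by (simp add: enc_simps)
      from eval_call1[OF this t1(2,3)]
      have "eval P [enc x, enc (y # ys)] (P ! Suc k) (enc (f x y ?acc))
          (1 + ((1 + ((1 + 1) + (1 + (1 + 1) + t + 1) + 1) + 1) + t1 + 1) + 1)"
        unfolding k(4) by (rule If_Node[OF v1])
      moreover have "1 + ((1 + ((1 + 1) + (1 + (1 + 1) + t + 1) + 1) + 1) + t1 + 1) + 1 \<le> (length (y # ys) + 1) * C x"
      proof -
        have "20 \<le> C x" by (simp add: C_def)
        then show ?thesis using t(1) t1' by (simp add: algebra_simps)
      qed
      ultimately show ?case by (intro exI conjI) simp_all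
    qed
    have "\<exists>t\<le>?T x. eval P [enc x] (P ! k) (enc (?r x)) t" for x
    proof -
      obtain t0 where t0: "t0 \<le> Tl x" "eval P [enc x] (P ! kl) (enc (l x)) t0" "kl < length P" using callsE[OF c(1)] by blast
      obtain t where t: "t \<le> (length (l x) + 1) * C x" "eval P [enc x, enc (l x)] (P ! Suc k) (enc (?r x)) t"
        using loop[of x "[]" "l x"] by auto
      have "eval P [enc x] (P ! k) (enc (?r x)) (1 + (1 + t0 + 1) + t + 1)"
        unfolding k(2) by (rule eval_call2[OF eval_var0 eval_callv[OF t0(2,3)] t(2) k(3)])
      moreover have "t \<le> (sz (l x) + 1) * C x"
        using t(1) length_le_sz[of "l x"] by (meson add_le_mono1 le_trans mult_le_mono1)
      ultimately show ?thesis using t0(1) by (intro exI[of _ "1 + (1 + t0 + 1) + t + 1"]) simp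
    qed
    then show "calls P k ?r ?T" using k(1) by (simp add: calls_def)
  qed
qed

lemma ptime_eq0: "ptime (\<lambda>z::'a::enc \<times> 'a. fst z = snd z)"
  unfolding ptime_def
proof (intro conjI exI allI impI)
  show "pbound (\<lambda>z::'a \<times> 'a. sz (fst z = snd z))"
    by (rule pbound_mono[OF pbound_const[of 1]]) (rule sz_bool)
  let ?T = "\<lambda>z::'a \<times> 'a. 20 * (2 * sz z + 1) + 10"
  show "pbound ?T" by (intro pbound_intros)
  let ?both = "\<lambda>k. EIf (ECall (Suc k) [ELeft (EVar 0), ELeft (EVar 1)]) (ECall (Suc k) [ERight (EVar 0), ERight (EVar 1)]) ELeaf"
  let ?loop = "\<lambda>k. EIf (EVar 0)
     (EIf (EVar 1) (?both k) ELeaf)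
     (EIf (EVar 1) ELeaf (ENode ELeaf ELeaf))"
  let ?e = "\<lambda>k. [ECall (Suc k) [ELeft (EVar 0), ERight (EVar 0)], ?loop k]"
  show "length (?e k) = 2" for k by simp
  fix P k assume ld: "loaded P k (?e k)"
  have k: "k < length P" "P ! k = ECall (Suc k) [ELeft (EVar 0), ERight (EVar 0)]" "Suc k < length P" "P ! Suc k = ?loop k"
    using ld by (simp_all add: loaded_Cons)
  have v1: "eval P [a, b] (EVar 1) b 1" for a b using eval_var1 by simp
  have leaf: "eval P env ELeaf Leaf 1" for env by (rule eval_evals.Leaf)
  \<comment> \<open>\<open>2 * size a + 1\<close> counts the nodes of \<open>a\<close> including
    leaves, and 20 covers the cost per node.\<close>
  have loop: "\<exists>t\<le>20 * (2 * size a + 1). eval P [a, b] (P ! Suc k) (enc (a = b)) t" for a b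
  proof (induction a arbitrary: b)
    case Leaf
    show ?case
    proof (cases b)
      case Leaf
      have "eval P [tree.Leaf, b] (P ! Suc k) (enc True) (1 + (1 + (1 + 1 + 1) + 1) + 1)"
        unfolding k(4) enc_simps Leaf by (intro If_Leaf eval_var0 eval_evals.Node leaf) (rule v1)
      then show ?thesis using Leaf by (intro exI[of _ "1 + (1 + (1 + 1 + 1) + 1) + 1"]) simp
    next
      case (Node b1 b2)
      have "eval P [tree.Leaf, b] (P ! Suc k) (enc False) (1 + (1 + 1 + 1) + 1)"
        unfolding k(4) enc_simps Node by (rule If_Leaf[OF eval_var0 If_Node[OF v1 leaf]])
      then show ?thesis using Node by (intro exI[of _ "1 + (1 + 1 + 1) + 1"]) simp
    qed
  next
    case (Node a1 a2)
    show ?case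
    proof (cases b)
      case Leaf
      have "eval P [tree.Node a1 a2, b] (P ! Suc k) (enc False) (1 + (1 + 1 + 1) + 1)"
        unfolding k(4) enc_simps Leaf by (rule If_Node[OF eval_var0 If_Leaf[OF v1 leaf]])
      then show ?thesis using Leaf by (intro exI[of _ "1 + (1 + 1 + 1) + 1"]) simp
    next
      case b: (Node b1 b2)
      obtain t1 where t1: "t1 \<le> 20 * (2 * size a1 + 1)" "eval P [a1, b1] (P ! Suc k) (enc (a1 = b1)) t1"
        using Node.IH(1) by blast
      obtain t2 where t2: "t2 \<le> 20 * (2 * size a2 + 1)" "eval P [a2, b2] (P ! Suc k) (enc (a2 = b2)) t2"
        using Node.IH(2) by blast
      let ?env = "[tree.Node a1 a2, tree.Node b1 b2]"
      have e1: "eval P ?env (ECall (Suc k) [ELeft (EVar 0), ELeft (EVar 1)]) (enc (a1 = b1)) ((1 + 1) + (1 + 1) + t1 + 1)"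
        by (rule eval_call2[OF Left[OF eval_var0] Left[OF v1] t1(2) k(3)])
      have e2: "eval P ?env (ECall (Suc k) [ERight (EVar 0), ERight (EVar 1)]) (enc (a2 = b2)) ((1 + 1) + (1 + 1) + t2 + 1)"
        by (rule eval_call2[OF Right[OF eval_var0] Right[OF v1] t2(2) k(3)])
      have "\<exists>t\<le>t1 + t2 + 12. eval P ?env (?both k)
          (enc (tree.Node a1 a2 = tree.Node b1 b2)) t"
      proof (cases "a1 = b1")
        case True
        have "eval P ?env (?both k)
          (enc (a2 = b2)) (((1 + 1) + (1 + 1) + t1 + 1) + ((1 + 1) + (1 + 1) + t2 + 1) + 1)"
          by (rule If_Node[OF _ e2]) (use e1 True in \<open>simp add: enc_simps\<close>)
        then show ?thesis using True by (intro exI[of _ "((1 + 1) + (1 + 1) + t1 + 1) + ((1 + 1) + (1 + 1) + t2 + 1) + 1"]) simp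
      next
        case False
        have "eval P ?env (?both k)
          tree.Leaf (((1 + 1) + (1 + 1) + t1 + 1) + 1 + 1)"
          by (rule If_Leaf[OF _ leaf]) (use e1 False in \<open>simp add: enc_simps\<close>)
        then show ?thesis using False by (intro exI[of _ "((1 + 1) + (1 + 1) + t1 + 1) + 1 + 1"]) (simp add: enc_simps)
      qed
      then obtain t where t: "t \<le> t1 + t2 + 12" "eval P ?env (?both k)
          (enc (tree.Node a1 a2 = tree.Node b1 b2)) t" by blast
      have "eval P ?env (P ! Suc k) (enc (tree.Node a1 a2 = tree.Node b1 b2)) (1 + (1 + t + 1) + 1)"
        unfolding k(4) by (rule If_Node[OF eval_var0 If_Node[OF v1 t(2)]])
      then show ?thesis unfolding b using t(1) t1(1) t2(1) by (intro exI[of _ "1 + (1 + t + 1) + 1"]) simp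
    qed
  qed
  have "\<exists>t\<le>?T z. eval P [enc z] (P ! k) (enc (fst z = snd z)) t" for z :: "'a \<times> 'a"
  proof -
    obtain t where t: "t \<le> 20 * (2 * sz (fst z) + 1)" "eval P [enc (fst z), enc (snd z)] (P ! Suc k) (enc (fst z = snd z)) t"
      using loop[of "enc (fst z)" "enc (snd z)"] by auto
    have v: "eval P [enc z] (EVar 0) (Node (enc (fst z)) (enc (snd z))) 1"
      using eval_var0[of P "enc z" "[]"] by (cases z) (simp add: enc_simps)
    have "eval P [enc z] (P ! k) (enc (fst z = snd z)) ((1 + 1) + (1 + 1) + t + 1)"
      unfolding k(2) by (rule eval_call2[OF Left[OF v] Right[OF v] t(2) k(3)])
    then show ?thesis using t(1) sz_fst[of z] by (intro exI[of _ "(1 + 1) + (1 + 1) + t + 1"]) simp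
  qed
  then show "calls P k (\<lambda>z::'a \<times> 'a. fst z = snd z) ?T" using k(1) by (simp add: calls_def)
qed

lemma ptime_comp2:
  assumes "ptime (uncurry2 f)" "ptime a" "ptime b" shows "ptime (\<lambda>x. f (a x) (b x))"
  using ptime_comp[OF assms(1) ptime_Pair[OF assms(2,3)]] by simp

lemma ptime_comp3:
  assumes "ptime (uncurry3 f)" "ptime a" "ptime b" "ptime c"
  shows "ptime (\<lambda>x. f (a x) (b x) (c x))"
  using ptime_comp[OF assms(1) ptime_Pair[OF assms(2) ptime_Pair[OF assms(3,4)]]] by simp

lemma ptime_eq: "ptime a \<Longrightarrow> ptime b \<Longrightarrow> ptime (\<lambda>x. a x = b x)"
  by (rule ptime_comp2[OF ptime_eq0])

lemma ptime_not: "ptime a \<Longrightarrow> ptime (\<lambda>x. \<not> a x)"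
proof -
  assume "ptime a"
  then have "ptime (\<lambda>x. if a x then False else True)" by (intro ptime_if ptime_const)
  moreover have "(\<lambda>x. if a x then False else True) = (\<lambda>x. \<not> a x)" by auto
  ultimately show ?thesis by simp
qed

lemma ptime_and: "ptime a \<Longrightarrow> ptime b \<Longrightarrow> ptime (\<lambda>x. a x \<and> b x)"
proof -
  assume "ptime a" "ptime b"
  then have "ptime (\<lambda>x. if a x then b x else False)" by (intro ptime_if ptime_const)
  moreover have "(\<lambda>x. if a x then b x else False) = (\<lambda>x. a x \<and> b x)" by auto
  ultimately show ?thesis by (simp only:)
qed

lemma ptime_or: "ptime a \<Longrightarrow> ptime b \<Longrightarrow> ptime (\<lambda>x. a x \<or> b x)"
  using ptime_not[OF ptime_and[OF ptime_not[of a] ptime_not[of b]]] by simp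

lemma ptime_imp: "ptime a \<Longrightarrow> ptime b \<Longrightarrow> ptime (\<lambda>x. a x \<longrightarrow> b x)"
  unfolding imp_conv_disj by (intro ptime_or ptime_not)

lemma ptime_case_prod:
  "ptime p \<Longrightarrow> ptime (uncurry3 g) \<Longrightarrow> ptime (\<lambda>x. case p x of (a, b) \<Rightarrow> g x a b)"
proof -
  assume p: "ptime p" and g: "ptime (uncurry3 g)"
  have "ptime (\<lambda>x. g x (fst (p x)) (snd (p x)))" by (intro ptime_comp3[OF g] ptime_fst ptime_snd ptime_id p)
  then show ?thesis by (simp add: case_prod_beta')
qed

text \<open>If a step enlarges the accumulator by an amount that depends only on the input and the
  list element, the total growth is polynomial, and no separate bound has to be found.\<close>

lemma ptime_foldr_add:
  fixes l :: "'a::enc \<Rightarrow> 'b::enc list" and s :: "'a \<Rightarrow> 'c::enc" and f :: "'a \<Rightarrow> 'b \<Rightarrow> 'c \<Rightarrow> 'c"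
  assumes l: "ptime l" and s: "ptime s" and f: "ptime (uncurry3 f)"
    and b: "pbound (b :: 'a \<times> 'b \<Rightarrow> nat)" and add: "\<And>x y a. sz (f x y a) \<le> sz a + b (x, y)"
  shows "ptime (\<lambda>x. foldr (f x) (l x) (s x))"
proof -
  obtain p where p: "\<forall>v. b v \<le> poly p (sz v)" using b unfolding pbound_def by blast
  let ?B = "\<lambda>x. sz (s x) + sz (l x) * poly p (sz x + sz (l x) + 1)"
  show ?thesis
  proof (rule ptime_foldr[OF l s f])
    show "pbound ?B" by (intro pbound_intros ptime_sz l s)
    fix x ys zs assume lx: "l x = zs @ ys"
    have "sz (foldr (f x) ys (s x)) \<le> sz (s x) + length ys * poly p (sz x + sz (l x) + 1)"
      if "set ys \<subseteq> set (l x)" for ys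
      using that
    proof (induction ys)
      case (Cons y ys)
      have "sz y \<le> sz (l x)" by (rule sz_member) (use Cons.prems in simp)
      then have "b (x, y) \<le> poly p (sz x + sz (l x) + 1)"
        using le_trans[OF p[rule_format, of "(x, y)"] poly_mono_nat] by (simp add: sz_Pair)
      moreover have "sz (f x y (foldr (f x) ys (s x))) \<le> sz (foldr (f x) ys (s x)) + b (x, y)" by (rule add)
      ultimately show ?case using Cons.IH Cons.prems by simp
    qed simp
    from this[of ys] have "sz (foldr (f x) ys (s x)) \<le> sz (s x) + length ys * poly p (sz x + sz (l x) + 1)"
      by (simp add: lx)
    also have "\<dots> \<le> ?B x"
      using length_le_sz[of "l x"] by (intro add_left_mono mult_right_mono) (simp_all add: lx)
    finally show "sz (foldr (f x) ys (s x)) \<le> ?B x" .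
  qed
qed

lemma foldr_map_Cons: "map g xs = foldr (\<lambda>y s. g y # s) xs []"
  by (induction xs) simp_all

lemma ptime_map:
  fixes l :: "'a::enc \<Rightarrow> 'b::enc list" and g :: "'a \<Rightarrow> 'b \<Rightarrow> 'c::enc"
  assumes l: "ptime l" and g: "ptime (uncurry2 g)"
  shows "ptime (\<lambda>x. map (g x) (l x))"
  unfolding foldr_map_Cons
proof (rule ptime_foldr_add[OF l ptime_const])
  have "ptime (\<lambda>z. g (fst z) (fst (snd z)))" for z :: "'a \<times> 'b \<times> 'c list"
    by (rule ptime_comp2[OF g]) (intro ptime_fst ptime_snd ptime_id)+
  then show "ptime (\<lambda>z::'a \<times> 'b \<times> 'c list. g (fst z) (fst (snd z)) # snd (snd z))"
    by (intro ptime_Cons ptime_comp2[OF g] ptime_fst ptime_snd ptime_id)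
  show "pbound (\<lambda>z. sz (g (fst z) (snd z)) + 1)" by (intro pbound_intros ptime_sz g)
qed (simp add: sz_simps)

lemma foldr_filter_Cons: "filter P xs = foldr (\<lambda>y s. if P y then y # s else s) xs []"
  by (induction xs) simp_all

lemma ptime_filter:
  fixes l :: "'a::enc \<Rightarrow> 'b::enc list"
  assumes l: "ptime l" and P: "ptime (uncurry2 P)"
  shows "ptime (\<lambda>x. filter (P x) (l x))"
  unfolding foldr_filter_Cons
proof (rule ptime_foldr_add[OF l ptime_const])
  show "ptime (\<lambda>z::'a \<times> 'b \<times> 'b list. if P (fst z) (fst (snd z)) then fst (snd z) # snd (snd z) else snd (snd z))"
    by (intro ptime_if ptime_Cons ptime_comp2[OF P] ptime_fst ptime_snd ptime_id)
  show "pbound (\<lambda>z::'a \<times> 'b. sz (snd z) + 1)" by (intro pbound_intros ptime_sz ptime_snd ptime_id)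
qed (simp add: sz_simps)

lemma foldr_append_Cons: "xs @ ys = foldr (\<lambda>y s. y # s) xs ys"
  by (induction xs) simp_all

lemma ptime_append:
  fixes f g :: "'a::enc \<Rightarrow> 'b::enc list"
  assumes "ptime f" "ptime g"
  shows "ptime (\<lambda>x. f x @ g x)"
  unfolding foldr_append_Cons
proof (rule ptime_foldr_add[OF assms])
  show "ptime (\<lambda>z::'a \<times> 'b \<times> 'b list. fst (snd z) # snd (snd z))"
    by (intro ptime_Cons ptime_fst ptime_snd ptime_id)
  show "pbound (\<lambda>z::'a \<times> 'b. sz (snd z) + 1)" by (intro pbound_intros ptime_sz ptime_snd ptime_id)
qed (simp add: sz_simps)

lemma foldr_concat_append: "concat xs = foldr (\<lambda>y s. y @ s) xs []"
  by (induction xs) simp_all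

lemma ptime_concat:
  fixes l :: "'a::enc \<Rightarrow> 'b::enc list list"
  assumes "ptime l"
  shows "ptime (\<lambda>x. concat (l x))"
  unfolding foldr_concat_append
proof (rule ptime_foldr_add[OF assms ptime_const])
  show "ptime (\<lambda>z::'a \<times> 'b list \<times> 'b list. fst (snd z) @ snd (snd z))"
    by (intro ptime_append ptime_fst ptime_snd ptime_id)
  show "pbound (\<lambda>z::'a \<times> 'b list. sz (snd z))" by (intro pbound_intros ptime_sz ptime_snd ptime_id)
qed (simp add: sz_append)

lemma rev_foldr: "rev xs = foldr (\<lambda>y s. s @ [y]) xs []"
  by (induction xs) simp_all

lemma ptime_rev:
  fixes l :: "'a::enc \<Rightarrow> 'b::enc list"
  assumes "ptime l"
  shows "ptime (\<lambda>x. rev (l x))"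
  unfolding rev_foldr
proof (rule ptime_foldr_add[OF assms ptime_const])
  show "ptime (\<lambda>z::'a \<times> 'b \<times> 'b list. snd (snd z) @ [fst (snd z)])"
    by (intro ptime_append ptime_Cons ptime_const ptime_fst ptime_snd ptime_id)
  show "pbound (\<lambda>z::'a \<times> 'b. sz (snd z) + 1)" by (intro pbound_intros ptime_sz ptime_snd ptime_id)
qed (simp add: sz_append sz_simps)

lemma Ball_foldr: "(\<forall>y\<in>set xs. P y) = foldr (\<lambda>y s. P y \<and> s) xs True"
  by (induction xs) simp_all

lemma ptime_Ball:
  fixes l :: "'a::enc \<Rightarrow> 'b::enc list"
  assumes l: "ptime l" and P: "ptime (uncurry2 P)"
  shows "ptime (\<lambda>x. \<forall>y\<in>set (l x). P x y)"
  unfolding Ball_foldr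
proof (rule ptime_foldr[OF l ptime_const])
  show "ptime (\<lambda>z::'a \<times> 'b \<times> bool. P (fst z) (fst (snd z)) \<and> snd (snd z))"
    by (intro ptime_and ptime_comp2[OF P] ptime_fst ptime_snd ptime_id)
  show "pbound (\<lambda>x::'a. 1)" by (rule pbound_const)
qed (rule sz_bool)

lemma ptime_Bex:
  fixes l :: "'a::enc \<Rightarrow> 'b::enc list"
  assumes l: "ptime l" and P: "ptime (uncurry2 P)"
  shows "ptime (\<lambda>x. \<exists>y\<in>set (l x). P x y)"
  using ptime_not[OF ptime_Ball[OF l ptime_not[OF P]]] by simp

lemma ptime_member:
  fixes l :: "'a::enc \<Rightarrow> 'b::enc list"
  assumes "ptime a" "ptime l"
  shows "ptime (\<lambda>x. a x \<in> set (l x))"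
proof -
  have "ptime (\<lambda>x. \<exists>y\<in>set (l x). y = a x)"
    by (rule ptime_Bex[OF assms(2)]) (intro ptime_eq ptime_snd ptime_id ptime_comp[OF assms(1)] ptime_fst)
  then show ?thesis by simp
qed

lemma foldr_funpow: "(f ^^ length xs) s = foldr (\<lambda>_. f) xs s"
  by (induction xs) simp_all

text \<open>The counter of the iteration is a list, so no arithmetic on numerals is
  involved.\<close>

lemma ptime_funpow:
  fixes l :: "'a::enc \<Rightarrow> 'b::enc list" and s :: "'a \<Rightarrow> 'c::enc" and f :: "'a \<Rightarrow> 'c \<Rightarrow> 'c"
  assumes l: "ptime l" and s: "ptime s" and f: "ptime (uncurry2 f)"
    and B: "pbound B" and bound: "\<And>x n. n \<le> length (l x) \<Longrightarrow> sz ((f x ^^ n) (s x)) \<le> B x"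
  shows "ptime (\<lambda>x. (f x ^^ length (l x)) (s x))"
  unfolding foldr_funpow
proof (rule ptime_foldr[OF l s _ B])
  show "ptime (\<lambda>z::'a \<times> 'b \<times> 'c. f (fst z) (snd (snd z)))"
    by (intro ptime_comp2[OF f] ptime_fst ptime_snd ptime_id)
  show "sz (foldr (\<lambda>_. f x) ys (s x)) \<le> B x" if "l x = zs @ ys" for x ys zs
    unfolding foldr_funpow[symmetric] by (rule bound) (simp add: that)
qed

text \<open>With these rules the running time of a definition follows from its syntax; only folds
  and iterations call for size bounds.\<close>

lemmas ptime_basic = ptime_const ptime_id ptime_fst ptime_snd ptime_Pair ptime_Cons ptime_if 
  ptime_not ptime_and ptime_or ptime_imp ptime_eq ptime_member ptime_Ball ptime_Bex
  ptime_map ptime_filter ptime_append ptime_concat ptime_rev ptime_case_list ptime_case_prod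

section \<open>Running time of the construction\<close>

lemma ptime_crosses: "ptime D \<Longrightarrow> ptime e \<Longrightarrow> ptime (\<lambda>x. crosses (set (D x)) (e x))"
  unfolding crosses_def by (intro ptime_basic)

lemma ptime_inc: "ptime v \<Longrightarrow> ptime e \<Longrightarrow> ptime (\<lambda>x. inc (v x) (e x))"
  unfolding inc_def by (intro ptime_basic)

lemma ptime_oth: "ptime v \<Longrightarrow> ptime e \<Longrightarrow> ptime (\<lambda>x. oth (v x) (e x))"
  unfolding oth_def by (intro ptime_basic)

lemma ptime_grow_step0: "ptime (\<lambda>z. grow_step (fst z :: ('e::enc, 'v::enc) edge list) (snd z))"
  unfolding grow_step_def Let_def by (intro ptime_basic ptime_crosses)

lemma sz_src: "sz (src e) \<le> sz e" and sz_tgt: "sz (tgt e) \<le> sz e"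
  by (meson sz_fst sz_snd le_trans)+

lemma sz_oth: "sz (oth v e) \<le> sz e"
  by (simp add: oth_def sz_src sz_tgt)

text \<open>Vertices and edges are copied from the input and never altered, so \<open>M\<close>
  bounds them throughout, and after \<open>n\<close> rounds the lists have at most
  \<open>n + 1\<close> entries.\<close>

lemma grow_funpow_small:
  fixes E :: "('e::enc, 'v::enc) edge list"
  assumes r: "sz r \<le> M" and E: "sz E \<le> M"
  defines "st \<equiv> \<lambda>n. (grow_step E ^^ n) ([r], [])"
  shows "(\<forall>w\<in>set (fst (st n)). sz w \<le> M) \<and> length (fst (st n)) \<le> n + 1 \<and> length (snd (st n)) \<le> n \<and>
    (\<forall>q\<in>set (snd (st n)). sz (fst q) \<le> M \<and> length (snd q) \<le> n + 1 \<and> (\<forall>w\<in>set (snd q). sz w \<le> M))"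
proof (induction n)
  case 0
  show ?case using r by (simp add: st_def)
next
  case (Suc n)
  have st: "st (Suc n) = grow_step E (st n)" by (simp add: st_def)
  show ?case
  proof (cases "filter (crosses (set (fst (st n)))) E")
    case Nil
    then have eq: "st (Suc n) = st n" unfolding st grow_step_def by simp
    show ?thesis unfolding eq using Suc.IH by (auto intro: le_SucI)
  next
    case (Cons t ts)
    have "t \<in> set (filter (crosses (set (fst (st n)))) E)" unfolding Cons by simp
    then have t: "sz t \<le> M" using sz_member[of t E] E by simp
    define w where "w = (if src t \<in> set (fst (st n)) then tgt t else src t)"
    define p where "p = (if src t \<in> set (fst (st n)) then src t else tgt t)"
    have eq: "st (Suc n) = (w # fst (st n),
        (t, [w]) # map (attach p w) (snd (st n)))"
      unfolding st grow_step_def Cons by (simp add: w_def p_def Let_def)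
    have w: "sz w \<le> M" using t sz_src[of t] sz_tgt[of t] by (auto simp: w_def)
    show ?thesis unfolding eq using Suc.IH t w by auto
  qed
qed

lemma sz_grow_funpow:
  fixes E :: "('e::enc, 'v::enc) edge list"
  assumes r: "sz r \<le> M" and E: "sz E \<le> M" and n: "n \<le> N"
  shows "sz ((grow_step E ^^ n) ([r], [])) \<le> (N + 1) * (M + 1) + N * (M + (N + 1) * (M + 1) + 2) + 1"
proof -
  let ?st = "(grow_step E ^^ n) ([r], [])"
  note small = grow_funpow_small[OF r E, of n]
  have "sz (fst ?st) \<le> length (fst ?st) * (M + 1)" by (rule sz_list_le) (use small in simp)
  also have "\<dots> \<le> (N + 1) * (M + 1)" by (rule mult_right_mono) (use small n in simp_all)
  finally have 1: "sz (fst ?st) \<le> (N + 1) * (M + 1)" .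
  have "sz q \<le> M + (N + 1) * (M + 1) + 1" if q: "q \<in> set (snd ?st)" for q
  proof -
    have "sz (snd q) \<le> length (snd q) * (M + 1)" by (rule sz_list_le) (use small q in simp)
    also have "\<dots> \<le> (N + 1) * (M + 1)" by (rule mult_right_mono) (use small q n in force)+
    finally have "sz (snd q) \<le> (N + 1) * (M + 1)" .
    moreover have "sz (fst q) \<le> M" using small q by simp
    moreover have "sz q = sz (fst q) + sz (snd q) + 1" by (cases q) (simp add: sz_Pair)
    ultimately show ?thesis by simp
  qed
  then have "sz (snd ?st) \<le> length (snd ?st) * ((M + (N + 1) * (M + 1) + 1) + 1)" by (intro sz_list_le) simp
  also have "\<dots> \<le> N * ((M + (N + 1) * (M + 1) + 1) + 1)" by (rule mult_right_mono) (use small n in simp_all)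
  finally have 2: "sz (snd ?st) \<le> N * (M + (N + 1) * (M + 1) + 2)" by simp
  have "sz ?st = sz (fst ?st) + sz (snd ?st) + 1" by (metis prod.collapse sz_Pair)
  then show ?thesis using 1 2 by simp
qed

lemma ptime_grow0: "ptime (\<lambda>z. grow (fst z :: 'v::enc list) (snd z :: ('e::enc, 'v) edge list))"
  unfolding grow_def
proof (rule ptime_case_list)
  let ?n = "\<lambda>z :: ('v list \<times> ('e, 'v) edge list) \<times> 'v \<times> 'v list. sz z"
  show "ptime (\<lambda>z :: ('v list \<times> ('e, 'v) edge list) \<times> 'v \<times> 'v list.
      (grow_step (snd (fst z)) ^^ length (fst (fst z))) ([fst (snd z)], []))"
  proof (rule ptime_funpow)
    show "ptime (\<lambda>z :: (('v list \<times> ('e, 'v) edge list) \<times> 'v \<times> 'v list) \<times> 'v list \<times> ('e, 'v) tree_cuts.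
        grow_step (snd (fst (fst z))) (snd z))"
      by (intro ptime_comp2[OF ptime_grow_step0] ptime_basic)
    show "pbound (\<lambda>z. (?n z + 1) * (?n z + 1) + ?n z * (?n z + (?n z + 1) * (?n z + 1) + 2) + 1)"
      by (intro pbound_intros)
    fix z :: "('v list \<times> ('e, 'v) edge list) \<times> 'v \<times> 'v list" and n
    assume n: "n \<le> length (fst (fst z))"
    have "sz (fst (snd z)) \<le> sz z" "sz (snd (fst z)) \<le> sz z" "sz (fst (fst z)) \<le> sz z"
      by (meson sz_fst sz_snd le_trans)+
    then show "sz ((grow_step (snd (fst z)) ^^ n) ([fst (snd z)], [])) \<le>
        (?n z + 1) * (?n z + 1) + ?n z * (?n z + (?n z + 1) * (?n z + 1) + 2) + 1"
      using n length_le_sz[of "fst (fst z)"] by (intro sz_grow_funpow) simp_all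
  qed (intro ptime_basic)+
qed (intro ptime_basic)+

lemmas ptime_grow = ptime_comp2[OF ptime_grow0]

lemma ptime_vlist: "ptime E \<Longrightarrow> ptime (\<lambda>x. vlist (E x))"
  unfolding vlist_def by (intro ptime_basic)

lemma ptime_connects0: "ptime (\<lambda>z. connects (fst z :: 'v::enc list) (snd z :: ('e::enc, 'v) edge list))"
  unfolding connects_def subset_iff Ball_def[symmetric] by (intro ptime_basic ptime_grow)

lemmas ptime_connects = ptime_comp2[OF ptime_connects0]

lemma ptime_three_conn0: "ptime (three_conn :: ('e::enc, 'v::enc) edge list \<Rightarrow> bool)"
  unfolding three_conn_def by (intro ptime_basic ptime_connects ptime_vlist)

lemmas ptime_three_conn = ptime_comp[OF ptime_three_conn0]

lemma ptime_side1: "ptime E \<Longrightarrow> ptime e \<Longrightarrow> ptime (\<lambda>x. side1 (E x) (e x))"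
  by (rule ptime_comp2[of side1]) (unfold side1_def, intro ptime_basic ptime_inc)

lemma ptime_side2: "ptime E \<Longrightarrow> ptime e \<Longrightarrow> ptime (\<lambda>x. side2 (E x) (e x))"
  by (rule ptime_comp2[of side2]) (unfold side2_def, intro ptime_basic ptime_inc)

lemma ptime_rest: "ptime E \<Longrightarrow> ptime e \<Longrightarrow> ptime (\<lambda>x. rest (E x) (e x))"
  by (rule ptime_comp2[of rest]) (unfold rest_def, intro ptime_basic ptime_inc)

lemma ptime_suppressed:
  "ptime E \<Longrightarrow> ptime e \<Longrightarrow> ptime a1 \<Longrightarrow> ptime a2 \<Longrightarrow> ptime b1 \<Longrightarrow> ptime b2 \<Longrightarrow> ptime (\<lambda>x. suppressed (E x) (e x) (a1 x) (a2 x) (b1 x) (b2 x))"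
  unfolding suppressed_def by (intro ptime_basic ptime_oth ptime_rest)

lemma ptime_reduce0: "ptime (\<lambda>z. reduce (fst z :: ('e::enc, 'v::enc) edge list) (snd z))"
  unfolding reduce_def by (intro ptime_basic ptime_side1 ptime_side2 ptime_suppressed)

lemmas ptime_reduce = ptime_comp2[OF ptime_reduce0]

lemma ptime_candidates0: "ptime (candidates :: ('e::enc, 'v::enc) edge list \<Rightarrow> _)"
  unfolding candidates_def by (intro ptime_basic ptime_reduce ptime_three_conn)

lemmas ptime_candidates = ptime_comp[OF ptime_candidates0]

lemma ptime_reduce_step0: "ptime (reduce_step :: ('e::enc, 'v::enc) edge list \<times> _ \<Rightarrow> _)"
  unfolding reduce_step_def by (intro ptime_basic ptime_candidates)

lemma ptime_comp4:
  assumes "ptime (\<lambda>z. f (fst z) (fst (snd z)) (fst (snd (snd z))) (snd (snd (snd z))))" "ptime a" "ptime b" "ptime c" "ptime d"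
  shows "ptime (\<lambda>x. f (a x) (b x) (c x) (d x))"
  using ptime_comp[OF assms(1) ptime_Pair[OF assms(2) ptime_Pair[OF assms(3) ptime_Pair[OF assms(4,5)]]]] by simp

lemma sz_sides: "sz (side1 E e) + sz (side2 E e) + sz (rest E e) \<le> sz E"
  unfolding side1_def side2_def rest_def by (induction E) (simp_all add: sz_simps)

lemma sz_edge: "sz (fst a) + sz (oth u a) + 2 \<le> sz a"
proof -
  have "sz a = sz (fst a) + sz (src a) + sz (tgt a) + 2" by (cases a) (simp add: sz_Pair)
  then show ?thesis by (simp add: oth_def)
qed

text \<open>The replacement edges take their identifiers and ends from the four edges they replace.
  As the encoding never grows, arbitrarily many reductions stay within the size of the
  input.\<close>

lemma sz_suppressed:
  assumes "side1 E e = a1 # a2 # A" "side2 E e = b1 # b2 # B"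
  shows "sz (suppressed E e a1 a2 b1 b2) \<le> sz E"
  using sz_sides[of E e] sz_edge[of a1 "src e"] sz_oth[of "src e" a2] sz_edge[of b1 "tgt e"] sz_oth[of "tgt e" b2]
  by (simp add: assms suppressed_def sz_simps)

lemma sz_candidates:
  assumes "r \<in> set (candidates E)"
  shows "sz (snd r) \<le> sz E" "sz (fst r) \<le> 5 * sz E + 4"
proof -
  obtain e where e: "e \<in> set E" "r \<in> set (reduce E e)" using assms by (auto simp: candidates_def)
  obtain a1 A' where A': "side1 E e = a1 # A'" using e(2) by (cases "side1 E e") (simp_all add: reduce_def)
  obtain a2 A where A: "A' = a2 # A" using e(2) A' by (cases A') (simp_all add: reduce_def)
  obtain b1 B' where B': "side2 E e = b1 # B'" using e(2) A' A by (cases "side2 E e") (simp_all add: reduce_def)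
  obtain b2 B where B: "B' = b2 # B" using e(2) A' A B' by (cases B') (simp_all add: reduce_def)
  have s: "side1 E e = a1 # a2 # A" "side2 E e = b1 # b2 # B" using A' A B' B by simp_all
  have r: "r = ((e, a1, a2, b1, b2), suppressed E e a1 a2 b1 b2)" using e(2) by (simp add: reduce_def s)
  show "sz (snd r) \<le> sz E" using sz_suppressed[OF s] by (simp add: r)
  show "sz (fst r) \<le> 5 * sz E + 4" using sz_sides[of E e] sz_member[OF e(1)] by (simp add: r s sz_simps)
qed

text \<open>An entry of the history pairs an edge list of size at most \<open>sz E\<close> with five
  edges joined by four pair nodes, which gives \<open>6 * sz E + 5\<close>.\<close>

lemma reduce_funpow_small:
  fixes E :: "('e::enc, 'v::enc) edge list"
  defines "st \<equiv> \<lambda>n. (reduce_step ^^ n) (E, [])"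
  shows "sz (fst (st n)) \<le> sz E \<and> length (snd (st n)) \<le> n \<and> (\<forall>r\<in>set (snd (st n)). sz r \<le> 6 * sz E + 5)"
proof (induction n)
  case (Suc n)
  have st: "st (Suc n) = reduce_step (st n)" by (simp add: st_def)
  show ?case
  proof (cases "candidates (fst (st n))")
    case Nil
    then have "st (Suc n) = st n" unfolding st reduce_step_def by simp
    then show ?thesis using Suc.IH by (simp add: le_SucI)
  next
    case (Cons r rs)
    then have eq: "st (Suc n) = (snd r, snd (st n) @ [(fst (st n), fst r)])" unfolding st reduce_step_def by simp
    have "r \<in> set (candidates (fst (st n)))" by (simp add: Cons)
    from sz_candidates[OF this] show ?thesis unfolding eq using Suc.IH by (auto simp: sz_Pair)
  qed
qed (simp add: st_def)

lemma sz_prod: "sz p = sz (fst p) + sz (snd p) + 1"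
  by (cases p) (simp add: sz_Pair)

lemma ptime_reductions: "ptime E \<Longrightarrow> ptime (\<lambda>x. reductions (E x :: ('e::enc, 'v::enc) edge list))"
proof (rule ptime_comp[of reductions])
  show "ptime (reductions :: ('e, 'v) edge list \<Rightarrow> _)"
    unfolding reductions_def
  proof (rule ptime_funpow)
    show "ptime (\<lambda>z :: ('e, 'v) edge list \<times> _. reduce_step (snd z))"
      by (rule ptime_comp[OF ptime_reduce_step0]) (intro ptime_basic)
    let ?B = "\<lambda>E :: ('e, 'v) edge list. sz E + sz E * ((6 * sz E + 5) + 1) + 1"
    show "pbound ?B" by (intro pbound_intros)
    fix E :: "('e, 'v) edge list" and n assume n: "n \<le> length E"
    let ?st = "(reduce_step ^^ n) (E, [])"
    have small: "sz (fst ?st) \<le> sz E" "length (snd ?st) \<le> n" "\<forall>r\<in>set (snd ?st). sz r \<le> 6 * sz E + 5"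
      using reduce_funpow_small[of n E] by simp_all
    have "sz (snd ?st) \<le> length (snd ?st) * ((6 * sz E + 5) + 1)" by (rule sz_list_le[OF small(3)])
    also have "\<dots> \<le> sz E * ((6 * sz E + 5) + 1)"
      by (rule mult_right_mono) (use small(2) n length_le_sz[of E] in simp_all)
    finally have "sz (snd ?st) \<le> sz E * ((6 * sz E + 5) + 1)" .
    moreover have "sz ?st = sz (fst ?st) + sz (snd ?st) + 1" by (rule sz_prod)
    ultimately show "sz ?st \<le> ?B E" using small(1) by linarith
  qed (intro ptime_basic)+
qed

lemma ptime_without: "ptime E \<Longrightarrow> ptime K \<Longrightarrow> ptime c \<Longrightarrow> ptime (\<lambda>x. without (E x) (K x) (c x))"
  by (rule ptime_comp3[of without]) (unfold without_def, intro ptime_basic)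

lemma ptime_valid0: "ptime (\<lambda>z. valid (fst z :: ('e::enc, 'v::enc) edge list) (snd z))"
  unfolding valid_def by (intro ptime_basic ptime_connects ptime_vlist ptime_without)

lemmas ptime_valid = ptime_comp2[OF ptime_valid0]

lemma ptime_recolour0: "ptime (\<lambda>z. recolour (fst z :: ('e::enc, 'v::enc) quintuple) (fst (snd z)) (snd (snd z) :: 'c::enc \<times> _))"
  unfolding recolour_def case_prod_beta' by (intro ptime_basic)

lemmas ptime_recolour = ptime_comp3[OF ptime_recolour0]

lemma ptime_base_colouring: "ptime E \<Longrightarrow> ptime (\<lambda>x. base_colouring (E x :: ('e::enc, 'v::enc) edge list))"
  by (rule ptime_comp[of base_colouring]) (unfold base_colouring_def, intro ptime_basic)

lemma ptime_unreduce0: "ptime (\<lambda>z. unreduce (fst z :: ('e::enc, 'v::enc) edge list \<times> _) (snd z))"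
  unfolding unreduce_def by (intro ptime_basic ptime_valid ptime_recolour)

lemma sz_recolour:
  fixes q :: "('e::enc, 'v::enc) quintuple" and cs :: "'c::enc \<times> 'c \<times> 'c \<times> 'c \<times> 'c"
  shows "sz (recolour q K cs) \<le> sz K + sz q + sz cs + 10"
proof -
  obtain e a1 a2 b1 b2 where q: "q = (e, a1, a2, b1, b2)" by (rule prod_cases5)
  obtain c1 c2 c3 c4 c5 where cs: "cs = (c1, c2, c3, c4, c5)" by (rule prod_cases5)
  have "sz (filter (\<lambda>k. fst k \<noteq> fst a1 \<and> fst k \<noteq> fst b1) K) \<le> sz K" by (rule sz_filter)
  then show ?thesis
    using sz_fst[of e] sz_fst[of a1] sz_fst[of a2] sz_fst[of b1] sz_fst[of b2]
    by (simp add: q cs recolour_def sz_simps)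
qed

text \<open>The growth does not depend on \<open>K\<close>, as \<open>ptime_foldr_add\<close>
  requires: at most five entries are new, with identifiers from \<open>r\<close> and colours from a
  fixed list.\<close>

lemma sz_unreduce: "sz (unreduce r K) \<le> sz K + (sz r + sz colour_tuples + 10)"
proof (cases "filter (valid (fst r)) (map (recolour (snd r) K) colour_tuples)")
  case Nil
  then show ?thesis by (simp add: unreduce_def)
next
  case (Cons K' Ks)
  have "K' \<in> set (filter (valid (fst r)) (map (recolour (snd r) K) colour_tuples))" by (simp add: Cons)
  then obtain cs where cs: "cs \<in> set colour_tuples" "K' = recolour (snd r) K cs" by auto
  have "sz K' \<le> sz K + sz (snd r) + sz cs + 10" unfolding cs(2) by (rule sz_recolour)
  also have "\<dots> \<le> sz K + (sz r + sz colour_tuples + 10)" using sz_snd[of r] sz_member[OF cs(1)] by simp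
  finally show ?thesis using Cons by (simp add: unreduce_def)
qed

lemma ptime_cotrees: "ptime E \<Longrightarrow> ptime (\<lambda>x. cotrees (E x :: ('e::enc, 'v::enc) edge list))"
proof (rule ptime_comp[of cotrees])
  show "ptime (cotrees :: ('e, 'v) edge list \<Rightarrow> _)"
    unfolding cotrees_def
  proof (rule ptime_foldr_add)
    show "ptime (\<lambda>z :: ('e, 'v) edge list \<times> (('e, 'v) edge list \<times> ('e, 'v) quintuple) \<times> _. unreduce (fst (snd z)) (snd (snd z)))"
      by (intro ptime_comp2[OF ptime_unreduce0] ptime_basic)
    show "pbound (\<lambda>z :: ('e, 'v) edge list \<times> (('e, 'v) edge list \<times> ('e, 'v) quintuple). sz (snd z) + sz colour_tuples + 10)"
      by (intro pbound_intros ptime_sz ptime_basic)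
    show "sz (unreduce y a) \<le> sz a + (sz (snd (x, y)) + sz colour_tuples + 10)"
      for x :: "('e, 'v) edge list" and y :: "('e, 'v) edge list \<times> ('e, 'v) quintuple" and a
      using sz_unreduce[of y a] by simp
  qed (intro ptime_basic ptime_reductions ptime_base_colouring)+
qed

lemma ptime_colour_ok0: "ptime (\<lambda>z. colour_ok (fst z :: 'v::enc list list) (fst (snd z) :: ('e::enc, 'v) edge)
    (fst (snd (snd z))) (snd (snd (snd z)) :: 'c::enc))"
  unfolding colour_ok_def by (intro ptime_basic ptime_crosses)

lemmas ptime_colour_ok = ptime_comp4[OF ptime_colour_ok0]

lemma ptime_assign0: "ptime (\<lambda>z. assign palette (fst z :: 'v::enc list list) (fst (snd z) :: ('e::enc, 'v) edge) (snd (snd z)))"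
  unfolding assign_def by (intro ptime_basic ptime_colour_ok)

lemma sz_assign: "sz (assign Cs Ds e M) \<le> sz M + (sz e + sz Cs + 2)"
proof (cases "filter (colour_ok Ds e M) Cs")
  case Nil
  then show ?thesis by (simp add: assign_def)
next
  case (Cons c cs)
  have "c \<in> set (filter (colour_ok Ds e M) Cs)" by (simp add: Cons)
  then have "sz c \<le> sz Cs" by (intro sz_member) simp
  then show ?thesis using Cons by (simp add: assign_def sz_simps)
qed

lemma sz_foldr_assign:
  assumes "set es \<subseteq> set N" "length es \<le> length N"
  shows "sz (foldr (assign Cs Ds) es M) \<le> sz M + sz N * (sz N + sz Cs + 2)"
proof -
  have "sz (foldr (assign Cs Ds) es M) \<le> sz M + length es * (sz N + sz Cs + 2)"
    using assms(1)
  proof (induction es)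
    case (Cons e es)
    have "sz (assign Cs Ds e (foldr (assign Cs Ds) es M)) \<le> sz (foldr (assign Cs Ds) es M) + (sz e + sz Cs + 2)"
      by (rule sz_assign)
    moreover have "sz e \<le> sz N" by (rule sz_member) (use Cons.prems in simp)
    ultimately show ?case using Cons by simp
  qed simp
  also have "\<dots> \<le> sz M + sz N * (sz N + sz Cs + 2)"
    using assms(2) length_le_sz[of N] by (intro add_left_mono mult_right_mono) simp_all
  finally show ?thesis .
qed

lemma ptime_colouring0: "ptime (\<lambda>z. colouring palette (fst z :: ('e::enc, 'v::enc) edge list) (snd z))"
  unfolding colouring_def
proof (rule ptime_foldr_add)
  show "ptime (\<lambda>w :: (('e, 'v) edge list \<times> 'v list list) \<times> 'v list \<times> (('e, 'v) edge \<times> nat) list.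
      foldr (assign palette (snd (fst w))) (filter (crosses (set (fst (snd w)))) (fst (fst w))) (snd (snd w)))"
  proof (rule ptime_foldr_add)
    show "pbound (\<lambda>v :: ((('e, 'v) edge list \<times> 'v list list) \<times> 'v list \<times> (('e, 'v) edge \<times> nat) list) \<times> ('e, 'v) edge.
        sz (snd v) + sz palette + 2)"
      by (intro pbound_intros ptime_sz ptime_basic)
    show "sz (assign palette (snd (fst w)) y a) \<le> sz a + (sz (snd (w, y)) + sz palette + 2)"
      for w :: "(('e, 'v) edge list \<times> 'v list list) \<times> 'v list \<times> (('e, 'v) edge \<times> nat) list" and y a
      unfolding snd_conv by (rule sz_assign)
  qed (intro ptime_basic ptime_crosses ptime_comp3[OF ptime_assign0])+
  show "pbound (\<lambda>w :: (('e, 'v) edge list \<times> 'v list list) \<times> 'v list.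
      sz (fst (fst w)) * (sz (fst (fst w)) + sz palette + 2))"
    by (intro pbound_intros ptime_sz ptime_basic)
  fix x :: "('e, 'v) edge list \<times> 'v list list" and D :: "'v list" and M :: "(('e, 'v) edge \<times> nat) list"
  show "sz (foldr (assign palette (snd x)) (filter (crosses (set D)) (fst x)) M) \<le>
      sz M + sz (fst (fst (x, D))) * (sz (fst (fst (x, D))) + sz palette + 2)"
    unfolding fst_conv by (rule sz_foldr_assign) auto
qed (intro ptime_basic)+

lemmas ptime_colouring = ptime_comp2[OF ptime_colouring0]

lemma ptime_classes0: "ptime (\<lambda>z. classes (fst z :: ('e::enc, 'v::enc) edge list) (snd z))"
  unfolding classes_def Let_def by (intro ptime_basic ptime_colouring ptime_grow ptime_vlist)

lemmas ptime_classes = ptime_comp2[OF ptime_classes0]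

lemma ptime_subgraphs0: "ptime (subgraphs :: ('e::enc, 'v::enc) edge list \<Rightarrow> _)"
  unfolding subgraphs_def by (intro ptime_basic ptime_classes ptime_without ptime_cotrees)

section \<open>Binary numerals, numbered edges and the size of the input\<close>

fun bits :: "nat \<Rightarrow> bool list" where
  "bits n = (if n = 0 then [] else odd n # bits (n div 2))"

declare bits.simps [simp del]

text \<open>A numeral is encoded like the list of its bits, so arithmetic can be programmed on lists
  of truth values.\<close>

lemma enc_bits: "enc (bits n) = enc (n :: nat)"
proof (induction n rule: less_induct)
  case (less n)
  show ?case
  proof (cases "n = 0")
    case False
    then show ?thesis using less[of "n div 2"]
      by (simp add: bits.simps[of n] enc_nat.simps[of n] enc_nat_inst enc_Cons enc_bool_def)
  qed (simp add: bits.simps enc_nat.simps enc_nat_inst enc_Nil)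
qed

fun inc_bits :: "bool list \<Rightarrow> bool list" where
  "inc_bits [] = [True]"
| "inc_bits (b # r) = (if b then False # inc_bits r else True # r)"

lemma bits_Suc: "bits (Suc n) = inc_bits (bits n)"
proof (induction n rule: less_induct)
  case (less n)
  show ?case
  proof (cases "even n")
    case True
    then have "Suc n div 2 = n div 2" by presburger
    then show ?thesis using True by (cases "n = 0") (simp_all add: bits.simps[of n] bits.simps[of "Suc n"] bits.simps[of 0] bits.simps[of "Suc 0"])
  next
    case False
    then have "n \<noteq> 0" "Suc n div 2 = Suc (n div 2)" "n div 2 < n" by presburger+
    then show ?thesis using False less[of "n div 2"] by (simp add: bits.simps[of n] bits.simps[of "Suc n"])
  qed
qed

lemma sz_inc_bits: "sz (inc_bits bs) \<le> sz bs + 2"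
  by (induction bs) (auto simp: enc_simps)

text \<open>When no carry is left, the tail itself is needed and not its successor. A fold has no
  access to the tail, so it is carried along as the first component.\<close>

lemma inc_bits_foldr:
  "(bs, inc_bits bs) = foldr (\<lambda>b s. (b # fst s, if b then False # snd s else True # fst s)) bs ([], [True])"
  by (induction bs) (auto simp: prod_eq_iff)

lemma ptime_Suc: "ptime f \<Longrightarrow> ptime (\<lambda>x. Suc (f x))"
proof (rule ptime_comp[of Suc])
  have "ptime (\<lambda>bs. foldr (\<lambda>b s. (b # fst s, if b then False # snd s else True # fst s)) bs ([], [True]))"
  proof (rule ptime_foldr)
    show "pbound (\<lambda>bs :: bool list. sz bs + (sz bs + 2) + 1)" by (intro pbound_intros)
    show "ptime (\<lambda>z :: bool list \<times> bool \<times> bool list \<times> bool list. (fst (snd z) # fst (snd (snd z)), if fst (snd z)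
      then False # snd (snd (snd z)) else True # fst (snd (snd z))))" by (intro ptime_basic)
    show "sz (foldr (\<lambda>b s. (b # fst s, if b then False # snd s else True # fst s)) ys ([], [True])) \<le>
        sz bs + (sz bs + 2) + 1" if "bs = zs @ ys" for bs ys zs
      unfolding inc_bits_foldr[symmetric] using sz_inc_bits[of ys] by (simp add: that sz_Pair sz_append)
  qed (intro ptime_basic)+
  then have "ptime (\<lambda>bs. (bs, inc_bits bs))" unfolding inc_bits_foldr .
  then have inc: "ptime (\<lambda>bs. inc_bits bs)" using ptime_snd[of "\<lambda>bs. (bs, inc_bits bs)"] by simp
  have "ptime bits" by (rule ptime_enc_cong[OF ptime_id]) (simp add: enc_bits)
  from ptime_comp[OF inc this] show "ptime Suc"
    by (rule ptime_enc_cong) (simp add: bits_Suc[symmetric] enc_bits)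
qed

text \<open>Input edges have no names and get their positions as identifiers. Reversing the list
  lets the fold count from its front.\<close>

definition enumerate_edges :: "'a list \<Rightarrow> nat \<times> (nat \<times> 'a) list" where
  "enumerate_edges es = foldr (\<lambda>p s. (Suc (fst s), snd s @ [(fst s, p)])) (rev es) (0, [])"

lemma enumerate_edges: "enumerate_edges es = (length es, zip [0..<length es] es)"
  unfolding enumerate_edges_def
proof (induction es rule: rev_induct)
  case (snoc x es)
  then show ?case by (simp add: zip_append1)
qed simp

text \<open>A linear bound in place of the logarithmic one is enough, because the running time is
  measured in the number of vertices and edges and not in bits.\<close>

lemma sz_nat_le: "sz (n :: nat) \<le> 2 * n"
proof (induction n rule: less_induct)
  case (less n)
  show ?case
  proof (cases "n = 0")
    case False
    then have "size (enc_nat (n div 2)) \<le> 2 * (n div 2)" using less[of "n div 2"] by (simp add: enc_nat_inst)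
    moreover have "size (enc_nat n) \<le> size (enc_nat (n div 2)) + 2"
      using False by (simp add: enc_nat.simps[of n] enc_bit_def)
    moreover have "n div 2 < n" using False by simp
    ultimately show ?thesis by (simp add: enc_nat_inst)
  qed (simp add: enc_nat_inst enc_nat.simps)
qed

lemma ptime_enumerate_edges: "ptime (\<lambda>es :: 'a::enc list. enumerate_edges es)"
  unfolding enumerate_edges_def
proof (rule ptime_foldr)
  let ?B = "\<lambda>es :: 'a list. 2 * sz es + sz es * ((2 * sz es + sz es + 1) + 1) + 1"
  show "pbound ?B" by (intro pbound_intros)
  fix es ys zs :: "'a list" assume "rev es = zs @ ys"
  then have es: "es = rev ys @ rev zs" by (metis rev_append rev_rev_ident)
  let ?m = "length (rev ys)"
  have m: "?m \<le> sz es" using length_le_sz[of es] es by simp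
  have "sz p \<le> 2 * sz es + sz es + 1" if p: "p \<in> set (zip [0..<?m] (rev ys))" for p
  proof -
    obtain i where "i < length (zip [0..<?m] (rev ys))" "zip [0..<?m] (rev ys) ! i = p"
      using p unfolding in_set_conv_nth by (elim exE conjE) (rule that)
    then have "i < ?m" "p = (i, rev ys ! i)" by simp_all
    then have "fst p < ?m" "snd p \<in> set (rev ys)" by (simp_all only: fst_conv snd_conv nth_mem)
    then have "sz (fst p) \<le> 2 * sz es" "sz (snd p) \<le> sz es"
      using sz_nat_le[of "fst p"] m sz_member[of "snd p" es] by (simp_all add: es)
    then show ?thesis by (cases p) (simp add: sz_Pair)
  qed
  then have "sz (zip [0..<?m] (rev ys)) \<le> length (zip [0..<?m] (rev ys)) * ((2 * sz es + sz es + 1) + 1)"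
    by (intro sz_list_le) simp
  also have "\<dots> \<le> sz es * ((2 * sz es + sz es + 1) + 1)" by (rule mult_right_mono) (use m in simp_all)
  finally have "sz (?m, zip [0..<?m] (rev ys)) \<le> ?B es" using sz_nat_le[of ?m] m by (simp add: sz_Pair)
  moreover have "foldr (\<lambda>p s. (Suc (fst s), snd s @ [(fst s, p)])) ys (0, []) = (?m, zip [0..<?m] (rev ys))"
    using enumerate_edges[of "rev ys"] by (simp add: enumerate_edges_def)
  ultimately show "sz (foldr (\<lambda>p s. (Suc (fst s), snd s @ [(fst s, p)])) ys (0, [])) \<le> ?B es" by simp
qed (intro ptime_basic ptime_Suc)+

definition weighted_subgraphs :: "nat \<times> (nat \<times> nat) list \<Rightarrow> weighted_lists" where
  "weighted_subgraphs G = map (\<lambda>H. ((1, 9), map (\<lambda>e. fst e) H)) (subgraphs (snd (enumerate_edges (snd G))))"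

lemma ptime_weighted_subgraphs: "ptime weighted_subgraphs"
  unfolding weighted_subgraphs_def
  by (intro ptime_basic ptime_comp[OF ptime_subgraphs0] ptime_comp[OF ptime_enumerate_edges])

lemma enc_weighted_eq: "enc ws = enc_weighted ws"
  by (simp add: enc_weighted_def enc_list_inst enc_prod_def enc_nat_inst)

lemma enc_graph_eq: "enc (n, es) = enc_graph n es"
  by (simp add: enc_graph_def enc_list_inst enc_prod_def enc_nat_inst)

text \<open>The code placed at position 0 is itself a complete program, whose entry point is the
  body computing \<open>f\<close>. The size of the output is added to the time bound.\<close>

lemma ptime_runs_within:
  assumes "ptime f"
  shows "\<exists>P p. \<forall>x. runs_within P (enc x) (enc (f x)) (poly p (sz x))"
proof -
  obtain m c T where T: "pbound T" "\<And>P k. loaded P k (c k) \<Longrightarrow> calls P k f T" and sz: "pbound (\<lambda>x. sz (f x))"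
    using assms unfolding ptime_def by blast
  have "calls (c 0) 0 f T" by (rule T(2)) (simp add: loaded_def)
  moreover obtain p where "\<forall>x. T x + sz (f x) \<le> poly p (sz x)"
    using pbound_add[OF T(1) sz] unfolding pbound_def by blast
  ultimately have "runs_within (c 0) (enc x) (enc (f x)) (poly p (sz x))" for x
  proof -
    have "0 < length (c 0)" using \<open>calls (c 0) 0 f T\<close> by (simp add: calls_def)
    then have "c 0 \<noteq> []" by auto
    moreover obtain t where "t \<le> T x" "eval (c 0) [enc x] (c 0 ! 0) (enc (f x)) t"
      using callsE[OF \<open>calls (c 0) 0 f T\<close>] by blast
    moreover have "T x + sz (f x) \<le> poly p (sz x)" using \<open>\<forall>x. T x + sz (f x) \<le> poly p (sz x)\<close> by blast
    ultimately show ?thesis unfolding runs_within_def by (intro conjI exI[of _ t]) simp_all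
  qed
  then show ?thesis by blast
qed

lemma runs_within_mono: "runs_within P x y S \<Longrightarrow> S \<le> T \<Longrightarrow> runs_within P x y T"
  unfolding runs_within_def by (auto intro: le_trans)

text \<open>In a well-formed graph all ends are below \<open>n\<close>. With
  \<open>N = n + length es\<close> the parts add up to \<open>2 * N + N * (4 * N + 2) + 1\<close>,
  which is the polynomial stated.\<close>

lemma sz_graph:
  assumes "wf_graph (graph_of n es)"
  shows "sz (n, es) \<le> poly [:1, 4, 4:] (n + length es)"
proof -
  have "sz p \<le> 4 * n + 1" if "p \<in> set es" for p
  proof -
    obtain i where i: "i < length es" "p = es ! i" using \<open>p \<in> set es\<close> by (metis in_set_conv_nth)
    then have "{fst p, snd p} \<subseteq> {..<n}" using assms by (simp add: wf_graph_def graph_of_def)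
    then have "fst p < n" "snd p < n" by auto
    then show ?thesis using sz_nat_le[of "fst p"] sz_nat_le[of "snd p"] by (cases p) (simp add: sz_Pair)
  qed
  then have "sz es \<le> length es * ((4 * n + 1) + 1)" by (intro sz_list_le) simp
  also have "\<dots> \<le> (n + length es) * (4 * (n + length es) + 2)" by (intro mult_mono) simp_all
  finally have "sz es \<le> (n + length es) * (4 * (n + length es) + 2)" .
  then have "sz (n, es) \<le> 2 * (n + length es) + (n + length es) * (4 * (n + length es) + 2) + 1"
    using sz_nat_le[of n] by (simp add: sz_Pair)
  then show ?thesis by (simp add: algebra_simps)
qed

theorem theorem9:
  shows "(\<forall>G :: ('v, 'e) graph. wf_graph G \<and> cubic G \<and> edge_connected 3 G \<longrightarrow>
            (\<exists>c. dominated_2ec_combination G (\<lambda>e. 8 / 9) c)) \<and>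
         (\<exists>(P :: program) (p :: nat poly). \<forall>(n :: nat) (es :: (nat \<times> nat) list).
            wf_graph (graph_of n es) \<and> cubic (graph_of n es) \<and> edge_connected 3 (graph_of n es) \<longrightarrow>
            (\<exists>ws. runs_within P (enc_graph n es) (enc_weighted ws) (poly p (n + length es)) \<and>
                  positive_denominators ws \<and>
                  dominated_2ec_combination (graph_of n es) (\<lambda>e. 8 / 9) (weighted_sets ws)))"
proof (intro conjI allI impI)
  fix G :: "('v, 'e) graph" assume G: "wf_graph G \<and> cubic G \<and> edge_connected 3 G"
  then obtain E where "lists_graph G E" using exists_lists_graph[of G] by blast
  then have "dominated_2ec_combination G (\<lambda>e. 8 / 9) (map (\<lambda>H. (1 / 9, fst ` set H)) (subgraphs E))"
    by (intro subgraphs_combination) (use G in simp_all)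
  then show "\<exists>c. dominated_2ec_combination G (\<lambda>e. 8 / 9) c" ..
next
  obtain P p where run: "\<And>x. runs_within P (enc x) (enc (weighted_subgraphs x)) (poly p (sz x))"
    using ptime_runs_within[OF ptime_weighted_subgraphs] by blast
  show "\<exists>(P :: program) (p :: nat poly). \<forall>(n :: nat) (es :: (nat \<times> nat) list).
            wf_graph (graph_of n es) \<and> cubic (graph_of n es) \<and> edge_connected 3 (graph_of n es) \<longrightarrow>
            (\<exists>ws. runs_within P (enc_graph n es) (enc_weighted ws) (poly p (n + length es)) \<and>
                  positive_denominators ws \<and>
                  dominated_2ec_combination (graph_of n es) (\<lambda>e. 8 / 9) (weighted_sets ws))"
  \<comment> \<open>The time is polynomial in the encoded input, whose size is at most quadratic in
    the number of vertices and edges; composing the two polynomials gives the bound.\<close>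
  proof (intro exI[of _ P] exI[of _ "pcompose p [:1, 4, 4:]"] allI impI)
    fix n :: nat and es :: "(nat \<times> nat) list"
    assume G: "wf_graph (graph_of n es) \<and> cubic (graph_of n es) \<and> edge_connected 3 (graph_of n es)"
    let ?ws = "weighted_subgraphs (n, es)"
    have "poly p (sz (n, es)) \<le> poly (pcompose p [:1, 4, 4:]) (n + length es)"
      using poly_mono_nat[OF sz_graph[of n es]] G by (simp only: poly_pcompose)
    then have "runs_within P (enc_graph n es) (enc_weighted ?ws) (poly (pcompose p [:1, 4, 4:]) (n + length es))"
      using run[of "(n, es)"] unfolding enc_graph_eq enc_weighted_eq by (rule runs_within_mono[rotated])
    moreover have "positive_denominators ?ws"
      by (auto simp: positive_denominators_def weighted_subgraphs_def)
    moreover have "weighted_sets ?ws = map (\<lambda>H. (1 / 9, fst ` set H)) (subgraphs (zip [0..<length es] es))"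
      by (simp add: weighted_sets_def weighted_subgraphs_def enumerate_edges)
    then have "dominated_2ec_combination (graph_of n es) (\<lambda>e. 8 / 9) (weighted_sets ?ws)"
      using subgraphs_combination[OF _ _ _ lists_graph_of[of n es]] G by (simp only: simp_thms)
    ultimately show "\<exists>ws. runs_within P (enc_graph n es) (enc_weighted ws) (poly (pcompose p [:1, 4, 4:]) (n + length es)) \<and>
                  positive_denominators ws \<and>
                  dominated_2ec_combination (graph_of n es) (\<lambda>e. 8 / 9) (weighted_sets ws)"
      by blast
  qed
qed

end
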